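(* Let $G$ be a group acting (without inversions) on a tree $T$. Suppose that there is $M\in\mathbb{N}$ such that every vertex stabilizer is a free abelian group of rank at most $M$, that for every edge $e$ the stabilizer of $e$ is a direct factor of the stabilizers of both endpoints of $e$, and that for all $x,y,z\in G$, if $xy=yx$ and $zxz^{-1}=y$ then $x=y$. If $G$ is not solvable, then $G$ maps onto the non-abelian free group $\mathbb{F}_2$.
   Context: A tree is a connected oriented graph whose topological realization is contractible; a group action on an oriented graph acts on vertices and edges compatibly with the initial and terminal vertex maps (so no edge is inverted). *)

theory Defs
  imports "HOL-Algebra.Group_Action" "HOL-Algebra.Solvable_Groups" "HOL-Algebra.Free_Abelian_Groups"
begin

text \<open>An oriented graph: vertex set V, edge set E, initial vertex map ini and
terminal vertex map ter (no edge reversal, so no inversions are possible).\<close>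

definition oriented_graph :: "'v set \<Rightarrow> 'e set \<Rightarrow> ('e \<Rightarrow> 'v) \<Rightarrow> ('e \<Rightarrow> 'v) \<Rightarrow> bool" where
  "oriented_graph V E ini ter \<longleftrightarrow> (\<forall>e\<in>E. ini e \<in> V \<and> ter e \<in> V)"

definition graph_path :: "'v set \<Rightarrow> 'e set \<Rightarrow> ('e \<Rightarrow> 'v) \<Rightarrow> ('e \<Rightarrow> 'v) \<Rightarrow> 'v list \<Rightarrow> 'e list \<Rightarrow> bool" where
  "graph_path V E ini ter vs es \<longleftrightarrow>
     length vs = Suc (length es) \<and> set vs \<subseteq> V \<and>
     (\<forall>i < length es. es ! i \<in> E \<and> {ini (es ! i), ter (es ! i)} = {vs ! i, vs ! Suc i})"

definition reduced_path :: "'e list \<Rightarrow> bool" where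
  "reduced_path es \<longleftrightarrow> (\<forall>i. Suc i < length es \<longrightarrow> es ! i \<noteq> es ! Suc i)"

definition graph_connected :: "'v set \<Rightarrow> 'e set \<Rightarrow> ('e \<Rightarrow> 'v) \<Rightarrow> ('e \<Rightarrow> 'v) \<Rightarrow> bool" where
  "graph_connected V E ini ter \<longleftrightarrow> V \<noteq> {} \<and>
     (\<forall>u\<in>V. \<forall>w\<in>V. \<exists>vs es. graph_path V E ini ter vs es \<and> hd vs = u \<and> last vs = w)"

definition is_tree :: "'v set \<Rightarrow> 'e set \<Rightarrow> ('e \<Rightarrow> 'v) \<Rightarrow> ('e \<Rightarrow> 'v) \<Rightarrow> bool" where
  "is_tree V E ini ter \<longleftrightarrow> oriented_graph V E ini ter \<and> graph_connected V E ini ter \<and>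
     \<not> (\<exists>vs es. graph_path V E ini ter vs es \<and> es \<noteq> [] \<and> reduced_path es \<and> hd vs = last vs)"

definition graph_action ::
  "('g, 'b) monoid_scheme \<Rightarrow> 'v set \<Rightarrow> 'e set \<Rightarrow> ('e \<Rightarrow> 'v) \<Rightarrow> ('e \<Rightarrow> 'v)
     \<Rightarrow> ('g \<Rightarrow> 'v \<Rightarrow> 'v) \<Rightarrow> ('g \<Rightarrow> 'e \<Rightarrow> 'e) \<Rightarrow> bool" where
  "graph_action G V E ini ter \<phi>V \<phi>E \<longleftrightarrow>
     group_action G V \<phi>V \<and> group_action G E \<phi>E \<and>
     (\<forall>g\<in>carrier G. \<forall>e\<in>E. ini (\<phi>E g e) = \<phi>V g (ini e) \<and> ter (\<phi>E g e) = \<phi>V g (ter e))"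

definition free_abelian_rank_le :: "('a, 'b) monoid_scheme \<Rightarrow> nat \<Rightarrow> bool" where
  "free_abelian_rank_le H M \<longleftrightarrow> (\<exists>r \<le> M. H \<cong> free_Abelian_group {..<r})"

definition direct_factor :: "('a, 'b) monoid_scheme \<Rightarrow> 'a set \<Rightarrow> 'a set \<Rightarrow> bool" where
  "direct_factor G A B \<longleftrightarrow>
     (\<exists>C. normal A (G\<lparr>carrier := B\<rparr>) \<and> normal C (G\<lparr>carrier := B\<rparr>) \<and>
          A \<inter> C = {\<one>\<^bsub>G\<^esub>} \<and> A <#>\<^bsub>G\<^esub> C = B)"

text \<open>Words over generators of type bool (two generators); a letter (s, a) is the
generator a if s = True and its inverse if s = False. fred computes the freely
reduced form of a word.\<close>

fun fred :: "(bool \<times> 'a) list \<Rightarrow> (bool \<times> 'a) list" where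
  "fred [] = []"
| "fred (x # xs) = (case fred xs of
       [] \<Rightarrow> [x]
     | y # ys \<Rightarrow> (if fst x \<noteq> fst y \<and> snd x = snd y then ys else x # y # ys))"

definition free_group_F2 :: "(bool \<times> bool) list monoid" where
  "free_group_F2 = \<lparr> carrier = {w. fred w = w}, mult = (\<lambda>u v. fred (u @ v)), one = [] \<rparr>"

end

theory Submission
  imports Defs
begin

text \<open>A homomorphism from \<open>G\<close> to a group \<open>F\<close> can be glued from compatible homomorphisms on the vertex
stabilizers and labels of the edges in \<open>F\<close>: such data form a cocycle on the vertices, and since closed
walks in the tree have trivial holonomy, it is a coboundary up to a homomorphism. So we look for a
family of homomorphisms from the vertex stabilizers to the integers which vanishes on the stabilizer
of one edge \<open>e\<close> without being trivial. If \<open>e\<close> separates the quotient graph, the two sides are sent to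
powers of the two generators; otherwise \<open>e\<close> itself yields the second generator. Since edge stabilizers
are direct factors, a family given on a convex part of the quotient extends as soon as the quotient
without \<open>e\<close> is a forest.

If the quotient graph has two independent cycles, edge labels alone suffice. If it has one cycle and
some edge \<open>e\<close> of it is smaller than an adjacent vertex stabilizer, a homomorphism vanishing on \<open>e\<close> can
be carried once around the cycle: if \<open>t\<close> translates a lift of the cycle, an element fixing all edges of
a fundamental segment commutes with its conjugate by \<open>t\<close>, so by the hypothesis on commuting conjugates
it commutes with \<open>t\<close>. In the remaining cases, either all vertex stabilizers are contained in a single
one, which is then central with cyclic quotient (and \<open>G\<close> is solvable), or there is a minimal walk
between two vertices whose stabilizers are larger than the adjacent edge stabilizer. All stabilizers
in the interior of that walk coincide, so neither it nor its prolongations along decreasing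
stabilizers can backtrack in the quotient, and this produces the required family.\<close>

subsection \<open>The free group of rank two\<close>

text \<open>The quotient graph is never formed: its paths are read off from a relation on the
  vertices of the tree. It may be infinite, so partial families are enlarged by Zorn's lemma, and
  this forces extension over an edge to be exact. Retractions onto direct factors achieve that. In
  contrast, prescribing a homomorphism on two subgroups at once costs an integral multiple, because
  their product need not be a direct factor; this happens only along one finite walk. The lost
  multiples are harmless, since surjectivity is restored at the end by dividing by a gcd.
  Conjugation by elements of an abelian vertex stabilizer acts trivially on it, so a homomorphism at
  one vertex determines a unique equivariant family on its orbit. The bound \<open>M\<close> serves
  to choose a vertex whose stabilizer is largest, measured by the number of homomorphisms to the
  group of order two. The hypothesis on commuting conjugates turns inclusions between conjugate
  vertex stabilizers into equalities.\<close>

definition F_red :: "bool \<times> 'a \<Rightarrow> (bool \<times> 'a) list \<Rightarrow> (bool \<times> 'a) list" where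
  "F_red x w = (case w of [] \<Rightarrow> [x]
     | y # ys \<Rightarrow> (if fst x \<noteq> fst y \<and> snd x = snd y then ys else x # y # ys))"

abbreviation flip_letter :: "bool \<times> 'a \<Rightarrow> bool \<times> 'a" where
  "flip_letter x \<equiv> (\<not> fst x, snd x)"

lemma fred_Cons: "fred (x # xs) = F_red x (fred xs)"
  by (simp add: F_red_def)

declare fred.simps(2) [simp del]

text \<open>Words act on reduced words letter by letter. The group laws are derived from this action
  (van der Waerden's argument) instead of from confluence of the cancellations.\<close>

lemma fred_append: "fred (u @ v) = foldr F_red u (fred v)"
  by (induction u) (auto simp: fred_Cons)

text \<open>If \<open>x\<close> cancelled against the head of \<open>fred xs\<close>, the remaining
  tail would have to be \<open>x # xs\<close>, which is longer than \<open>fred\<close> can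
  produce.\<close>

lemma fred_tl: "fred (x # xs) = x # xs \<Longrightarrow> fred xs = xs"
proof -
  have len: "length (fred ys) \<le> length ys" for ys :: "(bool \<times> 'a) list"
    by (induction ys) (auto simp: fred_Cons F_red_def split: list.splits)
  assume h: "fred (x # xs) = x # xs"
  show ?thesis
  proof (cases "fred xs")
    case Nil
    then show ?thesis using h by (auto simp: fred_Cons F_red_def)
  next
    case (Cons y ys)
    show ?thesis
    proof (cases "fst x \<noteq> fst y \<and> snd x = snd y")
      case True
      then have "ys = x # xs" using h Cons by (auto simp: fred_Cons F_red_def)
      then show ?thesis using len[of xs] Cons by auto
    next
      case False
      then show ?thesis using h Cons by (auto simp: fred_Cons F_red_def split: if_splits)
    qed
  qed
qed

text \<open>Each letter thus permutes the reduced words. If the flipped letter cancels the head of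
  \<open>w\<close>, then \<open>x\<close> puts it back, because \<open>w\<close> is reduced and
  \<open>x\<close> cannot cancel further.\<close>

lemma F_red_inverse:
  assumes "fred w = w"
  shows "F_red x (F_red (flip_letter x) w) = w"
proof (cases w)
  case Nil
  then show ?thesis by (simp add: F_red_def)
next
  case (Cons y ys)
  have fy: "fred ys = ys" using assms Cons fred_tl by blast
  show ?thesis
  proof (cases "y = x")
    case True
    have "F_red (flip_letter x) w = ys" using Cons True by (simp add: F_red_def)
    moreover have "F_red x ys = w" using assms fy Cons True by (metis fred_Cons)
    ultimately show ?thesis by simp
  next
    case False
    then have "F_red (flip_letter x) w = flip_letter x # w"
      using Cons by (auto simp: F_red_def prod_eq_iff)
    then show ?thesis by (simp add: F_red_def)
  qed
qed

lemma fred_F_red: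
  assumes "fred w = w"
  shows "fred (F_red x w) = F_red x w"
proof (cases w)
  case Nil
  then show ?thesis by (simp add: fred_Cons F_red_def)
next
  case (Cons y ys)
  show ?thesis
  proof (cases "fst x \<noteq> fst y \<and> snd x = snd y")
    case True
    have "fred ys = ys" using Cons assms fred_tl by blast
    then show ?thesis using Cons True by (simp add: F_red_def)
  next
    case False
    then have "F_red x w = x # w" using Cons by (auto simp: F_red_def)
    then show ?thesis using assms by (simp add: fred_Cons)
  qed
qed

lemma fred_idem: "fred (fred w) = fred w"
  by (induction w) (simp_all add: fred_Cons fred_F_red)

lemma foldr_F_red_reduced: "fred w = w \<Longrightarrow> fred (foldr F_red u w) = foldr F_red u w"
  by (induction u) (auto simp: fred_F_red)

text \<open>The action of a word depends only on its reduced form, since a cancelling pair of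
  letters acts as the identity. Associativity follows from this.\<close>

lemma foldr_F_red_fred:
  assumes "fred w = w"
  shows "foldr F_red (fred u) w = foldr F_red u w"
proof (induction u)
  case Nil
  then show ?case by simp
next
  case (Cons x u)
  show ?case
  proof (cases "fred u")
    case Nil
    then have "fred (x # u) = [x]" by (simp add: fred_Cons F_red_def)
    then show ?thesis using Cons Nil by simp
  next
    case F: (Cons y ys)
    show ?thesis
    proof (cases "fst x \<noteq> fst y \<and> snd x = snd y")
      case True
      then have y: "y = flip_letter x" by (auto simp: prod_eq_iff)
      have "foldr F_red (fred (x # u)) w = foldr F_red ys w"
        using F True by (simp add: fred_Cons F_red_def)
      also have "\<dots> = F_red x (F_red y (foldr F_red ys w))"
        using F_red_inverse[OF foldr_F_red_reduced[OF assms], of x] y by simp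
      also have "\<dots> = F_red x (foldr F_red u w)" using Cons F by simp
      finally show ?thesis by simp
    next
      case False
      then have "fred (x # u) = x # fred u" using F by (auto simp: fred_Cons F_red_def)
      then show ?thesis using Cons by (simp)
    qed
  qed
qed

lemma fred_append_left: "fred (fred u @ v) = fred (u @ v)"
  by (simp add: fred_append foldr_F_red_fred fred_idem)

lemma fred_append_right: "fred (u @ fred v) = fred (u @ v)"
  by (simp add: fred_append fred_idem)

lemma fred_inverse: "fred (rev (map flip_letter w) @ w) = []"
proof (induction w)
  case Nil
  then show ?case by simp
next
  case (Cons x w)
  have "fred (rev (map flip_letter (x # w)) @ x # w)
      = foldr F_red (rev (map flip_letter w)) (F_red (flip_letter x) (F_red x (fred w)))"
    by (simp add: fred_append fred_Cons)
  also have "\<dots> = foldr F_red (rev (map flip_letter w)) (fred w)"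
    using F_red_inverse[OF fred_idem, of "flip_letter x" w] by simp
  also have "\<dots> = []" using Cons by (simp add: fred_append)
  finally show ?case .
qed

lemma group_free_group_F2: "group free_group_F2"
proof (rule groupI)
  fix x y z
  assume x: "x \<in> carrier free_group_F2" and y: "y \<in> carrier free_group_F2"
    and z: "z \<in> carrier free_group_F2"
  show "x \<otimes>\<^bsub>free_group_F2\<^esub> y \<in> carrier free_group_F2"
    by (simp add: free_group_F2_def fred_idem)
  show "x \<otimes>\<^bsub>free_group_F2\<^esub> y \<otimes>\<^bsub>free_group_F2\<^esub> z
      = x \<otimes>\<^bsub>free_group_F2\<^esub> (y \<otimes>\<^bsub>free_group_F2\<^esub> z)"
    by (simp add: free_group_F2_def fred_append_left fred_append_right)
next
  fix x :: "(bool \<times> bool) list"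
  assume x: "x \<in> carrier free_group_F2"
  show "\<one>\<^bsub>free_group_F2\<^esub> \<otimes>\<^bsub>free_group_F2\<^esub> x = x"
    using x by (simp add: free_group_F2_def)
  show "\<exists>y\<in>carrier free_group_F2. y \<otimes>\<^bsub>free_group_F2\<^esub> x = \<one>\<^bsub>free_group_F2\<^esub>"
    by (rule bexI[of _ "fred (rev (map flip_letter x))"])
      (auto simp: free_group_F2_def fred_append_left fred_inverse fred_idem)
qed (simp add: free_group_F2_def)

definition gen_F2 :: "bool \<Rightarrow> (bool \<times> bool) list" where
  "gen_F2 s = [(True, s)]"

lemma gen_F2_closed: "gen_F2 s \<in> carrier free_group_F2"
  by (simp add: gen_F2_def free_group_F2_def fred_Cons F_red_def)

lemma inv_gen_F2: "inv\<^bsub>free_group_F2\<^esub> gen_F2 s = [(False, s)]"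
  by (rule group.inv_equality[OF group_free_group_F2])
    (auto simp: gen_F2_def free_group_F2_def fred_Cons F_red_def)

lemma subgroup_F2_eq:
  assumes S: "subgroup S free_group_F2" and gen: "\<And>s. gen_F2 s \<in> S"
  shows "S = carrier free_group_F2"
proof
  show "S \<subseteq> carrier free_group_F2" using S subgroup.subset by blast
  have "w \<in> S" if "fred w = w" for w
    using that
  proof (induction w)
    case Nil
    show ?case using subgroup.one_closed[OF S] by (simp add: free_group_F2_def)
  next
    case (Cons x w)
    have fw: "fred w = w" using Cons.prems fred_tl by blast
    have "[x] \<in> S"
    proof (cases "fst x")
      case True
      then show ?thesis using gen[of "snd x"] by (cases x) (auto simp: gen_F2_def)
    next
      case False
      then show ?thesis using subgroup.m_inv_closed[OF S gen[of "snd x"]]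
        by (cases x) (auto simp: inv_gen_F2)
    qed
    then have "[x] \<otimes>\<^bsub>free_group_F2\<^esub> w \<in> S"
      using Cons.IH[OF fw] subgroup.m_closed[OF S] by blast
    moreover have "[x] \<otimes>\<^bsub>free_group_F2\<^esub> w = fred (x # w)"
      by (simp add: free_group_F2_def)
    ultimately show ?case using Cons.prems by simp
  qed
  then show "carrier free_group_F2 \<subseteq> S" by (auto simp: free_group_F2_def)
qed

lemma one_F2_closed: "\<one>\<^bsub>free_group_F2\<^esub> \<in> carrier free_group_F2"
  using group_free_group_F2 by (simp add: group.is_monoid monoid.one_closed)

text \<open>Bezout's identity for a possibly infinite set: \<open>d\<close> is the gcd, so the
  quotients have gcd 1, and a nonempty set closed under differences is an ideal. It is applied with
  \<open>J\<close> the set of exponents for which the power of a free generator lies in the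
  image.\<close>

lemma normalize_int_set:
  fixes S :: "int set"
  assumes "s0 \<in> S" "s0 \<noteq> 0"
  obtains d where "d \<noteq> 0" "\<And>s. s \<in> S \<Longrightarrow> d dvd s"
    "\<And>J. (\<And>a b. a \<in> J \<Longrightarrow> b \<in> J \<Longrightarrow> a - b \<in> J) \<Longrightarrow> (\<And>s. s \<in> S \<Longrightarrow> s div d \<in> J) \<Longrightarrow> (1::int) \<in> J"
proof -
  define d where "d = Gcd S"
  have d0: "d \<noteq> 0" using assms by (auto simp: d_def)
  have dd: "d dvd s" if "s \<in> S" for s using that by (simp add: d_def)
  have "1 \<in> J" if J: "\<And>a b. a \<in> J \<Longrightarrow> b \<in> J \<Longrightarrow> a - b \<in> J" and S: "\<And>s. s \<in> S \<Longrightarrow> s div d \<in> J" for J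
  proof -
    have J0: "0 \<in> J" using J[of "s0 div d" "s0 div d"] S assms by simp
    have Jn: "- a \<in> J" if "a \<in> J" for a using J[OF J0 that] by simp
    have Jp: "a + b \<in> J" if "a \<in> J" "b \<in> J" for a b using J[OF that(1) Jn[OF that(2)]] by simp
    have Jm: "int n * a \<in> J" if "a \<in> J" for n a
      by (induction n) (use that J0 Jp in \<open>auto simp: algebra_simps\<close>)
    have Jz: "k * a \<in> J" if "a \<in> J" for k a
    proof (cases k rule: int_cases2)
      case (nonneg n)
      then show ?thesis using Jm[OF that] by simp
    next
      case (nonpos n)
      then show ?thesis using Jn[OF Jm[OF that, of n]] by simp
    qed
    have "s0 div d \<in> J" "s0 div d \<noteq> 0" using S assms dd[OF assms(1)] by auto
    then have "\<exists>n. n > 0 \<and> int n \<in> J"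
      using Jn[of "s0 div d"] by (intro exI[of _ "nat \<bar>s0 div d\<bar>"]) (auto simp: abs_if)
    \<comment> \<open>The least positive element \<open>m\<close> divides all of \<open>J\<close>.
      Hence \<open>m * d\<close> divides all of \<open>S\<close> and therefore \<open>d\<close>,
      which leaves only \<open>m = 1\<close>.\<close>
    then obtain m where m: "m > 0" "int m \<in> J" and min: "\<And>n. n > 0 \<Longrightarrow> int n \<in> J \<Longrightarrow> m \<le> n"
      unfolding exists_least_iff[of "\<lambda>n. n > 0 \<and> int n \<in> J"] using not_le by blast
    have mdvd: "int m dvd a" if "a \<in> J" for a
    proof (rule ccontr)
      assume n: "\<not> int m dvd a"
      have "a mod int m = a - (a div int m) * int m" by (rule minus_div_mult_eq_mod[symmetric])
      then have "a mod int m \<in> J" using J[OF that Jz[OF m(2)]] by simp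
      moreover have "a mod int m \<noteq> 0" using n by (simp add: dvd_eq_mod_eq_0)
      then have "a mod int m > 0" using pos_mod_sign[of "int m" a] m(1) by linarith
      moreover have "a mod int m < int m" using m(1) by simp
      ultimately show False using min[of "nat (a mod int m)"] by auto
    qed
    have "int m * d dvd s" if "s \<in> S" for s
      using mdvd[OF S[OF that]] dd[OF that] d0 by (metis dvd_div_iff_mult)
    then have "int m * d dvd d" unfolding d_def by (intro Gcd_greatest)
    then have "int m dvd 1" using d0 by (metis dvd_times_right_cancel_iff mult.left_neutral)
    then show ?thesis using m by auto
  qed
  then show ?thesis using that d0 dd by blast
qed

subsection \<open>Free abelian subgroups\<close>

context group begin

section \<open>Homomorphisms to the integers\<close>

definition zhom :: "'a set \<Rightarrow> ('a \<Rightarrow> int) \<Rightarrow> bool" where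
  "zhom B \<chi> \<longleftrightarrow> (\<forall>x\<in>B. \<forall>y\<in>B. \<chi> (x \<otimes> y) = \<chi> x + \<chi> y)"

lemma zhomD: "zhom B \<chi> \<Longrightarrow> x \<in> B \<Longrightarrow> y \<in> B \<Longrightarrow> \<chi> (x \<otimes> y) = \<chi> x + \<chi> y"
  by (simp add: zhom_def)

lemma zhom_one: "zhom B \<chi> \<Longrightarrow> subgroup B G \<Longrightarrow> \<chi> \<one> = 0"
  using zhomD[of B \<chi> \<one> \<one>] subgroup.one_closed[of B G] by simp

lemma inv_mult_eq:
  assumes "a \<in> carrier G" "a' \<in> carrier G" "c \<in> carrier G" "c' \<in> carrier G"
    and "a \<otimes> c = a' \<otimes> c'"
  shows "inv a' \<otimes> a = c' \<otimes> inv c"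
proof -
  have "a = a \<otimes> c \<otimes> inv c" using assms(1-4) by (simp add: m_assoc)
  also have "\<dots> = a' \<otimes> (c' \<otimes> inv c)" unfolding assms(5) using assms by (simp add: m_assoc)
  finally have "inv a' \<otimes> a = inv a' \<otimes> (a' \<otimes> (c' \<otimes> inv c))" by simp
  also have "\<dots> = c' \<otimes> inv c" using assms by (simp add: m_assoc[symmetric])
  finally show ?thesis .
qed

lemma zhom_inv:
  assumes "zhom B \<chi>" "subgroup B G" "x \<in> B"
  shows "\<chi> (inv x) = - \<chi> x"
proof -
  have "x \<in> carrier G" using subgroup.mem_carrier[OF assms(2,3)] .
  then have "\<chi> x + \<chi> (inv x) = \<chi> \<one>"
    using zhomD[of B \<chi> x "inv x"] assms subgroup.m_inv_closed[OF assms(2,3)] by simp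
  then show ?thesis using zhom_one[OF assms(1,2)] by simp
qed

lemma subgroup_int_pow_closed:
  assumes "subgroup B G" "x \<in> B"
  shows "x [^] (n::int) \<in> B"
proof -
  have nat: "x [^] (m::nat) \<in> B" for m
    using subgroup.one_closed[OF assms(1)] subgroup.m_closed[OF assms(1) _ assms(2)]
    by (induction m) auto
  show ?thesis
  proof (cases n rule: int_cases2)
    case (nonneg m)
    then show ?thesis using nat[of m] by (simp add: int_pow_int)
  next
    case (nonpos m)
    then show ?thesis using subgroup.m_inv_closed[OF assms(1) nat[of m]] subgroup.mem_carrier[OF assms]
      by (simp add: int_pow_neg_int)
  qed
qed

lemma zhom_int_pow:
  assumes "zhom B \<chi>" "subgroup B G" "x \<in> B"
  shows "\<chi> (x [^] (n::int)) = n * \<chi> x"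
proof -
  have x: "x \<in> carrier G" using subgroup.mem_carrier[OF assms(2,3)] .
  have np: "x [^] (m::nat) \<in> B" for m
    using subgroup_int_pow_closed[OF assms(2,3), of "int m"] by (simp add: int_pow_int)
  have nat: "\<chi> (x [^] (m::nat)) = int m * \<chi> x" for m
  proof (induction m)
    case 0
    then show ?case using zhom_one assms by simp
  next
    case (Suc m)
    then show ?case using zhomD[OF assms(1) np[of m] assms(3)] by (simp add: algebra_simps)
  qed
  show ?thesis
  proof (cases n rule: int_cases2)
    case (nonneg m)
    then show ?thesis using nat[of m] by (simp add: int_pow_int)
  next
    case (nonpos m)
    then show ?thesis using nat[of m] zhom_inv[OF assms(1,2) np[of m]] x by (simp add: int_pow_neg_int)
  qed
qed

lemma zhom_subset: "zhom B \<chi> \<Longrightarrow> C \<subseteq> B \<Longrightarrow> zhom C \<chi>"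
  by (auto simp: zhom_def)

text \<open>The integral multiple is unavoidable: a power of \<open>x\<close> may already lie in \<open>P\<close>.\<close>

lemma zhom_extend_generator:
  assumes P: "subgroup P G" and \<psi>: "zhom P \<psi>" and x: "x \<in> carrier G"
    and comm: "\<And>p. p \<in> P \<Longrightarrow> p \<otimes> x = x \<otimes> p"
  obtains k Q \<chi> where "k > (0::int)" "subgroup Q G" "P \<subseteq> Q" "x \<in> Q" "zhom Q \<chi>"
    "\<And>p. p \<in> P \<Longrightarrow> \<chi> p = k * \<psi> p" "Q \<subseteq> {p \<otimes> x [^] (n::int) | p n. p \<in> P}"
proof -
  \<comment> \<open>The extension will send \<open>p \<otimes> x [^] n\<close> to
    \<open>k * \<psi> p + n * q\<close>; ambiguity can come only from powers of \<open>x\<close> in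
    \<open>P\<close>. If \<open>x [^] m\<close> lies in \<open>P\<close>, then \<open>k = m\<close>
    and \<open>q = \<psi> (x [^] m)\<close> are consistent; if no positive power does,
    \<open>k = 1\<close> and \<open>q = 0\<close> are.\<close>
  obtain k q where k: "k > (0::int)" and q: "\<And>j::int. x [^] j \<in> P \<Longrightarrow> k * \<psi> (x [^] j) = j * q"
  proof (cases "\<exists>m>0::int. x [^] m \<in> P")
    case True
    then obtain m :: int where m: "m > 0" "x [^] m \<in> P" by auto
    have "m * \<psi> (x [^] j) = j * \<psi> (x [^] m)" if j: "x [^] j \<in> P" for j :: int
    proof -
      have "(x [^] j) [^] m = (x [^] m) [^] j" using x by (simp add: int_pow_pow mult.commute)
      then show ?thesis using zhom_int_pow[OF \<psi> P] m(2) j by metis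
    qed
    then show ?thesis using that m by blast
  next
    case False
    have "j = 0" if j: "x [^] j \<in> P" for j :: int
    proof (rule ccontr)
      assume "j \<noteq> 0"
      then have "j > 0 \<or> - j > 0" by auto
      moreover have "x [^] (- j) \<in> P" using j P x by (simp add: int_pow_neg subgroup.m_inv_closed)
      ultimately show False using j False by blast
    qed
    then show ?thesis using that[of 1 0] zhom_one[OF \<psi> P] by force
  qed
  define Q where "Q = {p \<otimes> x [^] (n::int) | p n. p \<in> P}"
  have Pc: "p \<in> carrier G" if "p \<in> P" for p using subgroup.mem_carrier[OF P that] .
  have comm': "x [^] (n::int) \<otimes> p = p \<otimes> x [^] n" if "p \<in> P" for p n
  proof -
    have nat: "x [^] (m::nat) \<otimes> p = p \<otimes> x [^] m" for m
    proof (induction m)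
      case 0 then show ?case using Pc that by simp
    next
      case (Suc m)
      have "x [^] Suc m \<otimes> p = x [^] m \<otimes> (x \<otimes> p)" using x Pc[OF that] by (simp add: m_assoc)
      also have "\<dots> = (x [^] m \<otimes> p) \<otimes> x" using comm[OF that] x Pc[OF that] by (simp add: m_assoc)
      also have "\<dots> = p \<otimes> x [^] Suc m" using Suc x Pc[OF that] by (simp add: m_assoc)
      finally show ?case .
    qed
    show ?thesis
    proof (cases n rule: int_cases2)
      case (nonneg m)
      then show ?thesis using nat[of m] by (simp add: int_pow_int)
    next
      case (nonpos m)
      have c: "inv y \<otimes> p = p \<otimes> inv y" if y: "y \<in> carrier G" and "y \<otimes> p = p \<otimes> y" for y
        using inv_mult_eq[of p y y p] that Pc[OF \<open>p \<in> P\<close>] by simp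
      show ?thesis using nonpos c[OF _ nat[of m]] x by (simp add: int_pow_neg_int)
    qed
  qed
  have mul: "(p \<otimes> x [^] (n::int)) \<otimes> (p' \<otimes> x [^] (n'::int)) = (p \<otimes> p') \<otimes> x [^] (n + n')"
    if "p \<in> P" "p' \<in> P" for p p' n n'
    using that Pc x comm'[OF that(2), of n]
    by (smt (verit) int_pow_closed int_pow_mult m_assoc m_closed)
  have subQ: "subgroup Q G"
  proof (rule subgroupI)
    show "Q \<subseteq> carrier G" using Pc x by (auto simp: Q_def)
    show "Q \<noteq> {}" using subgroup.one_closed[OF P] by (auto simp: Q_def)
  next
    fix a assume "a \<in> Q"
    then obtain p n where a: "a = p \<otimes> x [^] (n::int)" "p \<in> P" by (auto simp: Q_def)
    have "inv a = inv p \<otimes> x [^] (-n)"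
      using a x Pc comm'[of "inv p" "-n"] subgroup.m_inv_closed[OF P a(2)]
      by (simp add: inv_mult_group int_pow_neg)
    then show "inv a \<in> Q" using subgroup.m_inv_closed[OF P a(2)] by (auto simp: Q_def)
  next
    fix a b assume "a \<in> Q" "b \<in> Q"
    then show "a \<otimes> b \<in> Q" using mul subgroup.m_closed[OF P] unfolding Q_def by blast
  qed
  have PQ: "P \<subseteq> Q"
  proof
    fix p assume "p \<in> P"
    then show "p \<in> Q" using Pc[of p] unfolding Q_def by (auto intro!: exI[of _ p] exI[of _ "0::int"])
  qed
  have xQ: "x \<in> Q" using subgroup.one_closed[OF P] x unfolding Q_def
    by (auto intro!: exI[of _ \<one>] exI[of _ "1::int"] simp: int_pow_1)
  define \<chi> where "\<chi> y = (THE z. \<exists>p n. p \<in> P \<and> y = p \<otimes> x [^] (n::int) \<and> z = k * \<psi> p + n * q)" for y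
  have \<chi>: "\<chi> (p \<otimes> x [^] n) = k * \<psi> p + n * q" if p: "p \<in> P" for p and n :: int
    unfolding \<chi>_def
  proof (rule the_equality)
    show "\<exists>pa na. pa \<in> P \<and> p \<otimes> x [^] n = pa \<otimes> x [^] (na::int) \<and> k * \<psi> p + n * q = k * \<psi> pa + na * q"
      using p by blast
  next
    fix z assume "\<exists>pa na. pa \<in> P \<and> p \<otimes> x [^] n = pa \<otimes> x [^] (na::int) \<and> z = k * \<psi> pa + na * q"
    then obtain p' n' where p': "p' \<in> P" "p \<otimes> x [^] n = p' \<otimes> x [^] (n'::int)" "z = k * \<psi> p' + n' * q"
      by blast
    have "x [^] (n' - n) = inv p' \<otimes> p"
    proof -
      have "inv p' \<otimes> p = x [^] n' \<otimes> inv (x [^] n)"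
        using p' p Pc x by (intro inv_mult_eq) auto
      then show ?thesis using x by (simp add: int_pow_diff)
    qed
    moreover have ip: "inv p' \<in> P" using subgroup.m_inv_closed[OF P p'(1)] .
    ultimately have "k * \<psi> (inv p' \<otimes> p) = (n' - n) * q"
      using q[of "n' - n"] p subgroup.m_closed[OF P] by metis
    moreover have "\<psi> (inv p' \<otimes> p) = \<psi> p - \<psi> p'"
      using zhomD[OF \<psi> ip p] zhom_inv[OF \<psi> P p'(1)] by simp
    ultimately show "z = k * \<psi> p + n * q" using p'(3) by (simp add: algebra_simps)
  qed
  have "zhom Q \<chi>"
    unfolding zhom_def Q_def
  proof clarify
    fix p p' and n n' :: int assume pp: "p \<in> P" "p' \<in> P"
    have "\<chi> (p \<otimes> x [^] n \<otimes> (p' \<otimes> x [^] n')) = k * \<psi> (p \<otimes> p') + (n + n') * q"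
      unfolding mul[OF pp] using \<chi> subgroup.m_closed[OF P] pp by blast
    then show "\<chi> (p \<otimes> x [^] n \<otimes> (p' \<otimes> x [^] n')) = \<chi> (p \<otimes> x [^] n) + \<chi> (p' \<otimes> x [^] n')"
      using \<chi> pp zhomD[OF \<psi>] by (simp add: algebra_simps)
  qed
  moreover have "\<chi> p = k * \<psi> p" if "p \<in> P" for p
    using \<chi>[OF that, of 0] Pc[OF that] by simp
  ultimately show ?thesis using that k subQ PQ xQ by (auto simp: Q_def)
qed

text \<open>The generators in \<open>X\<close> are adjoined one at a time and the scale factors
  multiply; finiteness of \<open>X\<close> keeps their product an integer.\<close>

lemma zhom_extend_generators:
  assumes B: "subgroup B G" and comm: "\<And>x y. x \<in> B \<Longrightarrow> y \<in> B \<Longrightarrow> x \<otimes> y = y \<otimes> x"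
    and X: "finite X" "X \<subseteq> B" "\<And>Q. subgroup Q G \<Longrightarrow> X \<subseteq> Q \<Longrightarrow> B \<subseteq> Q"
    and P: "subgroup P G" "P \<subseteq> B" and \<psi>: "zhom P \<psi>"
  obtains k \<chi> where "k > (0::int)" "zhom B \<chi>" "\<And>p. p \<in> P \<Longrightarrow> \<chi> p = k * \<psi> p"
proof -
  have "\<exists>k Q \<chi>. k > (0::int) \<and> subgroup Q G \<and> P \<subseteq> Q \<and> X \<subseteq> Q \<and> Q \<subseteq> B \<and> zhom Q \<chi> \<and> (\<forall>p\<in>P. \<chi> p = k * \<psi> p)"
    using X(1,2)
  proof (induction X)
    case empty
    show ?case using P \<psi> by (auto intro!: exI[of _ 1] exI[of _ P] exI[of _ \<psi>])
  next
    case (insert x X)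
    then obtain k Q \<chi> where Q: "k > (0::int)" "subgroup Q G" "P \<subseteq> Q" "X \<subseteq> Q" "Q \<subseteq> B" "zhom Q \<chi>"
      "\<forall>p\<in>P. \<chi> p = k * \<psi> p" by auto
    have x: "x \<in> B" "x \<in> carrier G" using insert.prems subgroup.mem_carrier[OF B] by auto
    obtain k' Q' \<chi>' where Q': "k' > (0::int)" "subgroup Q' G" "Q \<subseteq> Q'" "x \<in> Q'" "zhom Q' \<chi>'"
      "\<And>p. p \<in> Q \<Longrightarrow> \<chi>' p = k' * \<chi> p" "Q' \<subseteq> {p \<otimes> x [^] (n::int) | p n. p \<in> Q}"
      by (rule zhom_extend_generator[OF Q(2,6) x(2)]) (use comm x(1) Q(5) in auto)
    have "Q' \<subseteq> B" using Q'(7) Q(5) subgroup_int_pow_closed[OF B x(1)] subgroup.m_closed[OF B] by blast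
    then show ?case using Q Q' insert
      by (intro exI[of _ "k' * k"] exI[of _ Q'] exI[of _ \<chi>']) auto
  qed
  then obtain k Q \<chi> where Q: "k > (0::int)" "subgroup Q G" "P \<subseteq> Q" "X \<subseteq> Q" "Q \<subseteq> B" "zhom Q \<chi>"
      "\<forall>p\<in>P. \<chi> p = k * \<psi> p" by blast
  have "Q = B" using X(3)[OF Q(2,4)] Q(5) by auto
  then show ?thesis using that Q by blast
qed

text \<open>\<open>B\<close> is free abelian of finite rank, in the form in which this is used: generators and
separation by homomorphisms to the integers.\<close>

definition fab :: "nat \<Rightarrow> 'a set \<Rightarrow> bool" where
  "fab M B \<longleftrightarrow> subgroup B G \<and> (\<forall>x\<in>B. \<forall>y\<in>B. x \<otimes> y = y \<otimes> x) \<and>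
     (\<exists>X. finite X \<and> card X \<le> M \<and> X \<subseteq> B \<and> (\<forall>Q. subgroup Q G \<longrightarrow> X \<subseteq> Q \<longrightarrow> B \<subseteq> Q)) \<and>
     (\<forall>x\<in>B. x \<noteq> \<one> \<longrightarrow> (\<exists>\<chi>. zhom B \<chi> \<and> \<chi> x \<noteq> 0))"

text \<open>The coordinates of the isomorphism are the separating homomorphisms, and the preimages
  of the basis vectors are the generators. Coordinates determine elements, which also gives
  commutativity.\<close>

lemma fab_if_free_abelian:
  assumes B: "subgroup B G" and fr: "free_abelian_rank_le (G\<lparr>carrier := B\<rparr>) M"
  shows "fab M B"
proof -
  obtain r where r: "r \<le> M" and "G\<lparr>carrier := B\<rparr> \<cong> free_Abelian_group {..<r}"
    using fr by (auto simp: free_abelian_rank_le_def)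
  then obtain \<phi> where \<phi>: "\<phi> \<in> iso (G\<lparr>carrier := B\<rparr>) (free_Abelian_group {..<r})"
    by (auto simp: is_iso_def)
  have bij: "bij_betw \<phi> B {c. Poly_Mapping.keys c \<subseteq> {..<r}}"
    using \<phi> by (auto simp: iso_def free_Abelian_group_def)
  have hom: "\<phi> (x \<otimes> y) = \<phi> x + \<phi> y" if "x \<in> B" "y \<in> B" for x y
    using \<phi> that by (auto simp: iso_def hom_def)
  define \<kappa> where "\<kappa> i x = Poly_Mapping.lookup (\<phi> x) i" for i x
  have \<kappa>: "zhom B (\<kappa> i)" for i by (simp add: zhom_def \<kappa>_def hom lookup_add)
  have keys: "Poly_Mapping.keys (\<phi> x) \<subseteq> {..<r}" if "x \<in> B" for x
    using bij that by (auto simp: bij_betw_def)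
  have inj: "x = y" if "x \<in> B" "y \<in> B" "\<And>i. i < r \<Longrightarrow> \<kappa> i x = \<kappa> i y" for x y
  proof -
    have "Poly_Mapping.lookup (\<phi> x) i = Poly_Mapping.lookup (\<phi> y) i" for i
    proof (cases "i < r")
      case True
      then show ?thesis using that(3)[of i] by (simp add: \<kappa>_def)
    next
      case False
      then have "i \<notin> Poly_Mapping.keys (\<phi> x)" "i \<notin> Poly_Mapping.keys (\<phi> y)"
        using keys[OF that(1)] keys[OF that(2)] by auto
      then show ?thesis by (simp add: in_keys_iff)
    qed
    then have "\<phi> x = \<phi> y" by (rule poly_mapping_eqI)
    then show ?thesis using bij that by (auto simp: bij_betw_def inj_on_def)
  qed
  have "\<exists>x\<in>B. \<phi> x = frag_of i" if "i < r" for i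
  proof -
    have "frag_of i \<in> \<phi> ` B" using bij that by (auto simp: bij_betw_def)
    then show ?thesis by (metis imageE)
  qed
  then obtain g where g: "\<And>i. i < r \<Longrightarrow> g i \<in> B \<and> \<phi> (g i) = frag_of i" by metis
  have comm: "x \<otimes> y = y \<otimes> x" if "x \<in> B" "y \<in> B" for x y
  proof (rule inj)
    show "x \<otimes> y \<in> B" "y \<otimes> x \<in> B" using that subgroup.m_closed[OF B] by auto
    show "\<kappa> i (x \<otimes> y) = \<kappa> i (y \<otimes> x)" for i using zhomD[OF \<kappa>] that by simp
  qed
  have \<kappa>g: "\<kappa> i (g j) = (if i = j then 1 else 0)" if "j < r" for i j
    using g[OF that] by (simp add: \<kappa>_def lookup_single when_def)
  have gen: "B \<subseteq> Q" if Q: "subgroup Q G" "g ` {..<r} \<subseteq> Q" for Q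
  proof -
    \<comment> \<open>Induction on the number of coordinates that may be nonzero: the last of them
      is cleared by a power of the corresponding generator.\<close>
    have "\<forall>b\<in>B. (\<forall>i. n \<le> i \<longrightarrow> i < r \<longrightarrow> \<kappa> i b = 0) \<longrightarrow> b \<in> Q" if "n \<le> r" for n
      using that
    proof (induction n)
      case 0
      show ?case
      proof (intro ballI impI)
        fix b assume b: "b \<in> B" "\<forall>i\<ge>0. i < r \<longrightarrow> \<kappa> i b = 0"
        have "b = \<one>"
          by (rule inj) (use b B zhom_one[OF \<kappa> B] in \<open>auto simp: subgroup.one_closed\<close>)
        then show "b \<in> Q" using Q subgroup.one_closed by auto
      qed
    next
      case (Suc n)
      show ?case
      proof (intro ballI impI)
        fix b assume b: "b \<in> B" "\<forall>i\<ge>Suc n. i < r \<longrightarrow> \<kappa> i b = 0"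
        define e where "e = g n [^] (\<kappa> n b)"
        have n: "n < r" using Suc by simp
        have eB: "e \<in> B" using subgroup_int_pow_closed[OF B] g[OF n] by (simp add: e_def)
        have eQ: "e \<in> Q" using subgroup_int_pow_closed[OF Q(1)] Q(2) n by (auto simp: e_def)
        have ke: "\<kappa> i e = (if i = n then \<kappa> n b else 0)" for i
          unfolding e_def using zhom_int_pow[OF \<kappa> B] g[OF n] \<kappa>g[OF n] by simp
        have ie: "inv e \<in> B" using subgroup.m_inv_closed[OF B eB] .
        have "\<kappa> i (b \<otimes> inv e) = \<kappa> i b - \<kappa> i e" for i
          using zhomD[OF \<kappa> b(1) ie] zhom_inv[OF \<kappa> B eB] by simp
        then have "\<forall>i. n \<le> i \<longrightarrow> i < r \<longrightarrow> \<kappa> i (b \<otimes> inv e) = 0"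
          using b(2) ke by (metis Suc_leI cancel_comm_monoid_add_class.diff_cancel diff_0_right le_neq_implies_less)
        moreover have "b \<otimes> inv e \<in> B" using b ie subgroup.m_closed[OF B] by blast
        ultimately have "b \<otimes> inv e \<in> Q" using Suc by simp
        then have "b \<otimes> inv e \<otimes> e \<in> Q" using subgroup.m_closed[OF Q(1)] eQ by simp
        moreover have "b \<otimes> inv e \<otimes> e = b"
          using b eB B subgroup.mem_carrier by (metis inv_solve_right m_closed inv_closed)
        ultimately show "b \<in> Q" by simp
      qed
    qed
    from this[of r] show ?thesis by auto
  qed
  have sep: "\<exists>\<chi>. zhom B \<chi> \<and> \<chi> x \<noteq> 0" if x: "x \<in> B" "x \<noteq> \<one>" for x
  proof (rule ccontr)
    assume "\<not> ?thesis"
    then have "\<kappa> i x = 0" for i using \<kappa> by blast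
    then have "x = \<one>"
      by (intro inj) (use x B zhom_one[OF \<kappa> B] in \<open>auto simp: subgroup.one_closed\<close>)
    then show False using x by simp
  qed
  have "card (g ` {..<r}) \<le> M" using card_image_le[of "{..<r}" g] r by simp
  then show ?thesis unfolding fab_def using B comm gen sep g
    by (auto intro!: exI[of _ "g ` {..<r}"])
qed

lemma fab_subgroup: "fab M B \<Longrightarrow> subgroup B G"
  and fab_comm: "fab M B \<Longrightarrow> x \<in> B \<Longrightarrow> y \<in> B \<Longrightarrow> x \<otimes> y = y \<otimes> x"
  by (auto simp: fab_def)

text \<open>Vanishing on the intersection of \<open>P\<close> and \<open>R\<close> makes
  \<open>p \<otimes> x \<mapsto> \<psi> p\<close> well defined on their product. The factor
  \<open>k\<close> arises from extending it to \<open>B\<close>, in which that product may have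
  torsion quotient.\<close>

lemma fab_extend:
  assumes B: "fab M B" and P: "subgroup P G" "P \<subseteq> B" and R: "subgroup R G" "R \<subseteq> B"
    and \<psi>: "zhom P \<psi>" and PR: "\<And>x. x \<in> P \<Longrightarrow> x \<in> R \<Longrightarrow> \<psi> x = 0"
  obtains k \<chi> where "k > (0::int)" "zhom B \<chi>" "\<And>p. p \<in> P \<Longrightarrow> \<chi> p = k * \<psi> p"
    "\<And>x. x \<in> R \<Longrightarrow> \<chi> x = 0"
proof -
  note sB = fab_subgroup[OF B] and comm = fab_comm[OF B]
  have Bc: "x \<in> carrier G" if "x \<in> B" for x using subgroup.mem_carrier[OF sB that] .
  define Q where "Q = {p \<otimes> x | p x. p \<in> P \<and> x \<in> R}"
  have mul: "(p \<otimes> x) \<otimes> (p' \<otimes> x') = (p \<otimes> p') \<otimes> (x \<otimes> x')"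
    if "p \<in> B" "p' \<in> B" "x \<in> B" "x' \<in> B" for p p' x x'
    using that comm[of x p'] Bc by (metis m_assoc m_closed)
  have "subgroup Q G"
  proof (rule subgroupI)
    show "Q \<subseteq> carrier G" using P R Bc by (auto simp: Q_def)
    show "Q \<noteq> {}" using subgroup.one_closed[OF P(1)] subgroup.one_closed[OF R(1)] by (auto simp: Q_def)
  next
    fix a assume "a \<in> Q"
    then obtain p x where a: "a = p \<otimes> x" "p \<in> P" "x \<in> R" by (auto simp: Q_def)
    have "inv a = inv p \<otimes> inv x"
    proof -
      have px: "p \<in> B" "x \<in> B" using a P(2) R(2) by auto
      then have "a = x \<otimes> p" using a(1) comm by simp
      then show ?thesis using inv_mult_group px Bc by simp
    qed
    then show "inv a \<in> Q"
      using subgroup.m_inv_closed[OF P(1) a(2)] subgroup.m_inv_closed[OF R(1) a(3)] unfolding Q_def by blast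
  next
    fix a b assume "a \<in> Q" "b \<in> Q"
    then obtain p x p' x' where a: "a = p \<otimes> x" "p \<in> P" "x \<in> R" "b = p' \<otimes> x'" "p' \<in> P" "x' \<in> R"
      by (auto simp: Q_def)
    then have "a \<otimes> b = (p \<otimes> p') \<otimes> (x \<otimes> x')" using mul P R by (meson subsetD)
    then show "a \<otimes> b \<in> Q" using a subgroup.m_closed[OF P(1)] subgroup.m_closed[OF R(1)] unfolding Q_def by blast
  qed
  moreover have "Q \<subseteq> B" using P R subgroup.m_closed[OF sB] by (auto simp: Q_def)
  moreover define \<theta> where "\<theta> y = (THE z. \<exists>p x. p \<in> P \<and> x \<in> R \<and> y = p \<otimes> x \<and> z = \<psi> p)" for y
  have \<theta>: "\<theta> (p \<otimes> x) = \<psi> p" if px: "p \<in> P" "x \<in> R" for p x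
    unfolding \<theta>_def
  proof (rule the_equality)
    show "\<exists>pa xa. pa \<in> P \<and> xa \<in> R \<and> p \<otimes> x = pa \<otimes> xa \<and> \<psi> p = \<psi> pa" using px by blast
  next
    fix z assume "\<exists>pa xa. pa \<in> P \<and> xa \<in> R \<and> p \<otimes> x = pa \<otimes> xa \<and> z = \<psi> pa"
    then obtain p' x' where p': "p' \<in> P" "x' \<in> R" "p \<otimes> x = p' \<otimes> x'" "z = \<psi> p'" by blast
    have c: "p \<in> carrier G" "x \<in> carrier G" "p' \<in> carrier G" "x' \<in> carrier G"
      using px p' P R Bc by auto
    have "inv p' \<otimes> p = x' \<otimes> inv x"
      using c p'(3) inv_mult_eq by blast
    moreover have "inv p' \<otimes> p \<in> P" using P p' px by (simp add: subgroup.m_inv_closed subgroup.m_closed)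
    moreover have "x' \<otimes> inv x \<in> R" using R p' px by (simp add: subgroup.m_inv_closed subgroup.m_closed)
    ultimately have "\<psi> (inv p' \<otimes> p) = 0" using PR by metis
    moreover have "\<psi> (inv p' \<otimes> p) = - \<psi> p' + \<psi> p"
      using zhomD[OF \<psi>] zhom_inv[OF \<psi> P(1)] p' px P(1) by (simp add: subgroup.m_inv_closed)
    ultimately show "z = \<psi> p" using p' by simp
  qed
  have "zhom Q \<theta>"
    unfolding zhom_def Q_def
  proof clarify
    fix p x p' x' assume a: "p \<in> P" "x \<in> R" "p' \<in> P" "x' \<in> R"
    have "\<theta> ((p \<otimes> x) \<otimes> (p' \<otimes> x')) = \<theta> ((p \<otimes> p') \<otimes> (x \<otimes> x'))"
      using mul P R a by (simp add: subset_iff)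
    then show "\<theta> ((p \<otimes> x) \<otimes> (p' \<otimes> x')) = \<theta> (p \<otimes> x) + \<theta> (p' \<otimes> x')"
      using \<theta> a P R subgroup.m_closed zhomD[OF \<psi>] by metis
  qed
  moreover obtain X where "finite X" "X \<subseteq> B" "\<And>Q. subgroup Q G \<Longrightarrow> X \<subseteq> Q \<Longrightarrow> B \<subseteq> Q"
    using B by (auto simp: fab_def)
  ultimately obtain k \<chi> where k: "k > (0::int)" "zhom B \<chi>" "\<And>p. p \<in> Q \<Longrightarrow> \<chi> p = k * \<theta> p"
    using zhom_extend_generators[OF sB comm] by metis
  have "\<chi> p = k * \<psi> p" if "p \<in> P" for p
    using \<theta>[OF that subgroup.one_closed[OF R(1)]] k(3)[of p] that P R Bc subgroup.one_closed[OF R(1)]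
    by (force simp: Q_def)
  moreover have "\<chi> x = 0" if "x \<in> R" for x
    using \<theta>[OF subgroup.one_closed[OF P(1)] that] k(3)[of x] that P R Bc subgroup.one_closed[OF P(1)]
      zhom_one[OF \<psi> P(1)] by (force simp: Q_def)
  ultimately show ?thesis using that k by blast
qed

text \<open>Homomorphisms to \<open>\<int>/2\<close> are encoded by the preimages of the nontrivial element; for a free
abelian group of rank \<open>r\<close> there are \<open>2 ^ r\<close> of them, so their number is a substitute for the rank.\<close>

definition mod2 :: "'a set \<Rightarrow> 'a set set" where
  "mod2 B = {K. K \<subseteq> B \<and> (\<forall>x\<in>B. \<forall>y\<in>B. x \<otimes> y \<in> K \<longleftrightarrow> (x \<in> K) \<noteq> (y \<in> K))}"

text \<open>A set in \<open>mod2 B\<close> is determined by its trace on the generators, because the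
  elements on which two such sets agree form a subgroup.\<close>

lemma mod2_bound:
  assumes B: "fab M B"
  shows "finite (mod2 B)" "card (mod2 B) \<le> 2 ^ M"
proof -
  note sB = fab_subgroup[OF B]
  obtain X where X: "finite X" "card X \<le> M" "X \<subseteq> B" "\<And>Q. subgroup Q G \<Longrightarrow> X \<subseteq> Q \<Longrightarrow> B \<subseteq> Q"
    using B by (auto simp: fab_def)
  have inj: "inj_on (\<lambda>K. K \<inter> X) (mod2 B)"
  proof (rule inj_onI)
    fix K L assume K: "K \<in> mod2 B" and L: "L \<in> mod2 B" and e: "K \<inter> X = L \<inter> X"
    define Q where "Q = {x\<in>B. x \<in> K \<longleftrightarrow> x \<in> L}"
    have one: "\<one> \<notin> K" if "K \<in> mod2 B" for K
    proof -
      have "\<one> \<otimes> \<one> \<in> K \<longleftrightarrow> (\<one> \<in> K) \<noteq> (\<one> \<in> K)"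
        using that subgroup.one_closed[OF sB] unfolding mod2_def by blast
      then show ?thesis by simp
    qed
    have inv: "inv x \<in> K \<longleftrightarrow> x \<in> K" if "K \<in> mod2 B" "x \<in> B" for K x
    proof -
      have "x \<otimes> inv x \<in> K \<longleftrightarrow> (x \<in> K) \<noteq> (inv x \<in> K)"
        using that subgroup.m_inv_closed[OF sB that(2)] unfolding mod2_def by blast
      then show ?thesis using one[OF that(1)] subgroup.mem_carrier[OF sB that(2)] by simp
    qed
    have "subgroup Q G"
    proof (rule subgroupI)
      show "Q \<subseteq> carrier G" using sB subgroup.subset by (auto simp: Q_def)
      show "Q \<noteq> {}" using subgroup.one_closed[OF sB] one K L by (auto simp: Q_def)
      show "inv a \<in> Q" if "a \<in> Q" for a
        using that inv[OF K] inv[OF L] subgroup.m_inv_closed[OF sB] by (auto simp: Q_def)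
      show "a \<otimes> b \<in> Q" if "a \<in> Q" "b \<in> Q" for a b
        using that K L subgroup.m_closed[OF sB] by (auto simp: Q_def mod2_def)
    qed
    moreover have "X \<subseteq> Q" using e X(3) by (auto simp: Q_def)
    ultimately have "B \<subseteq> Q" using X(4) by blast
    then show "K = L" using K L by (auto simp: Q_def mod2_def)
  qed
  have im: "(\<lambda>K. K \<inter> X) ` mod2 B \<subseteq> Pow X" by auto
  show "finite (mod2 B)" using inj_on_finite[OF inj im] X(1) by simp
  have "card (mod2 B) \<le> card (Pow X)" using card_inj_on_le[OF inj im] X(1) by simp
  also have "\<dots> = 2 ^ card X" using X(1) by (simp add: card_Pow)
  also have "\<dots> \<le> 2 ^ M" using X(2) by (simp add: power_increasing)
  finally show "card (mod2 B) \<le> 2 ^ M" .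
qed

text \<open>Only the projection of a direct factor is kept, not the complement. Composition with
  \<rho> extends homomorphisms from \<open>A\<close> to \<open>B\<close> without passing to a
  multiple, and \<open>x \<otimes> inv (\<rho> x)\<close> detects the elements outside
  \<open>A\<close>.\<close>

definition retraction :: "'a set \<Rightarrow> 'a set \<Rightarrow> ('a \<Rightarrow> 'a) \<Rightarrow> bool" where
  "retraction A B \<rho> \<longleftrightarrow> A \<subseteq> B \<and> \<rho> ` B \<subseteq> A \<and> (\<forall>x\<in>A. \<rho> x = x) \<and>
     (\<forall>x\<in>B. \<forall>y\<in>B. \<rho> (x \<otimes> y) = \<rho> x \<otimes> \<rho> y)"

lemma retraction_if_direct_factor:
  assumes B: "subgroup B G" and df: "direct_factor G A B"
    and comm: "\<And>x y. x \<in> B \<Longrightarrow> y \<in> B \<Longrightarrow> x \<otimes> y = y \<otimes> x"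
  shows "subgroup A G" "\<exists>\<rho>. retraction A B \<rho>"
proof -
  obtain C where C: "A \<lhd> (G\<lparr>carrier := B\<rparr>)" "C \<lhd> (G\<lparr>carrier := B\<rparr>)" "A \<inter> C = {\<one>}" "A <#> C = B"
    using df by (auto simp: direct_factor_def)
  have sA: "subgroup A G" using C(1) B by (simp add: normal_imp_subgroup incl_subgroup)
  have sC: "subgroup C G" using C(2) B by (simp add: normal_imp_subgroup incl_subgroup)
  have AB: "A \<subseteq> B" "C \<subseteq> B" 
    using subgroup.subset[OF normal_imp_subgroup[OF C(1)]] subgroup.subset[OF normal_imp_subgroup[OF C(2)]]
    by simp_all
  have Bc: "x \<in> carrier G" if "x \<in> B" for x using subgroup.mem_carrier[OF B that] .
  have uniq: "a = a'" if a: "a \<in> A" "a' \<in> A" "c \<in> C" "c' \<in> C" "a \<otimes> c = a' \<otimes> c'" for a a' c c'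
  proof -
    have cc: "a \<in> carrier G" "a' \<in> carrier G" "c \<in> carrier G" "c' \<in> carrier G" using a AB Bc by auto
    have "inv a' \<otimes> a = c' \<otimes> inv c"
      using cc a(5) inv_mult_eq by blast
    moreover have "inv a' \<otimes> a \<in> A" "c' \<otimes> inv c \<in> C"
      using a sA sC by (simp_all add: subgroup.m_inv_closed subgroup.m_closed)
    ultimately have "inv a' \<otimes> a = \<one>" using C(3) by auto
    then show ?thesis using cc by (metis inv_equality inv_inv inv_closed)
  qed
  define \<rho> where "\<rho> x = (SOME a. a \<in> A \<and> (\<exists>c\<in>C. x = a \<otimes> c))" for x
  have ex: "\<rho> x \<in> A \<and> (\<exists>c\<in>C. x = \<rho> x \<otimes> c)" if "x \<in> B" for x
    unfolding \<rho>_def by (rule someI_ex) (use that C(4) in \<open>auto simp: set_mult_def\<close>)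
  have \<rho>: "\<rho> (a \<otimes> c) = a" if "a \<in> A" "c \<in> C" for a c
  proof -
    have "a \<otimes> c \<in> B" using that AB subgroup.m_closed[OF B] by blast
    from ex[OF this] show ?thesis using uniq that by metis
  qed
  have "retraction A B \<rho>"
    unfolding retraction_def
  proof (intro conjI ballI)
    show "A \<subseteq> B" by fact
    show "\<rho> ` B \<subseteq> A" using ex by auto
    show "\<rho> x = x" if "x \<in> A" for x
      using \<rho>[OF that subgroup.one_closed[OF sC]] that AB Bc by auto
  next
    fix x y assume xy: "x \<in> B" "y \<in> B"
    obtain c c' where c: "c \<in> C" "x = \<rho> x \<otimes> c" "c' \<in> C" "y = \<rho> y \<otimes> c'" using ex xy by metis
    have m: "\<rho> x \<in> B" "\<rho> y \<in> B" "c \<in> B" "c' \<in> B" using ex xy c AB by auto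
    have "x \<otimes> y = (\<rho> x \<otimes> c) \<otimes> (\<rho> y \<otimes> c')" using c by simp
    also have "\<dots> = \<rho> x \<otimes> ((c \<otimes> \<rho> y) \<otimes> c')" using m Bc by (simp add: m_assoc)
    also have "\<dots> = (\<rho> x \<otimes> \<rho> y) \<otimes> (c \<otimes> c')" using m Bc comm[of c "\<rho> y"] by (simp add: m_assoc)
    finally show "\<rho> (x \<otimes> y) = \<rho> x \<otimes> \<rho> y"
      using \<rho> ex[OF xy(1)] ex[OF xy(2)] c subgroup.m_closed[OF sA] subgroup.m_closed[OF sC] by simp
  qed
  then show "subgroup A G" "\<exists>\<rho>. retraction A B \<rho>" using sA by auto
qed

lemma retraction_zhom_extend:
  assumes "retraction A B \<rho>" "zhom A \<psi>"
  shows "\<exists>\<chi>. zhom B \<chi> \<and> (\<forall>x\<in>A. \<chi> x = \<psi> x)"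
  using assms by (intro exI[of _ "\<psi> \<circ> \<rho>"]) (auto simp: retraction_def zhom_def image_subset_iff)

text \<open>For \<open>b\<close> outside \<open>A\<close> the complementary part
  \<open>b \<otimes> inv (\<rho> b)\<close> is nontrivial. A homomorphism that does not vanish on
  it, composed with the complementary projection, vanishes on \<open>A\<close>.\<close>

lemma retraction_kill:
  assumes B: "fab M B" and A: "subgroup A G" "retraction A B \<rho>" and ne: "A \<noteq> B"
  shows "\<exists>\<chi>. zhom B \<chi> \<and> (\<forall>x\<in>A. \<chi> x = 0) \<and> (\<exists>x\<in>B. \<chi> x \<noteq> 0)"
proof -
  note sB = fab_subgroup[OF B] and comm = fab_comm[OF B]
  have Bc: "x \<in> carrier G" if "x \<in> B" for x using subgroup.mem_carrier[OF sB that] .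
  have \<rho>: "\<rho> x \<in> A" "\<rho> x \<in> B" if "x \<in> B" for x using A(2) that by (auto simp: retraction_def)
  obtain b where b: "b \<in> B" "b \<notin> A" using ne A(2) by (auto simp: retraction_def)
  define \<pi> where "\<pi> x = x \<otimes> inv (\<rho> x)" for x
  have \<pi>B: "\<pi> x \<in> B" if "x \<in> B" for x
    using that \<rho> sB by (simp add: \<pi>_def subgroup.m_closed subgroup.m_inv_closed)
  have "\<pi> b \<noteq> \<one>"
  proof
    assume "\<pi> b = \<one>"
    then have "b = \<rho> b" using b \<rho> Bc by (metis \<pi>_def inv_closed inv_equality inv_inv)
    then show False using b \<rho> by metis
  qed
  then obtain \<chi> where \<chi>: "zhom B \<chi>" "\<chi> (\<pi> b) \<noteq> 0" using B \<pi>B[OF b(1)] by (auto simp: fab_def)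
  have e: "\<chi> (\<pi> x) = \<chi> x - \<chi> (\<rho> x)" if "x \<in> B" for x
    unfolding \<pi>_def using zhomD[OF \<chi>(1)] zhom_inv[OF \<chi>(1) sB] \<rho> that sB
    by (simp add: subgroup.m_inv_closed)
  have "zhom B (\<chi> \<circ> \<pi>)"
    unfolding zhom_def
  proof (intro ballI)
    fix x y assume xy: "x \<in> B" "y \<in> B"
    then have "\<rho> (x \<otimes> y) = \<rho> x \<otimes> \<rho> y" using A(2) by (auto simp: retraction_def)
    then show "(\<chi> \<circ> \<pi>) (x \<otimes> y) = (\<chi> \<circ> \<pi>) x + (\<chi> \<circ> \<pi>) y"
      using e xy sB \<rho> zhomD[OF \<chi>(1)] by (simp add: subgroup.m_closed)
  qed
  moreover have "(\<chi> \<circ> \<pi>) x = 0" if "x \<in> A" for x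
    using e[of x] A(2) that unfolding retraction_def by auto
  ultimately show ?thesis using \<chi>(2) b(1) by (intro exI[of _ "\<chi> \<circ> \<pi>"]) auto
qed

text \<open>Pulling back along \<rho> embeds \<open>mod2 A\<close> into \<open>mod2 B\<close>. If
  \<open>A\<close> is proper, a nonzero homomorphism that kills \<open>A\<close>, read modulo 2,
  gives a nonempty set disjoint from \<open>A\<close>, and this is not a pullback.\<close>

lemma mod2_retraction:
  assumes B: "fab M B" and A: "subgroup A G" "retraction A B \<rho>"
  shows "card (mod2 A) \<le> card (mod2 B)" and "A \<noteq> B \<Longrightarrow> card (mod2 A) < card (mod2 B)"
proof -
  note sB = fab_subgroup[OF B]
  define L where "L K = {x\<in>B. \<rho> x \<in> K}" for K
  have \<rho>: "\<rho> x \<in> A" "\<rho> x \<in> B" if "x \<in> B" for x using A(2) that by (auto simp: retraction_def)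
  have \<rho>A: "\<rho> x = x" "x \<in> B" if "x \<in> A" for x using A(2) that by (auto simp: retraction_def)
  have \<rho>m: "\<rho> (x \<otimes> y) = \<rho> x \<otimes> \<rho> y" if "x \<in> B" "y \<in> B" for x y
    using A(2) that by (auto simp: retraction_def)
  have im: "L ` mod2 A \<subseteq> mod2 B"
    using \<rho> \<rho>m subgroup.m_closed[OF sB] by (auto simp: L_def mod2_def)
  have LA: "L K \<inter> A = K" if "K \<in> mod2 A" for K using that \<rho>A by (auto simp: L_def mod2_def)
  have inj: "inj_on L (mod2 A)" using LA by (metis inj_onI)
  show "card (mod2 A) \<le> card (mod2 B)"
    using card_inj_on_le[OF inj im] mod2_bound(1)[OF B] by blast
  assume "A \<noteq> B"
  then obtain \<chi> where \<chi>: "zhom B \<chi>" "\<forall>x\<in>A. \<chi> x = 0" "\<exists>x\<in>B. \<chi> x \<noteq> 0"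
    using retraction_kill[OF B A] by blast
  \<comment> \<open>Without dividing by the gcd, all values might be even.\<close>
  define d where "d = Gcd (\<chi> ` B)"
  have d0: "d \<noteq> 0" using \<chi>(3) by (auto simp: d_def Gcd_0_iff)
  have dd: "d dvd \<chi> x" if "x \<in> B" for x using that by (simp add: d_def Gcd_dvd)
  define K where "K = {x\<in>B. odd (\<chi> x div d)}"
  have "K \<in> mod2 B"
    unfolding mod2_def K_def using zhomD[OF \<chi>(1)] dd subgroup.m_closed[OF sB]
    by (auto simp: div_add)
  moreover have "K \<notin> L ` mod2 A"
  proof
    assume "K \<in> L ` mod2 A"
    then obtain K' where K': "K' \<in> mod2 A" "K = L K'" by auto
    then have "K' = K \<inter> A" using LA by auto
    then have "K' = {}" using \<chi>(2) by (auto simp: K_def)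
    then have "K = {}" using K'(2) by (auto simp: L_def)
    then have "2 * d dvd \<chi> x" if "x \<in> B" for x
    proof -
      have "even (\<chi> x div d)" using \<open>K = {}\<close> that by (auto simp: K_def)
      then show ?thesis using dd[OF that] d0 by (metis dvd_div_iff_mult mult.commute)
    qed
    then have "2 * d dvd Gcd (\<chi> ` B)" by (intro Gcd_greatest) auto
    then have "2 * d dvd d" by (simp add: d_def)
    then show False using d0 by (metis dvd_times_right_cancel_iff mult.left_neutral odd_one)
  qed
  ultimately have "L ` mod2 A \<subset> mod2 B" using im by blast
  then have "card (L ` mod2 A) < card (mod2 B)" using mod2_bound(1)[OF B] psubset_card_mono by blast
  then show "card (mod2 A) < card (mod2 B)" using card_image[OF inj] by simp
qed

end

lemma (in group) solvable_if_commutative: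
  assumes "\<And>x y. x \<in> carrier G \<Longrightarrow> y \<in> carrier G \<Longrightarrow> x \<otimes> y = y \<otimes> x"
  shows "solvable G"
proof -
  interpret comm_group G by (rule group_comm_groupI) (rule assms)
  have "(derived G ^^ 1) (carrier G) = {\<one>}" using derived_eq_singleton[of "carrier G"] by simp
  then show ?thesis using solvable_iff_trivial_derived_seq by blast
qed

subsection \<open>Group actions on trees\<close>

locale tree_action = group G for G (structure) +
  fixes V :: "'v set" and E :: "'e set" and ini ter :: "'e \<Rightarrow> 'v"
    and actV :: "'a \<Rightarrow> 'v \<Rightarrow> 'v" (infixr "\<cdot>" 75) and actE :: "'a \<Rightarrow> 'e \<Rightarrow> 'e" (infixr "\<star>" 75)
  assumes tree: "is_tree V E ini ter" and action: "graph_action G V E ini ter actV actE"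
begin

lemma group_action_V: "group_action G V actV" and group_action_E: "group_action G E actE"
  using action by (auto simp: graph_action_def)

lemma ini_closed [simp]: "e \<in> E \<Longrightarrow> ini e \<in> V" and ter_closed [simp]: "e \<in> E \<Longrightarrow> ter e \<in> V"
  using tree by (auto simp: is_tree_def oriented_graph_def)

lemma ini_act [simp]: "g \<in> carrier G \<Longrightarrow> e \<in> E \<Longrightarrow> ini (g \<star> e) = g \<cdot> ini e"
  and ter_act [simp]: "g \<in> carrier G \<Longrightarrow> e \<in> E \<Longrightarrow> ter (g \<star> e) = g \<cdot> ter e"
  using action by (auto simp: graph_action_def)

lemma actV_closed [simp]: "g \<in> carrier G \<Longrightarrow> v \<in> V \<Longrightarrow> g \<cdot> v \<in> V"
  using group_action.element_image[OF group_action_V] by blast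

lemma actE_closed [simp]: "g \<in> carrier G \<Longrightarrow> e \<in> E \<Longrightarrow> g \<star> e \<in> E"
  using group_action.element_image[OF group_action_E] by blast

lemma actV_one [simp]: "v \<in> V \<Longrightarrow> \<one> \<cdot> v = v"
  using group_action.id_eq_one[OF group_action_V] by (metis restrict_apply')

lemma actE_one [simp]: "e \<in> E \<Longrightarrow> \<one> \<star> e = e"
  using group_action.id_eq_one[OF group_action_E] by (metis restrict_apply')

lemma actV_mult: "g \<in> carrier G \<Longrightarrow> h \<in> carrier G \<Longrightarrow> v \<in> V \<Longrightarrow> (g \<otimes> h) \<cdot> v = g \<cdot> h \<cdot> v"
  using group_action.composition_rule[OF group_action_V] by blast

lemma actE_mult: "g \<in> carrier G \<Longrightarrow> h \<in> carrier G \<Longrightarrow> e \<in> E \<Longrightarrow> (g \<otimes> h) \<star> e = g \<star> h \<star> e"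
  using group_action.composition_rule[OF group_action_E] by blast

lemma actV_inv [simp]: "g \<in> carrier G \<Longrightarrow> v \<in> V \<Longrightarrow> inv g \<cdot> g \<cdot> v = v"
  "g \<in> carrier G \<Longrightarrow> v \<in> V \<Longrightarrow> g \<cdot> inv g \<cdot> v = v"
  by (simp_all flip: actV_mult)

lemma actE_inv [simp]: "g \<in> carrier G \<Longrightarrow> e \<in> E \<Longrightarrow> inv g \<star> g \<star> e = e"
  "g \<in> carrier G \<Longrightarrow> e \<in> E \<Longrightarrow> g \<star> inv g \<star> e = e"
  by (simp_all flip: actE_mult)

lemma V_nonempty: "V \<noteq> {}"
  using tree by (auto simp: is_tree_def graph_connected_def)

subsection \<open>Walks\<close>

text \<open>A dart \<open>(e, b)\<close> is the edge \<open>e\<close> traversed forwards (\<open>b = True\<close>) or backwards.\<close>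

definition src :: "'e \<times> bool \<Rightarrow> 'v" where "src d = (if snd d then ini (fst d) else ter (fst d))"
definition tgt :: "'e \<times> bool \<Rightarrow> 'v" where "tgt d = (if snd d then ter (fst d) else ini (fst d))"
definition flip :: "'e \<times> bool \<Rightarrow> 'e \<times> bool" where "flip d = (fst d, \<not> snd d)"
definition actD :: "'a \<Rightarrow> 'e \<times> bool \<Rightarrow> 'e \<times> bool" where "actD g d = (g \<star> fst d, snd d)"

fun walk :: "'v \<Rightarrow> ('e \<times> bool) list \<Rightarrow> 'v \<Rightarrow> bool" where
  "walk u [] w \<longleftrightarrow> u = w \<and> u \<in> V"
| "walk u (d # ds) w \<longleftrightarrow> fst d \<in> E \<and> src d = u \<and> walk (tgt d) ds w"

definition reduced :: "('e \<times> bool) list \<Rightarrow> bool" where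
  "reduced ds \<longleftrightarrow> successively (\<lambda>a b. fst a \<noteq> fst b) ds"

lemma dart_simps [simp]:
  "fst (flip d) = fst d" "src (flip d) = tgt d" "tgt (flip d) = src d" "fst (actD g d) = g \<star> fst d"
  "snd (actD g d) = snd d" "snd (flip d) = (\<not> snd d)"
  by (auto simp: flip_def src_def tgt_def actD_def)

lemma dart_act [simp]: "g \<in> carrier G \<Longrightarrow> fst d \<in> E \<Longrightarrow> src (actD g d) = g \<cdot> src d"
  "g \<in> carrier G \<Longrightarrow> fst d \<in> E \<Longrightarrow> tgt (actD g d) = g \<cdot> tgt d"
  by (auto simp: actD_def src_def tgt_def)

lemma dart_closed [simp]: "fst d \<in> E \<Longrightarrow> src d \<in> V" "fst d \<in> E \<Longrightarrow> tgt d \<in> V"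
  by (auto simp: src_def tgt_def)

lemma dart_ends: "{src d, tgt d} = {ini (fst d), ter (fst d)}"
  by (auto simp: src_def tgt_def)

lemma walk_closed: "walk u ds w \<Longrightarrow> u \<in> V" "walk u ds w \<Longrightarrow> w \<in> V"
  by (induction ds arbitrary: u) auto

lemma walk_edges: "walk u ds w \<Longrightarrow> d \<in> set ds \<Longrightarrow> fst d \<in> E"
  by (induction ds arbitrary: u) auto

lemma walk_append: "walk u (xs @ ys) w \<longleftrightarrow> (\<exists>v. walk u xs v \<and> walk v ys w)"
  by (induction xs arbitrary: u) (auto dest: walk_closed)

lemma walk_rev: "walk u ds w \<Longrightarrow> walk w (rev (map flip ds)) u"
  by (induction ds arbitrary: u) (auto simp: walk_append)

lemma walk_act: "g \<in> carrier G \<Longrightarrow> walk u ds w \<Longrightarrow> walk (g \<cdot> u) (map (actD g) ds) (g \<cdot> w)"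
  by (induction ds arbitrary: u) auto

lemma walk_exists:
  assumes "u \<in> V" "w \<in> V"
  shows "\<exists>ds. walk u ds w"
proof -
  have "\<exists>ds. walk (hd vs) ds (last vs)" if "graph_path V E ini ter vs es" for vs es
    using that
  proof (induction es arbitrary: vs)
    case Nil
    then obtain v where "vs = [v]" "v \<in> V" by (cases vs) (auto simp: graph_path_def)
    then show ?case by (intro exI[of _ "[]"]) auto
  next
    case (Cons e es)
    then obtain v v' vs' where vs: "vs = v # v' # vs'"
      by (cases vs; cases "tl vs") (auto simp: graph_path_def)
    have e: "e \<in> E" "{ini e, ter e} = {v, v'}"
      using Cons.prems vs unfolding graph_path_def by (force dest: spec[of _ 0])+
    have "graph_path V E ini ter (v' # vs') es"
      unfolding graph_path_def
    proof (intro conjI allI impI)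
      fix i assume "i < length es"
      then have "(e # es) ! Suc i \<in> E \<and>
          {ini ((e # es) ! Suc i), ter ((e # es) ! Suc i)} = {vs ! Suc i, vs ! Suc (Suc i)}"
        using Cons.prems unfolding graph_path_def by (metis Suc_less_eq length_Cons)
      then show "es ! i \<in> E" "{ini (es ! i), ter (es ! i)} = {(v' # vs') ! i, (v' # vs') ! Suc i}"
        using vs by auto
    qed (use Cons.prems vs in \<open>auto simp: graph_path_def\<close>)
    then obtain ds where ds: "walk v' ds (last vs)" using Cons.IH vs by fastforce
    obtain b where "src (e, b) = v" "tgt (e, b) = v'"
      using e(2) that[of True] that[of False] by (auto simp: src_def tgt_def doubleton_eq_iff)
    then have "walk v ((e, b) # ds) (last vs)" using e ds by auto
    then have "\<exists>ds. walk v ds (last vs)" by blast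
    then show ?case using vs by simp
  qed
  then show ?thesis using tree assms unfolding is_tree_def graph_connected_def by metis
qed

lemma reduced_closed_walk:
  assumes "walk u ds u" "reduced ds"
  shows "ds = []"
proof (rule ccontr)
  assume ne: "ds \<noteq> []"
  have gp: "graph_path V E ini ter (v # map tgt ds) (map fst ds) \<and> last (v # map tgt ds) = w"
    if "walk v ds w" for v w ds
    using that
  proof (induction ds arbitrary: v)
    case Nil
    then show ?case by (auto simp: graph_path_def)
  next
    case (Cons d ds)
    then have IH: "graph_path V E ini ter (tgt d # map tgt ds) (map fst ds)" "last (tgt d # map tgt ds) = w"
      and d: "fst d \<in> E" "src d = v" by auto
    have "graph_path V E ini ter (v # map tgt (d # ds)) (map fst (d # ds))"
      unfolding graph_path_def
    proof (intro conjI allI impI)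
      show "set (v # map tgt (d # ds)) \<subseteq> V" using IH d by (auto simp: graph_path_def)
      fix i assume i: "i < length (map fst (d # ds))"
      show "map fst (d # ds) ! i \<in> E"
        using i IH d by (cases i) (auto simp: graph_path_def)
      show "{ini (map fst (d # ds) ! i), ter (map fst (d # ds) ! i)} =
          {(v # map tgt (d # ds)) ! i, (v # map tgt (d # ds)) ! Suc i}"
        using i IH d dart_ends[of d] by (cases i) (auto simp: graph_path_def)
    qed simp
    then show ?case using IH by simp
  qed
  have "reduced_path (map fst ds)"
    using assms(2) by (auto simp: reduced_path_def reduced_def successively_conv_nth)
  then show False
    using gp[OF assms(1)] ne tree unfolding is_tree_def by (metis list.sel(1) map_is_Nil_conv)
qed

lemma no_loop: "e \<in> E \<Longrightarrow> ini e \<noteq> ter e"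
  using reduced_closed_walk[of "ini e" "[(e, True)]"] by (auto simp: reduced_def src_def tgt_def)

text \<open>Since a tree has no loops, a repetition of consecutive edges is genuine backtracking.
  This justifies comparing edges instead of darts in \<open>reduced\<close>, and lets the two darts
  be cancelled.\<close>

lemma dart_eq_flip:
  assumes "fst a \<in> E" "fst a = fst b" "src b = tgt a"
  shows "b = flip a"
  using assms no_loop[of "fst a"] by (cases a; cases b) (auto simp: flip_def src_def tgt_def split: if_splits)

lemma not_reduced: "\<not> reduced ds \<Longrightarrow> \<exists>xs a b ys. ds = xs @ a # b # ys \<and> fst a = fst b"
proof (induction ds)
  case Nil
  then show ?case by (simp add: reduced_def)
next
  case (Cons d ds)
  show ?case
  proof (cases "reduced ds")
    case True
    then obtain b ys where "ds = b # ys" "fst d = fst b"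
      using Cons.prems by (cases ds) (auto simp: reduced_def)
    then show ?thesis by (metis append_Nil)
  next
    case False
    then show ?thesis using Cons.IH by (metis append_Cons)
  qed
qed

lemma walk_cancel:
  assumes "walk u (xs @ a # b # ys) w" "fst a = fst b"
  shows "b = flip a" "walk u (xs @ ys) w"
proof -
  obtain v where v: "walk u xs v" "walk v (a # b # ys) w" using assms(1) by (auto simp: walk_append)
  then show b: "b = flip a" using dart_eq_flip[of a b] assms(2) by auto
  show "walk u (xs @ ys) w" using v b by (auto simp: walk_append)
qed

lemma reduced_walk_exists:
  assumes "u \<in> V" "w \<in> V"
  obtains ds where "walk u ds w" "reduced ds"
proof -
  obtain ds where ds: "walk u ds w" and min: "\<And>ds'. walk u ds' w \<Longrightarrow> length ds \<le> length ds'"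
    using walk_exists[OF assms] ex_has_least_nat[of "\<lambda>ds. walk u ds w" _ length] by metis
  have "reduced ds"
  proof (rule ccontr)
    assume "\<not> reduced ds"
    then obtain xs a b ys where x: "ds = xs @ a # b # ys" "fst a = fst b" using not_reduced by blast
    then show False using walk_cancel(2)[of u xs a b ys w] min[of "xs @ ys"] ds by auto
  qed
  then show ?thesis using that ds by blast
qed

lemma reduced_append: "reduced (xs @ ys) \<Longrightarrow> reduced xs" "reduced (xs @ ys) \<Longrightarrow> reduced ys"
  by (auto simp: reduced_def successively_append_iff)

subsection \<open>Connectedness in the quotient graph\<close>

definition orbE :: "'e \<Rightarrow> 'e set" where "orbE e = (\<lambda>g. g \<star> e) ` carrier G"
definition ginv :: "'e set \<Rightarrow> bool" where "ginv O' \<longleftrightarrow> (\<forall>g\<in>carrier G. \<forall>e\<in>E. e \<in> O' \<longrightarrow> g \<star> e \<in> O')"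

text \<open>\<open>conn R U u v\<close>: the images of \<open>u\<close> and \<open>v\<close> in the quotient graph are joined by a path which
runs through images of vertices in \<open>U\<close> and avoids the images of the edges in \<open>R\<close>.\<close>

definition arcs :: "'e set \<Rightarrow> 'v set \<Rightarrow> ('v \<times> 'v) set" where
  "arcs R U = {(u, v). u \<in> U \<and> v \<in> U \<and>
     ((\<exists>g\<in>carrier G. v = g \<cdot> u) \<or> (\<exists>f\<in>E - R. {u, v} = {ini f, ter f}))}"

definition conn :: "'e set \<Rightarrow> 'v set \<Rightarrow> 'v \<Rightarrow> 'v \<Rightarrow> bool" where
  "conn R U u v \<longleftrightarrow> (u, v) \<in> (arcs R U)\<^sup>*"

lemma orbE_self [simp]: "e \<in> E \<Longrightarrow> e \<in> orbE e"
  unfolding orbE_def by (rule image_eqI[of _ _ \<one>]) auto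

lemma orbE_subset: "e \<in> E \<Longrightarrow> orbE e \<subseteq> E" by (auto simp: orbE_def)

lemma ginv_orbE: "e \<in> E \<Longrightarrow> ginv (orbE e)"
  unfolding ginv_def orbE_def by (auto simp flip: actE_mult)

lemma ginv_empty: "ginv {}"
  by (simp add: ginv_def)

lemma ginvD: "ginv R \<Longrightarrow> g \<in> carrier G \<Longrightarrow> e \<in> E \<Longrightarrow> g \<star> e \<in> R \<longleftrightarrow> e \<in> R"
  unfolding ginv_def by (metis actE_closed actE_inv(1) inv_closed)

lemma conn_refl [simp]: "conn R U u u" by (simp add: conn_def)

lemma conn_trans [trans]: "conn R U u v \<Longrightarrow> conn R U v w \<Longrightarrow> conn R U u w"
  by (simp add: conn_def)

lemma arcs_sym:
  assumes "U \<subseteq> V" "(u, v) \<in> arcs R U"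
  shows "(v, u) \<in> arcs R U"
proof -
  have "u \<in> V" using assms by (auto simp: arcs_def)
  then have "u = inv g \<cdot> v" if "g \<in> carrier G" "v = g \<cdot> u" for g
    using that by simp
  then have "\<exists>h\<in>carrier G. u = h \<cdot> v" if "\<exists>g\<in>carrier G. v = g \<cdot> u" using that by (metis inv_closed)
  then show ?thesis using assms unfolding arcs_def by (auto simp: insert_commute)
qed

lemma conn_sym: "U \<subseteq> V \<Longrightarrow> conn R U u v \<Longrightarrow> conn R U v u"
  unfolding conn_def using arcs_sym by (metis sym_def sym_rtrancl symE)

lemma conn_mono: "conn R U u v \<Longrightarrow> R' \<subseteq> R \<Longrightarrow> U \<subseteq> U' \<Longrightarrow> conn R' U' u v"
  unfolding conn_def by (erule rtrancl_mono[THEN subsetD, rotated]) (auto simp: arcs_def)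

lemma conn_act: "u \<in> U \<Longrightarrow> g \<cdot> u \<in> U \<Longrightarrow> g \<in> carrier G \<Longrightarrow> conn R U u (g \<cdot> u)"
  unfolding conn_def by (rule r_into_rtrancl) (auto simp: arcs_def)

lemma conn_edge: "f \<in> E - R \<Longrightarrow> ini f \<in> U \<Longrightarrow> ter f \<in> U \<Longrightarrow> conn R U (ini f) (ter f)"
  "f \<in> E - R \<Longrightarrow> ini f \<in> U \<Longrightarrow> ter f \<in> U \<Longrightarrow> conn R U (ter f) (ini f)"
  unfolding conn_def by (rule r_into_rtrancl, force simp: arcs_def)+

lemma conn_dart: "fst d \<in> E - R \<Longrightarrow> src d \<in> U \<Longrightarrow> tgt d \<in> U \<Longrightarrow> conn R U (src d) (tgt d)"
  using conn_edge[of "fst d" R U] by (auto simp: src_def tgt_def)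

lemma conn_closed: "conn R V u v \<Longrightarrow> u \<in> V \<Longrightarrow> v \<in> V"
  unfolding conn_def by (induction rule: rtrancl_induct) (auto simp: arcs_def)

definition avoids :: "('e \<times> bool) list \<Rightarrow> 'e set \<Rightarrow> bool" where
  "avoids ds R \<longleftrightarrow> fst ` set ds \<inter> R = {}"

lemma avoids_simps [simp]: "avoids [] R" "avoids (d # ds) R \<longleftrightarrow> fst d \<notin> R \<and> avoids ds R"
  "avoids (xs @ ys) R \<longleftrightarrow> avoids xs R \<and> avoids ys R" "avoids (rev xs) R \<longleftrightarrow> avoids xs R"
  "avoids (map flip xs) R \<longleftrightarrow> avoids xs R" "avoids ds {}"
  by (auto simp: avoids_def image_image)

lemma avoids_act:
  assumes "ginv R" "g \<in> carrier G" "walk u ds w"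
  shows "avoids (map (actD g) ds) R \<longleftrightarrow> avoids ds R"
  using assms(3) by (induction ds arbitrary: u) (auto simp: ginvD[OF assms(1,2)])

lemma conn_walk: "walk u ds w \<Longrightarrow> avoids ds R \<Longrightarrow> conn R V u w"
proof (induction ds arbitrary: u)
  case (Cons d ds)
  then have "conn R V (src d) (tgt d)" "conn R V (tgt d) w" by (auto intro!: conn_dart)
  then show ?case using Cons.prems conn_trans by auto
qed simp

text \<open>Path lifting: a step inside an orbit leaves the lift alone and only changes the
  translate \<open>g\<close> of its end point, while a step over an edge appends the
  \<open>g\<close>-translate of that edge.\<close>

lemma walk_of_conn:
  assumes "conn R V u w" "u \<in> V" "ginv R"
  obtains g ds where "g \<in> carrier G" "walk u ds (g \<cdot> w)" "avoids ds R"
proof -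
  have "\<exists>g ds. g \<in> carrier G \<and> walk u ds (g \<cdot> w) \<and> avoids ds R"
    using assms(1) unfolding conn_def
  proof (induction rule: rtrancl_induct)
    case base
    then show ?case using assms(2) by (intro exI[of _ \<one>] exI[of _ "[]"]) auto
  next
    case (step w w')
    then obtain g ds where g: "g \<in> carrier G" "walk u ds (g \<cdot> w)" "avoids ds R" by auto
    have V: "w \<in> V" "w' \<in> V" using step by (auto simp: arcs_def)
    from step(2) consider h where "h \<in> carrier G" "w' = h \<cdot> w"
      | f where "f \<in> E" "f \<notin> R" "{w, w'} = {ini f, ter f}" by (auto simp: arcs_def)
    then show ?case
    proof cases
      case 1
      then have "(g \<otimes> inv h) \<cdot> w' = g \<cdot> w" using g V by (simp add: actV_mult)
      then show ?thesis using g 1 by (intro exI[of _ "g \<otimes> inv h"] exI[of _ ds]) auto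
    next
      case 2
      then obtain b where b: "src (f, b) = w" "tgt (f, b) = w'"
        using that[of True] that[of False] by (auto simp: src_def tgt_def doubleton_eq_iff)
      have "walk u (ds @ [actD g (f, b)]) (g \<cdot> w')" using g b 2 V by (auto simp: walk_append)
      moreover have "avoids (ds @ [actD g (f, b)]) R" using g 2 ginvD[OF assms(3)] by auto
      ultimately show ?thesis using g(1) by blast
    qed
  qed
  then show ?thesis using that by blast
qed

subsection \<open>Folds\<close>

text \<open>\<open>forest R\<close>: removing the images of the edges in \<open>R\<close> turns the quotient graph into a forest.\<close>

definition forest :: "'e set \<Rightarrow> bool" where
  "forest R \<longleftrightarrow> ginv R \<and> (\<forall>f\<in>E - R. \<not> conn (R \<union> orbE f) V (ini f) (ter f))"

lemma forestD: "forest R \<Longrightarrow> fst d \<in> E \<Longrightarrow> fst d \<notin> R \<Longrightarrow> \<not> conn (R \<union> orbE (fst d)) V (src d) (tgt d)"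
  unfolding forest_def src_def tgt_def using conn_sym[of V] by auto

text \<open>A walk whose image in a forest is closed must backtrack there.\<close>

lemma fold_exists:
  assumes "forest R" "walk v ds (g \<cdot> v)" "avoids ds R" "ds \<noteq> []" "g \<in> carrier G"
  shows "\<exists>xs a b ys k. ds = xs @ a # b # ys \<and> k \<in> carrier G \<and> k \<cdot> tgt a = tgt a \<and> k \<star> fst a = fst b"
  using assms(2-5)
proof (induction "length ds" arbitrary: ds v g rule: less_induct)
  case less
  then obtain d ds' where ds: "ds = d # ds'" by (cases ds) auto
  let ?Q = "R \<union> orbE (fst d)"
  have d: "fst d \<in> E" "src d = v" "fst d \<notin> R" "walk (tgt d) ds' (g \<cdot> v)" "avoids ds' R" "v \<in> V"
    using less.prems ds by (auto dest: walk_closed)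
  have nc: "\<not> conn ?Q V (tgt d) (src d)"
    using forestD[OF assms(1)] d conn_sym[of V] by blast
  \<comment> \<open>In the quotient without \<open>R\<close> the first edge is a bridge, and the
    walk returns to the orbit of its starting point, so it must cross this bridge again.\<close>
  have "\<exists>b\<in>set ds'. fst b \<in> orbE (fst d)"
  proof (rule ccontr)
    assume "\<not> ?thesis"
    then have "avoids ds' ?Q" using d(5) by (auto simp: avoids_def)
    then have "conn ?Q V (tgt d) (g \<cdot> v)" using conn_walk d(4) by blast
    moreover have "conn ?Q V (g \<cdot> v) v"
      using conn_sym[of V] conn_act[of v V g] d(6) less.prems(4) by simp
    ultimately show False using nc d(2) conn_trans by blast
  qed
  then obtain xs b ys where b: "ds' = xs @ b # ys" "fst b \<in> orbE (fst d)" "\<forall>x\<in>set xs. fst x \<notin> orbE (fst d)"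
    using split_list_first_prop[of ds' "\<lambda>b. fst b \<in> orbE (fst d)"] by blast
  obtain k where k: "k \<in> carrier G" "fst b = k \<star> fst d" using b(2) by (auto simp: orbE_def)
  have w: "walk (tgt d) xs (src b)" "fst b \<in> E" using d(4) b(1) by (auto simp: walk_append)
  have "avoids xs ?Q" using b(1,3) d(5) by (auto simp: avoids_def)
  then have c: "conn ?Q V (tgt d) (src b)" using conn_walk w by blast
  \<comment> \<open>The first return crosses the bridge in the opposite direction. Thus
    \<open>xs\<close> is itself closed modulo the action: if it is empty, \<open>d\<close> and
    \<open>b\<close> form the fold, otherwise the induction hypothesis finds a fold inside
    it.\<close>
  have "src b = k \<cdot> tgt d"
  proof (rule ccontr)
    assume n: "src b \<noteq> k \<cdot> tgt d"
    have "src b \<in> {src (actD k d), tgt (actD k d)}"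
      using dart_ends[of b] dart_ends[of "actD k d"] k by auto
    then have "src b = k \<cdot> src d" using n k d by auto
    then have "conn ?Q V (src b) (src d)" using conn_sym[of V] conn_act[of "src d" V k] k d by simp
    then show False using nc c conn_trans by blast
  qed
  show ?case
  proof (cases xs)
    case Nil
    then have "src b = tgt d" using w by simp
    then show ?thesis using \<open>src b = k \<cdot> tgt d\<close> k Nil b ds by (intro exI[of _ "[]"]) auto
  next
    case (Cons x xs')
    have "\<exists>xs1 a b' ys1 k. xs = xs1 @ a # b' # ys1 \<and> k \<in> carrier G \<and> k \<cdot> tgt a = tgt a \<and> k \<star> fst a = fst b'"
    proof (rule less.hyps)
      show "walk (tgt d) xs (k \<cdot> tgt d)" using w \<open>src b = k \<cdot> tgt d\<close> by simp
      show "avoids xs R" using b d by simp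
    qed (use ds b k Cons in auto)
    then obtain xs1 a b' ys1 k' where *: "xs = xs1 @ a # b' # ys1" "k' \<in> carrier G" "k' \<cdot> tgt a = tgt a"
      "k' \<star> fst a = fst b'" by blast
    then have "ds = (d # xs1) @ a # b' # (ys1 @ b # ys)" using ds b by simp
    then show ?thesis using * by blast
  qed
qed

section \<open>Stabilizers and their conjugates\<close>

abbreviation stV :: "'v \<Rightarrow> 'a set" where "stV v \<equiv> stabilizer G actV v"
abbreviation stE :: "'e \<Rightarrow> 'a set" where "stE e \<equiv> stabilizer G actE e"

lemma stV_iff: "x \<in> stV v \<longleftrightarrow> x \<in> carrier G \<and> x \<cdot> v = v" by (simp add: stabilizer_def)
lemma stE_iff: "x \<in> stE e \<longleftrightarrow> x \<in> carrier G \<and> x \<star> e = e" by (simp add: stabilizer_def)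

lemma subgroup_stV: "v \<in> V \<Longrightarrow> subgroup (stV v) G"
  using group_action.stabilizer_subgroup[OF group_action_V] by blast

lemma subgroup_stE: "e \<in> E \<Longrightarrow> subgroup (stE e) G"
  using group_action.stabilizer_subgroup[OF group_action_E] by blast

lemma stE_subset: "e \<in> E \<Longrightarrow> stE e \<subseteq> stV (ini e)" "e \<in> E \<Longrightarrow> stE e \<subseteq> stV (ter e)"
  by (auto simp: stE_iff stV_iff simp flip: ini_act ter_act)

lemma stE_subset_dart: "fst d \<in> E \<Longrightarrow> stE (fst d) \<subseteq> stV (src d)" "fst d \<in> E \<Longrightarrow> stE (fst d) \<subseteq> stV (tgt d)"
  using stE_subset[of "fst d"] by (auto simp: src_def tgt_def)

lemma conj_cancel:
  assumes "g \<in> carrier G" "x \<in> carrier G"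
  shows "g \<otimes> (inv g \<otimes> x \<otimes> g) \<otimes> inv g = x" "inv g \<otimes> (g \<otimes> x \<otimes> inv g) \<otimes> g = x"
  using assms by (simp_all add: m_assoc) (simp_all add: m_assoc[symmetric])

lemma stV_act: "g \<in> carrier G \<Longrightarrow> v \<in> V \<Longrightarrow> x \<in> carrier G \<Longrightarrow> x \<in> stV (g \<cdot> v) \<longleftrightarrow> inv g \<otimes> x \<otimes> g \<in> stV v"
proof -
  assume a: "g \<in> carrier G" "v \<in> V" "x \<in> carrier G"
  have "(inv g \<otimes> x \<otimes> g) \<cdot> v = inv g \<cdot> x \<cdot> g \<cdot> v" using a by (simp add: actV_mult)
  moreover have "inv g \<cdot> x \<cdot> g \<cdot> v = v \<longleftrightarrow> x \<cdot> g \<cdot> v = g \<cdot> v"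
    using a actV_inv(2)[of g "x \<cdot> g \<cdot> v"] by (metis actV_closed actV_inv(1))
  ultimately show ?thesis using a by (simp add: stV_iff)
qed

lemma stE_act: "g \<in> carrier G \<Longrightarrow> e \<in> E \<Longrightarrow> x \<in> carrier G \<Longrightarrow> x \<in> stE (g \<star> e) \<longleftrightarrow> inv g \<otimes> x \<otimes> g \<in> stE e"
proof -
  assume a: "g \<in> carrier G" "e \<in> E" "x \<in> carrier G"
  have "(inv g \<otimes> x \<otimes> g) \<star> e = inv g \<star> x \<star> g \<star> e" using a by (simp add: actE_mult)
  moreover have "inv g \<star> x \<star> g \<star> e = e \<longleftrightarrow> x \<star> g \<star> e = g \<star> e"
    using a actE_inv(2)[of g "x \<star> g \<star> e"] by (metis actE_closed actE_inv(1))
  ultimately show ?thesis using a by (simp add: stE_iff)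
qed

lemma stV_act': "g \<in> carrier G \<Longrightarrow> v \<in> V \<Longrightarrow> stV (g \<cdot> v) = (\<lambda>x. g \<otimes> x \<otimes> inv g) ` stV v"
proof -
  assume a: "g \<in> carrier G" "v \<in> V"
  show ?thesis
  proof (intro Set.set_eqI iffI)
    fix x assume x: "x \<in> stV (g \<cdot> v)"
    then have "x \<in> carrier G" by (simp add: stV_iff)
    then show "x \<in> (\<lambda>x. g \<otimes> x \<otimes> inv g) ` stV v"
      using x a stV_act[of g v x] conj_cancel(1)[of g x] by (metis imageI)
  next
    fix x assume "x \<in> (\<lambda>x. g \<otimes> x \<otimes> inv g) ` stV v"
    then obtain y where y: "x = g \<otimes> y \<otimes> inv g" "y \<in> stV v" by auto
    then have "y \<in> carrier G" by (simp add: stV_iff)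
    then show "x \<in> stV (g \<cdot> v)" using y a stV_act[of g v x] conj_cancel(2)[of g y] by simp
  qed
qed

lemma stE_act': "g \<in> carrier G \<Longrightarrow> e \<in> E \<Longrightarrow> stE (g \<star> e) = (\<lambda>x. g \<otimes> x \<otimes> inv g) ` stE e"
proof -
  assume a: "g \<in> carrier G" "e \<in> E"
  show ?thesis
  proof (intro Set.set_eqI iffI)
    fix x assume x: "x \<in> stE (g \<star> e)"
    then have "x \<in> carrier G" by (simp add: stE_iff)
    then show "x \<in> (\<lambda>x. g \<otimes> x \<otimes> inv g) ` stE e"
      using x a stE_act[of g e x] conj_cancel(1)[of g x] by (metis imageI)
  next
    fix x assume "x \<in> (\<lambda>x. g \<otimes> x \<otimes> inv g) ` stE e"
    then obtain y where y: "x = g \<otimes> y \<otimes> inv g" "y \<in> stE e" by auto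
    then have "y \<in> carrier G" by (simp add: stE_iff)
    then show "x \<in> stE (g \<star> e)" using y a stE_act[of g e x] conj_cancel(2)[of g y] by simp
  qed
qed

text \<open>Tight walks have no folds: an element which folds the walk at a vertex would fix one of the two
adjacent edges.\<close>

definition tight :: "('e \<times> bool) list \<Rightarrow> bool" where
  "tight ds \<longleftrightarrow> successively (\<lambda>a b. fst a \<noteq> fst b \<and> (stE (fst a) = stV (tgt a) \<or> stE (fst b) = stV (tgt a))) ds"

lemma tight_not_closed:
  assumes "forest R" "walk v ds (g \<cdot> v)" "avoids ds R" "ds \<noteq> []" "g \<in> carrier G"
  shows "\<not> tight ds"
proof
  assume t: "tight ds"
  obtain xs a b ys k where *: "ds = xs @ a # b # ys" "k \<in> carrier G" "k \<cdot> tgt a = tgt a" "k \<star> fst a = fst b"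
    using fold_exists[OF assms] by blast
  have k: "k \<in> stV (tgt a)" using * by (simp add: stV_iff)
  have aE: "fst a \<in> E" using walk_edges[OF assms(2)] * by auto
  have "fst a \<noteq> fst b" "stE (fst a) = stV (tgt a) \<or> stE (fst b) = stV (tgt a)"
    using t * by (auto simp: tight_def successively_append_iff)
  then show False
  proof (elim disjE)
    assume "stE (fst b) = stV (tgt a)"
    then have "k \<star> fst b = fst b" using k by (auto simp: stE_iff)
    then have "k \<star> k \<star> fst a = k \<star> fst a" using * by simp
    then have "k \<star> fst a = fst a" using actE_inv(1)[of k] *(2) aE by (metis actE_closed)
    then show False using * \<open>fst a \<noteq> fst b\<close> by simp
  next
    assume "stE (fst a) = stV (tgt a)"
    then have "k \<star> fst a = fst a" using k stE_iff by blast
    then show False using * \<open>fst a \<noteq> fst b\<close> by simp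
  qed
qed

subsection \<open>Potentials\<close>

text \<open>\<open>H v\<close> is the product of the labels along a walk from \<open>v\<close> to
  \<open>v0\<close>, later labels standing on the left. Closed walks contribute the identity by
  induction on their length: a nonempty one backtracks, and a backtrack multiplies a label by its
  inverse.\<close>

lemma potential_exists:
  fixes F :: "('f, 'c) monoid_scheme"
  assumes "group F" and t: "\<And>e. e \<in> E \<Longrightarrow> t e \<in> carrier F" and v0: "v0 \<in> V"
  obtains H where "\<And>v. v \<in> V \<Longrightarrow> H v \<in> carrier F" "H v0 = \<one>\<^bsub>F\<^esub>"
    "\<And>e. e \<in> E \<Longrightarrow> H (ini e) = H (ter e) \<otimes>\<^bsub>F\<^esub> t e"
proof -
  interpret F: group F by fact
  define s where "s d = (if snd d then t (fst d) else inv\<^bsub>F\<^esub> t (fst d))" for d :: "'e \<times> bool"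
  define hol where "hol ds = foldr (\<lambda>d z. z \<otimes>\<^bsub>F\<^esub> s d) ds \<one>\<^bsub>F\<^esub>" for ds
  have sc: "s d \<in> carrier F" if "fst d \<in> E" for d using that t by (auto simp: s_def)
  have hol_simps: "hol [] = \<one>\<^bsub>F\<^esub>" "\<And>d ds. hol (d # ds) = hol ds \<otimes>\<^bsub>F\<^esub> s d" by (auto simp: hol_def)
  have hc: "hol ds \<in> carrier F" if "walk u ds w" for u ds w
    using that by (induction ds arbitrary: u) (auto simp: hol_simps sc)
  have happ: "hol (xs @ ys) = hol ys \<otimes>\<^bsub>F\<^esub> hol xs" if "walk u (xs @ ys) w" for u xs ys w
    using that
  proof (induction xs arbitrary: u)
    case Nil
    then show ?case using hc by (auto simp: hol_simps)
  next
    case (Cons d xs)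
    obtain v where v: "walk (tgt d) xs v" "walk v ys w" using Cons.prems by (auto simp: walk_append)
    have "hol ys \<in> carrier F" "hol xs \<in> carrier F" using hc v by blast+
    moreover have "hol (xs @ ys) = hol ys \<otimes>\<^bsub>F\<^esub> hol xs" using Cons by auto
    ultimately show ?case using sc[of d] Cons.prems by (simp add: hol_simps F.m_assoc)
  qed
  have closed: "hol ds = \<one>\<^bsub>F\<^esub>" if "walk u ds u" for u ds
    using that
  proof (induction "length ds" arbitrary: ds rule: less_induct)
    case less
    show ?case
    proof (cases "reduced ds")
      case True
      then show ?thesis using reduced_closed_walk[OF less.prems True] by (simp add: hol_simps)
    next
      case False
      then obtain xs a b ys where x: "ds = xs @ a # b # ys" "fst a = fst b" using not_reduced by blast
      have b: "b = flip a" and w: "walk u (xs @ ys) u" using walk_cancel[of u xs a b ys u] less.prems x by auto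
      obtain v where v: "walk u xs v" "walk v (a # b # ys) u" using less.prems x by (auto simp: walk_append)
      then have aE: "fst a \<in> E" and ys: "walk v ys u" using b by auto
      have c: "hol xs \<in> carrier F" "hol ys \<in> carrier F" using hc v ys by blast+
      have "hol (a # b # ys) = hol ys \<otimes>\<^bsub>F\<^esub> (s b \<otimes>\<^bsub>F\<^esub> s a)"
        using c sc[of a] sc[of b] aE b by (simp add: hol_simps F.m_assoc)
      also have "s b \<otimes>\<^bsub>F\<^esub> s a = \<one>\<^bsub>F\<^esub>" using b t[OF aE] by (auto simp: s_def)
      finally have "hol (a # b # ys) = hol ys" using c by simp
      then have "hol ds = hol (xs @ ys)" using happ[OF w] happ[of u xs "a # b # ys" u] less.prems x by simp
      then show ?thesis using less.hyps[OF _ w] x by simp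
    qed
  qed
  have hrev: "hol ds \<otimes>\<^bsub>F\<^esub> hol (rev (map flip ds)) = \<one>\<^bsub>F\<^esub>" if "walk u ds w" for u ds w
  proof -
    have "walk w (rev (map flip ds) @ ds) w" using that walk_rev[OF that] by (auto simp: walk_append)
    then show ?thesis using happ closed by metis
  qed
  have indep: "hol ds = hol ds'" if "walk u ds w" "walk u ds' w" for u ds ds' w
  proof -
    have "walk u (ds @ rev (map flip ds')) u" using that walk_rev[OF that(2)] by (auto simp: walk_append)
    then have "hol (rev (map flip ds')) \<otimes>\<^bsub>F\<^esub> hol ds = \<one>\<^bsub>F\<^esub>" using happ closed by metis
    moreover have "hol (rev (map flip ds')) \<otimes>\<^bsub>F\<^esub> hol ds' = \<one>\<^bsub>F\<^esub>"
      using hrev[OF that(2)] hc[OF that(2)] hc[OF walk_rev[OF that(2)]] F.inv_comm by blast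
    ultimately show ?thesis using hc[OF that(1)] hc[OF that(2)] hc[OF walk_rev[OF that(2)]]
      by (metis F.inv_equality F.inv_inv)
  qed
  define H where "H v = hol (SOME ds. walk v ds v0)" for v
  have H: "H v = hol ds" if "walk v ds v0" for v ds
    unfolding H_def using someI[of "\<lambda>ds. walk v ds v0", OF that] indep that by blast
  have "H v \<in> carrier F" if "v \<in> V" for v
    using walk_exists[OF that v0] H hc by metis
  moreover have "H v0 = \<one>\<^bsub>F\<^esub>" using H[of v0 "[]"] v0 by (simp add: hol_simps)
  moreover have "H (ini e) = H (ter e) \<otimes>\<^bsub>F\<^esub> t e" if e: "e \<in> E" for e
  proof -
    obtain ds where ds: "walk (ter e) ds v0" using walk_exists[OF ter_closed[OF e] v0] by blast
    then have "walk (ini e) ((e, True) # ds) v0" using e by (auto simp: src_def tgt_def)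
    then have "H (ini e) = hol ((e, True) # ds)" by (rule H)
    then show ?thesis using H[OF ds] by (simp add: hol_simps s_def)
  qed
  ultimately show ?thesis using that by blast
qed

subsection \<open>Homomorphisms from cocycles\<close>

lemma m_inv_cancel: "a \<in> carrier G \<Longrightarrow> y \<in> carrier G \<Longrightarrow> a \<otimes> (inv a \<otimes> y) = y"
  by (simp flip: m_assoc)

text \<open>Twisting \<tau> by the cocycle gives edge labels \<open>t\<close> that are equivariant
  up to \<open>c\<close>. For their potential \<open>H\<close>, the product of
  \<open>H (g \<cdot> v)\<close>, \<open>c g v\<close> and the inverse of \<open>H v\<close> agrees
  at the two ends of every edge; so it does not depend on \<open>v\<close>, and it is the
  homomorphism. The last two conclusions retain what is needed to compute its image.\<close>

lemma cocycle_hom: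
  fixes F :: "('f, 'c) monoid_scheme"
  assumes F: "group F"
    and cc: "\<And>g v. g \<in> carrier G \<Longrightarrow> v \<in> V \<Longrightarrow> c g v \<in> carrier F"
    and cm: "\<And>g h v. g \<in> carrier G \<Longrightarrow> h \<in> carrier G \<Longrightarrow> v \<in> V \<Longrightarrow>
      c (g \<otimes> h) v = c g (h \<cdot> v) \<otimes>\<^bsub>F\<^esub> c h v"
    and \<tau>c: "\<And>e. e \<in> E \<Longrightarrow> \<tau> e \<in> carrier F"
    and \<tau>i: "\<And>g e. g \<in> carrier G \<Longrightarrow> e \<in> E \<Longrightarrow> \<tau> (g \<star> e) = \<tau> e"
    and compat: "\<And>e x. e \<in> E \<Longrightarrow> x \<in> stE e \<Longrightarrow> c x (ter e) \<otimes>\<^bsub>F\<^esub> \<tau> e = \<tau> e \<otimes>\<^bsub>F\<^esub> c x (ini e)"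
    and v0: "v0 \<in> V"
  obtains h H where "h \<in> hom G F" "\<And>v. v \<in> V \<Longrightarrow> H v \<in> carrier F" "H v0 = \<one>\<^bsub>F\<^esub>"
    "\<And>g v. g \<in> carrier G \<Longrightarrow> v \<in> V \<Longrightarrow> h g \<otimes>\<^bsub>F\<^esub> H v = H (g \<cdot> v) \<otimes>\<^bsub>F\<^esub> c g v"
    "\<And>e. e \<in> E \<Longrightarrow> \<exists>g\<in>carrier G.
       H (ini e) = H (ter e) \<otimes>\<^bsub>F\<^esub> c g (inv g \<cdot> ter e) \<otimes>\<^bsub>F\<^esub> \<tau> e \<otimes>\<^bsub>F\<^esub> c (inv g) (ini e)"
proof -
  interpret F: group F by fact
  have c1: "c \<one> v = \<one>\<^bsub>F\<^esub>" if "v \<in> V" for v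
    using cm[of \<one> \<one> v] cc[of \<one> v] that by simp
  have ci: "c (inv g) (g \<cdot> v) = inv\<^bsub>F\<^esub> c g v" if "g \<in> carrier G" "v \<in> V" for g v
  proof -
    have "c (inv g) (g \<cdot> v) \<otimes>\<^bsub>F\<^esub> c g v = \<one>\<^bsub>F\<^esub>" using cm[of "inv g" g v] c1 that by simp
    then show ?thesis using cc that F.inv_equality by (metis actV_closed inv_closed)
  qed
  define r where "r e = (SOME e'. e' \<in> orbE e)" for e
  have r: "r e \<in> orbE e" if "e \<in> E" for e
    unfolding r_def by (rule someI[of _ e]) (use that in simp)
  have orb: "orbE (g \<star> e) = orbE e" if "g \<in> carrier G" "e \<in> E" for g e
  proof -
    have "orbE (g \<star> e) \<subseteq> orbE e" if "g \<in> carrier G" "e \<in> E" for g e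
      using that unfolding orbE_def by (auto simp flip: actE_mult)
    from this[OF that] this[of "inv g" "g \<star> e"] that show ?thesis by simp
  qed
  have rg: "r (g \<star> e) = r e" if "g \<in> carrier G" "e \<in> E" for g e using orb[OF that] by (simp add: r_def)
  have rE: "r e \<in> E" if "e \<in> E" for e using r[OF that] orbE_subset that by blast
  have "\<exists>g\<in>carrier G. g \<star> r e = e" if "e \<in> E" for e
  proof -
    obtain g where "g \<in> carrier G" "r e = g \<star> e" using r[OF \<open>e \<in> E\<close>] by (auto simp: orbE_def)
    then show ?thesis using that by (intro bexI[of _ "inv g"]) auto
  qed
  then obtain \<sigma> where \<sigma>: "\<And>e. e \<in> E \<Longrightarrow> \<sigma> e \<in> carrier G \<and> \<sigma> e \<star> r e = e" by metis
  \<comment> \<open>The label of \<open>e\<close> transported to \<open>g \<star> e\<close>. By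
    \<open>compat\<close> the stabilizer of \<open>e\<close> does not change it, so the choice of
    \<open>\<sigma>\<close> among the elements carrying the representative to an edge is
    immaterial.\<close>
  define t0 where "t0 g e = c g (ter e) \<otimes>\<^bsub>F\<^esub> \<tau> e \<otimes>\<^bsub>F\<^esub> inv\<^bsub>F\<^esub> c g (ini e)" for g e
  define t where "t e = t0 (\<sigma> e) (r e)" for e
  have t0c: "t0 g e \<in> carrier F" if "g \<in> carrier G" "e \<in> E" for g e
    using that cc \<tau>c by (simp add: t0_def)
  have t0_mult: "t0 (g \<otimes> h) e = c g (h \<cdot> ter e) \<otimes>\<^bsub>F\<^esub> t0 h e \<otimes>\<^bsub>F\<^esub> inv\<^bsub>F\<^esub> c g (h \<cdot> ini e)"
    if "g \<in> carrier G" "h \<in> carrier G" "e \<in> E" for g h e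
    using that cc \<tau>c by (simp add: t0_def cm F.inv_mult_group F.m_assoc)
  have t0_st: "t0 x e = \<tau> e" if "e \<in> E" "x \<in> stE e" for e x
    unfolding t0_def compat[OF that]
    using that cc[of x] \<tau>c[OF that(1)] by (simp add: F.m_assoc stE_iff)
  have t_act: "t (g \<star> e) = c g (ter e) \<otimes>\<^bsub>F\<^esub> t e \<otimes>\<^bsub>F\<^esub> inv\<^bsub>F\<^esub> c g (ini e)"
    if g: "g \<in> carrier G" and e: "e \<in> E" for g e
  proof -
    let ?s = "\<sigma> (g \<star> e)"
    have s: "?s \<in> carrier G" "?s \<star> r e = g \<star> e" using \<sigma>[of "g \<star> e"] g e rg by auto
    define k where "k = inv ?s \<otimes> (g \<otimes> \<sigma> e)"
    have kc: "k \<in> carrier G" using s g \<sigma>[OF e] by (simp add: k_def)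
    have k: "k \<in> stE (r e)"
      using s g \<sigma>[OF e] rE[OF e] kc by (simp add: stE_iff k_def actE_mult) (metis actE_inv(1))
    have sk: "?s \<otimes> k = g \<otimes> \<sigma> e" using s g \<sigma>[OF e] by (simp add: k_def m_assoc[symmetric])
    have kv: "k \<cdot> ter (r e) = ter (r e)" "k \<cdot> ini (r e) = ini (r e)"
      using k stE_subset[OF rE[OF e]] by (auto simp: stV_iff)
    have tt: "\<sigma> e \<cdot> ter (r e) = ter e" "\<sigma> e \<cdot> ini (r e) = ini e"
      using \<sigma>[OF e] rE[OF e] by (metis ter_act, metis ini_act)
    have "t0 (g \<otimes> \<sigma> e) (r e) = t0 ?s (r e)"
      unfolding sk[symmetric] t0_mult[OF s(1) kc rE[OF e]] t0_st[OF rE[OF e] k] kv by (simp add: t0_def)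
    also have "\<dots> = t (g \<star> e)" using rg g e by (simp add: t_def)
    finally show ?thesis
      using t0_mult[OF g _ rE[OF e], of "\<sigma> e"] \<sigma>[OF e] tt by (simp add: t_def)
  qed
  have tc: "t e \<in> carrier F" if "e \<in> E" for e using t0c \<sigma> rE that by (simp add: t_def)
  obtain H where H: "\<And>v. v \<in> V \<Longrightarrow> H v \<in> carrier F" "H v0 = \<one>\<^bsub>F\<^esub>"
    "\<And>e. e \<in> E \<Longrightarrow> H (ini e) = H (ter e) \<otimes>\<^bsub>F\<^esub> t e"
    by (rule potential_exists[OF F _ v0, of t]) (use tc in auto)
  \<comment> \<open>The defect of \<open>H\<close> as a trivialization of the cocycle; it is
    constant along walks and hence depends on \<open>g\<close> only.\<close>
  define \<phi> where "\<phi> g v = H (g \<cdot> v) \<otimes>\<^bsub>F\<^esub> c g v \<otimes>\<^bsub>F\<^esub> inv\<^bsub>F\<^esub> H v" for g v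
  have edge: "\<phi> g (ini e) = \<phi> g (ter e)" if g: "g \<in> carrier G" and e: "e \<in> E" for g e
  proof -
    have "H (g \<cdot> ini e) = H (g \<cdot> ter e) \<otimes>\<^bsub>F\<^esub> (c g (ter e) \<otimes>\<^bsub>F\<^esub> t e \<otimes>\<^bsub>F\<^esub> inv\<^bsub>F\<^esub> c g (ini e))"
      using H(3)[of "g \<star> e"] t_act[OF g e] g e by simp
    then show ?thesis
      using H(1) H(3)[OF e] cc tc g e by (simp add: \<phi>_def F.m_assoc F.inv_mult_group) (simp add: F.m_assoc[symmetric])
  qed
  have const: "\<phi> g u = \<phi> g w" if "walk u ds w" "g \<in> carrier G" for g u w ds
    using that
  proof (induction ds arbitrary: u)
    case (Cons d ds)
    then have dE: "fst d \<in> E" by simp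
    have "\<phi> g (src d) = \<phi> g (tgt d)" using edge[OF Cons.prems(2) dE] unfolding src_def tgt_def by simp
    moreover have "\<phi> g (tgt d) = \<phi> g w" using Cons by auto
    ultimately show ?case using Cons.prems by simp
  qed simp
  have const': "\<phi> g u = \<phi> g w" if "u \<in> V" "w \<in> V" "g \<in> carrier G" for g u w
    using walk_exists[OF that(1,2)] const that(3) by blast
  define h where "h g = \<phi> g v0" for g
  have hH: "h g \<otimes>\<^bsub>F\<^esub> H v = H (g \<cdot> v) \<otimes>\<^bsub>F\<^esub> c g v" if "g \<in> carrier G" "v \<in> V" for g v
    unfolding h_def const'[OF v0 that(2,1)] using H(1) cc that by (simp add: \<phi>_def F.m_assoc)
  have hc: "h g \<in> carrier F" if "g \<in> carrier G" for g using that v0 H cc by (simp add: h_def \<phi>_def)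
  have "h \<in> hom G F"
  proof (rule homI)
    fix g k assume gk: "g \<in> carrier G" "k \<in> carrier G"
    have "h (g \<otimes> k) \<otimes>\<^bsub>F\<^esub> H v0 = h g \<otimes>\<^bsub>F\<^esub> h k \<otimes>\<^bsub>F\<^esub> H v0"
      using hH[of "g \<otimes> k" v0] hH[of k v0] hH[of g "k \<cdot> v0"] gk v0 H(1) hc cc
      by (simp add: cm actV_mult F.m_assoc) (simp add: F.m_assoc[symmetric])
    then show "h (g \<otimes> k) = h g \<otimes>\<^bsub>F\<^esub> h k" using hc gk H(2) by simp
  qed (rule hc)
  moreover have "\<exists>g\<in>carrier G.
       H (ini e) = H (ter e) \<otimes>\<^bsub>F\<^esub> c g (inv g \<cdot> ter e) \<otimes>\<^bsub>F\<^esub> \<tau> e \<otimes>\<^bsub>F\<^esub> c (inv g) (ini e)" if e: "e \<in> E" for e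
  proof -
    let ?s = "\<sigma> e"
    have s: "?s \<in> carrier G" "?s \<star> r e = e" "r e \<in> E" using \<sigma>[OF e] rE[OF e] by auto
    then have tt: "?s \<cdot> ter (r e) = ter e" "?s \<cdot> ini (r e) = ini e" by (metis ter_act, metis ini_act)
    have "inv ?s \<cdot> ter e = ter (r e)" using tt s by (metis actV_inv(1) ter_closed)
    moreover have "c (inv ?s) (ini e) = inv\<^bsub>F\<^esub> c ?s (ini (r e))" using ci[of ?s "ini (r e)"] s tt by simp
    moreover have "\<tau> e = \<tau> (r e)" using \<tau>i[of ?s "r e"] s by simp
    ultimately show ?thesis
      using H(3)[OF e] s H(1) cc \<tau>c e by (intro bexI[of _ ?s]) (auto simp: t_def t0_def F.m_assoc)
  qed
  ultimately show ?thesis using that H hH by blast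
qed

section \<open>Equivariant families and the homomorphisms they induce\<close>

definition family :: "('v \<Rightarrow> 'a \<Rightarrow> int) \<Rightarrow> bool" where
  "family \<chi> \<longleftrightarrow> (\<forall>v\<in>V. zhom (stV v) (\<chi> v) \<and>
     (\<forall>g\<in>carrier G. \<forall>x\<in>stV v. \<chi> (g \<cdot> v) (g \<otimes> x \<otimes> inv g) = \<chi> v x))"

text \<open>The cocycle takes powers of \<open>L (col v)\<close>; the exponent is \<chi> evaluated
  at an orbit representative, after \<open>g\<close> has been moved into its stabilizer. The
  exponents in the conclusions are stated as values of \<chi>, so that they vanish if \<chi>
  does.\<close>

lemma family_hom:
  fixes F :: "('f, 'c) monoid_scheme" and L :: "bool \<Rightarrow> 'f"
  assumes F: "group F" and L: "\<And>s. L s \<in> carrier F" and \<chi>: "family \<chi>"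
    and col: "\<And>g v. g \<in> carrier G \<Longrightarrow> v \<in> V \<Longrightarrow> col (g \<cdot> v) = col v"
    and \<tau>c: "\<And>e. e \<in> E \<Longrightarrow> \<tau> e \<in> carrier F"
    and \<tau>i: "\<And>g e. g \<in> carrier G \<Longrightarrow> e \<in> E \<Longrightarrow> \<tau> (g \<star> e) = \<tau> e"
    and edges: "\<And>f. f \<in> E \<Longrightarrow>
      (col (ini f) = col (ter f) \<and> \<tau> f = \<one>\<^bsub>F\<^esub> \<and> (\<forall>x\<in>stE f. \<chi> (ini f) x = \<chi> (ter f) x)) \<or>
      (\<forall>x\<in>stE f. \<chi> (ini f) x = 0 \<and> \<chi> (ter f) x = 0)"
    and v0: "v0 \<in> V"
  obtains h H where "h \<in> hom G F" "\<And>v. v \<in> V \<Longrightarrow> H v \<in> carrier F" "H v0 = \<one>\<^bsub>F\<^esub>"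
    "\<And>v x. v \<in> V \<Longrightarrow> x \<in> stV v \<Longrightarrow> h x \<otimes>\<^bsub>F\<^esub> H v = H v \<otimes>\<^bsub>F\<^esub> L (col v) [^]\<^bsub>F\<^esub> \<chi> v x"
    "\<And>v g. v \<in> V \<Longrightarrow> g \<in> carrier G \<Longrightarrow>
       \<exists>x\<in>stV v. h g \<otimes>\<^bsub>F\<^esub> H v = H (g \<cdot> v) \<otimes>\<^bsub>F\<^esub> L (col v) [^]\<^bsub>F\<^esub> \<chi> v x"
    "\<And>f. f \<in> E \<Longrightarrow> \<exists>x\<in>stV (ter f). \<exists>y\<in>stV (ini f).
       H (ini f) = H (ter f) \<otimes>\<^bsub>F\<^esub> L (col (ter f)) [^]\<^bsub>F\<^esub> \<chi> (ter f) x \<otimes>\<^bsub>F\<^esub> \<tau> f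
         \<otimes>\<^bsub>F\<^esub> L (col (ini f)) [^]\<^bsub>F\<^esub> \<chi> (ini f) y"
proof -
  interpret F: group F by fact
  have zh: "zhom (stV v) (\<chi> v)" if "v \<in> V" for v using \<chi> that by (auto simp: family_def)
  have inv\<chi>: "\<chi> (g \<cdot> v) (g \<otimes> x \<otimes> inv g) = \<chi> v x" if "g \<in> carrier G" "v \<in> V" "x \<in> stV v" for g v x
    using \<chi> that by (auto simp: family_def)
  define orb where "orb v = (\<lambda>g. g \<cdot> v) ` carrier G" for v
  define r where "r v = (SOME w. w \<in> orb v)" for v
  have r: "r v \<in> orb v" if "v \<in> V" for v
    unfolding r_def orb_def by (rule someI[of _ "\<one> \<cdot> v"]) simp
  have orb: "orb (g \<cdot> v) = orb v" if "g \<in> carrier G" "v \<in> V" for g v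
  proof -
    have "orb (g \<cdot> v) \<subseteq> orb v" if "g \<in> carrier G" "v \<in> V" for g v
      using that unfolding orb_def by (auto simp flip: actV_mult)
    from this[OF that] this[of "inv g" "g \<cdot> v"] that show ?thesis by simp
  qed
  have rg: "r (g \<cdot> v) = r v" if "g \<in> carrier G" "v \<in> V" for g v using orb[OF that] by (simp add: r_def)
  have rV: "r v \<in> V" if "v \<in> V" for v using r[OF that] that by (auto simp: orb_def)
  have "\<exists>g\<in>carrier G. g \<cdot> r v = v" if "v \<in> V" for v
  proof -
    obtain g where "g \<in> carrier G" "r v = g \<cdot> v" using r[OF \<open>v \<in> V\<close>] by (auto simp: orb_def)
    then show ?thesis using that by (intro bexI[of _ "inv g"]) auto
  qed
  then obtain \<sigma> where \<sigma>: "\<And>v. v \<in> V \<Longrightarrow> \<sigma> v \<in> carrier G \<and> \<sigma> v \<cdot> r v = v" by metis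
  \<comment> \<open>From the representative to \<open>v\<close>, then by \<open>g\<close> to
    \<open>g \<cdot> v\<close>, then back to the same representative. These elements satisfy the
    cocycle identity in the stabilizer of the representative.\<close>
  define k where "k g v = inv (\<sigma> (g \<cdot> v)) \<otimes> g \<otimes> \<sigma> v" for g v
  have kc: "k g v \<in> carrier G" if "g \<in> carrier G" "v \<in> V" for g v
    using that \<sigma> by (simp add: k_def)
  have kst: "k g v \<in> stV (r v)" if "g \<in> carrier G" "v \<in> V" for g v
  proof -
    have "k g v \<cdot> r v = inv (\<sigma> (g \<cdot> v)) \<cdot> g \<cdot> \<sigma> v \<cdot> r v"
      using that \<sigma>[of v] \<sigma>[of "g \<cdot> v"] rV by (simp add: k_def actV_mult)
    also have "\<dots> = inv (\<sigma> (g \<cdot> v)) \<cdot> \<sigma> (g \<cdot> v) \<cdot> r (g \<cdot> v)" using that \<sigma>[of v] \<sigma>[of "g \<cdot> v"] by simp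
    also have "\<dots> = r (g \<cdot> v)"
      using actV_inv(1)[of "\<sigma> (g \<cdot> v)" "r (g \<cdot> v)"] \<sigma>[of "g \<cdot> v"] rV[of "g \<cdot> v"] that by simp
    also have "\<dots> = r v" using that by (rule rg)
    finally show ?thesis using kc that by (simp add: stV_iff)
  qed
  define c where "c g v = L (col v) [^]\<^bsub>F\<^esub> \<chi> (r v) (k g v)" for g v
  have kmult: "k (g \<otimes> h) v = k g (h \<cdot> v) \<otimes> k h v"
    if "g \<in> carrier G" "h \<in> carrier G" "v \<in> V" for g h v
  proof -
    have s: "\<sigma> v \<in> carrier G" "\<sigma> (h \<cdot> v) \<in> carrier G" "\<sigma> (g \<cdot> h \<cdot> v) \<in> carrier G" using \<sigma> that by auto
    have "k g (h \<cdot> v) \<otimes> k h v = inv (\<sigma> (g \<cdot> h \<cdot> v)) \<otimes> g \<otimes> (\<sigma> (h \<cdot> v) \<otimes> inv (\<sigma> (h \<cdot> v))) \<otimes> h \<otimes> \<sigma> v"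
      unfolding k_def using s that by (simp add: m_assoc m_inv_cancel del: r_inv)
    also have "\<dots> = inv (\<sigma> (g \<cdot> h \<cdot> v)) \<otimes> g \<otimes> h \<otimes> \<sigma> v" using s that by simp
    finally show ?thesis using s that by (simp add: k_def actV_mult m_assoc)
  qed
  have val: "\<exists>x\<in>stV w. c g v = L (col w) [^]\<^bsub>F\<^esub> \<chi> w x"
    if "g \<in> carrier G" "v \<in> V" "w = v \<or> w = g \<cdot> v" for g v w
  proof -
    have w: "w \<in> V" "r w = r v" "col w = col v" using that rg col by auto
    let ?x = "\<sigma> w \<otimes> k g v \<otimes> inv (\<sigma> w)"
    have sw: "\<sigma> w \<in> carrier G" "\<sigma> w \<cdot> r v = w" using \<sigma>[OF w(1)] w by auto
    have kk: "k g v \<in> stV (r v)" using kst that by blast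
    have "?x \<in> stV w" using stV_act'[OF sw(1) rV[OF that(2)]] sw kk by auto
    moreover have "\<chi> w ?x = \<chi> (r v) (k g v)" using inv\<chi>[OF sw(1) rV[OF that(2)] kk] sw by simp
    ultimately show ?thesis unfolding c_def w(3) by metis
  qed
  have c_st: "c x v = L (col v) [^]\<^bsub>F\<^esub> \<chi> v x" if v: "v \<in> V" and x: "x \<in> stV v" for x v
  proof -
    have xx: "x \<in> carrier G" "x \<cdot> v = v" using x by (auto simp: stV_iff)
    have s: "\<sigma> v \<in> carrier G" "\<sigma> v \<cdot> r v = v" using \<sigma>[OF v] by auto
    have "\<chi> v (\<sigma> v \<otimes> k x v \<otimes> inv (\<sigma> v)) = \<chi> (r v) (k x v)"
      using inv\<chi>[OF s(1) rV[OF v] kst[OF xx(1) v]] s by simp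
    moreover have "\<sigma> v \<otimes> k x v \<otimes> inv (\<sigma> v) = x" using conj_cancel(1)[OF s(1) xx(1)] xx by (simp add: k_def)
    ultimately show ?thesis by (simp add: c_def)
  qed
  have 1: "c g v \<in> carrier F" if "g \<in> carrier G" "v \<in> V" for g v using L by (simp add: c_def)
  have 2: "c (g \<otimes> h) v = c g (h \<cdot> v) \<otimes>\<^bsub>F\<^esub> c h v" if "g \<in> carrier G" "h \<in> carrier G" "v \<in> V" for g h v
    unfolding c_def kmult[OF that]
    using zhomD[OF zh[OF rV[OF that(3)]]] kst[of g "h \<cdot> v"] kst[of h v] that L
    by (simp add: rg col F.int_pow_mult)
  \<comment> \<open>The dichotomy for edges is used here: either both sides are the same power next
    to a trivial label, or both exponents are zero and the label is arbitrary.\<close>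
  have 3: "c x (ter e) \<otimes>\<^bsub>F\<^esub> \<tau> e = \<tau> e \<otimes>\<^bsub>F\<^esub> c x (ini e)" if e: "e \<in> E" "x \<in> stE e" for e x
  proof -
    have "x \<in> stV (ini e)" "x \<in> stV (ter e)" using stE_subset e by auto
    then show ?thesis using edges[OF e(1)] e \<tau>c[OF e(1)] L by (auto simp: c_st)
  qed
  obtain h H
    where H: "h \<in> hom G F" "\<And>v. v \<in> V \<Longrightarrow> H v \<in> carrier F" "H v0 = \<one>\<^bsub>F\<^esub>"
    "\<And>g v. g \<in> carrier G \<Longrightarrow> v \<in> V \<Longrightarrow> h g \<otimes>\<^bsub>F\<^esub> H v = H (g \<cdot> v) \<otimes>\<^bsub>F\<^esub> c g v"
    "\<And>e. e \<in> E \<Longrightarrow> \<exists>g\<in>carrier G.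
       H (ini e) = H (ter e) \<otimes>\<^bsub>F\<^esub> c g (inv g \<cdot> ter e) \<otimes>\<^bsub>F\<^esub> \<tau> e \<otimes>\<^bsub>F\<^esub> c (inv g) (ini e)"
    by (rule cocycle_hom[OF F 1 2 \<tau>c \<tau>i 3 v0]) auto
  show ?thesis
  proof (rule that[of h H])
    show "h x \<otimes>\<^bsub>F\<^esub> H v = H v \<otimes>\<^bsub>F\<^esub> L (col v) [^]\<^bsub>F\<^esub> \<chi> v x" if "v \<in> V" "x \<in> stV v" for v x
      using H(4)[of x v] c_st[OF that] that by (simp add: stV_iff)
    show "\<exists>x\<in>stV v. h g \<otimes>\<^bsub>F\<^esub> H v = H (g \<cdot> v) \<otimes>\<^bsub>F\<^esub> L (col v) [^]\<^bsub>F\<^esub> \<chi> v x"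
      if "v \<in> V" "g \<in> carrier G" for v g
      using H(4)[OF that(2,1)] val[OF that(2,1), of v] by metis
    show "\<exists>x\<in>stV (ter f). \<exists>y\<in>stV (ini f).
       H (ini f) = H (ter f) \<otimes>\<^bsub>F\<^esub> L (col (ter f)) [^]\<^bsub>F\<^esub> \<chi> (ter f) x \<otimes>\<^bsub>F\<^esub> \<tau> f
         \<otimes>\<^bsub>F\<^esub> L (col (ini f)) [^]\<^bsub>F\<^esub> \<chi> (ini f) y" if f: "f \<in> E" for f
    proof -
      obtain g where g: "g \<in> carrier G"
        "H (ini f) = H (ter f) \<otimes>\<^bsub>F\<^esub> c g (inv g \<cdot> ter f) \<otimes>\<^bsub>F\<^esub> \<tau> f \<otimes>\<^bsub>F\<^esub> c (inv g) (ini f)"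
        using H(5)[OF f] by blast
      obtain x where "x \<in> stV (ter f)" "c g (inv g \<cdot> ter f) = L (col (ter f)) [^]\<^bsub>F\<^esub> \<chi> (ter f) x"
        using val[of g "inv g \<cdot> ter f" "ter f"] g f by auto
      moreover obtain y where "y \<in> stV (ini f)" "c (inv g) (ini f) = L (col (ini f)) [^]\<^bsub>F\<^esub> \<chi> (ini f) y"
        using val[of "inv g" "ini f" "ini f"] g f by auto
      ultimately show ?thesis using g(2) by auto
    qed
  qed (use H(1-3) in auto)
qed

definition maps_onto_F2 :: bool where
  "maps_onto_F2 \<longleftrightarrow> (\<exists>h. h \<in> hom G free_group_F2 \<and> h ` carrier G = carrier free_group_F2)"

section \<open>Components of the quotient without one edge, and the image in the free group\<close>

lemma conn_propagate:
  assumes "conn R V u v" "P u" "u \<in> V"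
    and g: "\<And>g v. g \<in> carrier G \<Longrightarrow> v \<in> V \<Longrightarrow> P v \<Longrightarrow> P (g \<cdot> v)"
    and f: "\<And>f. f \<in> E - R \<Longrightarrow> P (ini f) \<Longrightarrow> P (ter f)" "\<And>f. f \<in> E - R \<Longrightarrow> P (ter f) \<Longrightarrow> P (ini f)"
  shows "P v"
  using assms(1) unfolding conn_def
proof (induction rule: rtrancl_induct)
  case base
  then show ?case by fact
next
  case (step w w')
  from step(2) consider h where "h \<in> carrier G" "w' = h \<cdot> w" "w \<in> V"
    | e where "e \<in> E - R" "{w, w'} = {ini e, ter e}" by (auto simp: arcs_def)
  then show ?case
  proof cases
    case 1 then show ?thesis using g step.IH by simp
  next
    case 2 then show ?thesis using f step.IH by (auto simp: doubleton_eq_iff)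
  qed
qed

text \<open>The quotient of a tree is connected, so deleting one edge leaves at most two components,
  and each contains an end of that edge.\<close>

lemma conn_or:
  assumes "e \<in> E" "v \<in> V"
  shows "conn (orbE e) V (ini e) v \<or> conn (orbE e) V (ter e) v"
proof -
  let ?P = "\<lambda>v. conn (orbE e) V (ini e) v \<or> conn (orbE e) V (ter e) v"
  obtain ds where "walk (ini e) ds v" using walk_exists[OF ini_closed[OF assms(1)] assms(2)] by blast
  then have "conn {} V (ini e) v" by (rule conn_walk) simp
  then show ?thesis
  proof (rule conn_propagate[where P = ?P])
    show "?P (g \<cdot> w)" if "g \<in> carrier G" "w \<in> V" "?P w" for g w
      using that conn_act[of w V g "orbE e"] conn_trans by (metis actV_closed)
    show "?P (ter f)" if f: "f \<in> E - {}" "?P (ini f)" for f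
    proof (cases "f \<in> orbE e")
      case True
      then obtain g where "g \<in> carrier G" "f = g \<star> e" by (auto simp: orbE_def)
      then show ?thesis using conn_act[of "ter e" V g "orbE e"] assms by auto
    next
      case False
      then have "conn (orbE e) V (ini f) (ter f)" using f by (intro conn_edge) auto
      then show ?thesis using f conn_trans by blast
    qed
    show "?P (ini f)" if f: "f \<in> E - {}" "?P (ter f)" for f
    proof (cases "f \<in> orbE e")
      case True
      then obtain g where "g \<in> carrier G" "f = g \<star> e" by (auto simp: orbE_def)
      then show ?thesis using conn_act[of "ini e" V g "orbE e"] assms by auto
    next
      case False
      then have "conn (orbE e) V (ter f) (ini f)" using f by (intro conn_edge) auto
      then show ?thesis using f conn_trans by blast
    qed
  qed (use assms in auto)
qed

lemma conn_all:
  assumes "e \<in> E" "conn (orbE e) V (ini e) (ter e)" "v \<in> V"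
  shows "conn (orbE e) V (ini e) v"
  using conn_or[OF assms(1,3)] assms(2) conn_trans by blast

text \<open>\<open>Q v\<close> says that the potential at \<open>v\<close> is a product of an element of the image \<open>I\<close> and a power of
the generator \<open>gen_F2 (col v)\<close>.\<close>

lemma F2_hom:
  assumes \<chi>: "family \<chi>"
    and col: "\<And>g v. g \<in> carrier G \<Longrightarrow> v \<in> V \<Longrightarrow> col (g \<cdot> v) = col v"
    and \<tau>c: "\<And>e. e \<in> E \<Longrightarrow> \<tau> e \<in> carrier free_group_F2"
    and \<tau>i: "\<And>g e. g \<in> carrier G \<Longrightarrow> e \<in> E \<Longrightarrow> \<tau> (g \<star> e) = \<tau> e"
    and edges: "\<And>f. f \<in> E \<Longrightarrow>
      (col (ini f) = col (ter f) \<and> \<tau> f = \<one>\<^bsub>free_group_F2\<^esub> \<and> (\<forall>x\<in>stE f. \<chi> (ini f) x = \<chi> (ter f) x)) \<or>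
      (\<forall>x\<in>stE f. \<chi> (ini f) x = 0 \<and> \<chi> (ter f) x = 0)"
    and flat: "\<And>f. f \<in> E - R \<Longrightarrow> col (ini f) = col (ter f) \<and> \<tau> f = \<one>\<^bsub>free_group_F2\<^esub>"
    and v0: "v0 \<in> V"
  obtains h I Q where "h \<in> hom G free_group_F2" "I = h ` carrier G" "subgroup I free_group_F2" "Q v0"
    "\<And>u v. conn R V u v \<Longrightarrow> u \<in> V \<Longrightarrow> Q u \<Longrightarrow> Q v \<and> col v = col u"
    "\<And>v x. v \<in> V \<Longrightarrow> Q v \<Longrightarrow> x \<in> stV v \<Longrightarrow> gen_F2 (col v) [^]\<^bsub>free_group_F2\<^esub> \<chi> v x \<in> I"
    "\<And>f. f \<in> E \<Longrightarrow> Q (ini f) \<Longrightarrow> gen_F2 (col (ini f)) \<in> I \<Longrightarrow> \<tau> f = \<one>\<^bsub>free_group_F2\<^esub> \<Longrightarrow> Q (ter f)"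
    "\<And>f. f \<in> E \<Longrightarrow> Q (ini f) \<Longrightarrow> Q (ter f) \<Longrightarrow>
       gen_F2 (col (ini f)) \<in> I \<and> gen_F2 (col (ter f)) \<in> I \<or> (\<forall>v\<in>V. \<forall>x\<in>stV v. \<chi> v x = 0) \<Longrightarrow> \<tau> f \<in> I"
proof -
  let ?F = free_group_F2
  interpret F: group ?F by (rule group_free_group_F2)
  note L = gen_F2_closed
  obtain h H where h: "h \<in> hom G ?F" and Hc: "\<And>v. v \<in> V \<Longrightarrow> H v \<in> carrier ?F" and H0: "H v0 = \<one>\<^bsub>?F\<^esub>"
    and H1: "\<And>v x. v \<in> V \<Longrightarrow> x \<in> stV v \<Longrightarrow> h x \<otimes>\<^bsub>?F\<^esub> H v = H v \<otimes>\<^bsub>?F\<^esub> gen_F2 (col v) [^]\<^bsub>?F\<^esub> \<chi> v x"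
    and H2: "\<And>v g. v \<in> V \<Longrightarrow> g \<in> carrier G \<Longrightarrow>
       \<exists>x\<in>stV v. h g \<otimes>\<^bsub>?F\<^esub> H v = H (g \<cdot> v) \<otimes>\<^bsub>?F\<^esub> gen_F2 (col v) [^]\<^bsub>?F\<^esub> \<chi> v x"
    and H3: "\<And>f. f \<in> E \<Longrightarrow> \<exists>x\<in>stV (ter f). \<exists>y\<in>stV (ini f).
       H (ini f) = H (ter f) \<otimes>\<^bsub>?F\<^esub> gen_F2 (col (ter f)) [^]\<^bsub>?F\<^esub> \<chi> (ter f) x \<otimes>\<^bsub>?F\<^esub> \<tau> f
         \<otimes>\<^bsub>?F\<^esub> gen_F2 (col (ini f)) [^]\<^bsub>?F\<^esub> \<chi> (ini f) y"
    by (rule family_hom[where L = gen_F2, OF group_free_group_F2 L \<chi> col \<tau>c \<tau>i edges v0]) (assumption | (rule that; assumption))+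
  define I where "I = h ` carrier G"
  define zero where "zero \<longleftrightarrow> (\<forall>v\<in>V. \<forall>x\<in>stV v. \<chi> v x = 0)"
  have sI: "subgroup I ?F"
    unfolding I_def using h by (intro group_hom.img_is_subgroup group_hom.intro) (auto simp: group_hom_axioms_def is_group)
  have Ic: "i \<in> carrier ?F" if "i \<in> I" for i using subgroup.mem_carrier[OF sI that] .
  have Im: "i \<otimes>\<^bsub>?F\<^esub> j \<in> I" if "i \<in> I" "j \<in> I" for i j using subgroup.m_closed[OF sI that] .
  have Ii: "inv\<^bsub>?F\<^esub> i \<in> I" if "i \<in> I" for i using subgroup.m_inv_closed[OF sI that] .
  have I1: "\<one>\<^bsub>?F\<^esub> \<in> I" using subgroup.one_closed[OF sI] .
  have hI: "h g \<in> I" if "g \<in> carrier G" for g using that by (simp add: I_def)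
  have Ip: "i [^]\<^bsub>?F\<^esub> (n::int) \<in> I" if "i \<in> I" for i n using F.subgroup_int_pow_closed[OF sI that] .
  \<comment> \<open>The clause on \<open>zero\<close> serves families that vanish identically:
    potentials are then elements of \<open>I\<close> themselves, and edge labels can be recovered
    before any generator is known to lie in \<open>I\<close>.\<close>
  define P where "P s z \<longleftrightarrow> (\<exists>i\<in>I. \<exists>n::int. z = i \<otimes>\<^bsub>?F\<^esub> gen_F2 s [^]\<^bsub>?F\<^esub> n \<and> (zero \<longrightarrow> n = 0))" for s z
  have Pm: "P s (i \<otimes>\<^bsub>?F\<^esub> z)" if iz: "i \<in> I" "P s z" for s i z
  proof -
    obtain j n where "j \<in> I" "z = j \<otimes>\<^bsub>?F\<^esub> gen_F2 s [^]\<^bsub>?F\<^esub> (n::int)" "zero \<longrightarrow> n = 0"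
      using iz by (auto simp: P_def)
    moreover from this have "i \<otimes>\<^bsub>?F\<^esub> z = (i \<otimes>\<^bsub>?F\<^esub> j) \<otimes>\<^bsub>?F\<^esub> gen_F2 s [^]\<^bsub>?F\<^esub> n"
      using Ic iz L by (simp add: F.m_assoc)
    ultimately show ?thesis using Im iz unfolding P_def by blast
  qed
  have Pp: "P s (z \<otimes>\<^bsub>?F\<^esub> gen_F2 s [^]\<^bsub>?F\<^esub> (m::int))" if iz: "P s z" "zero \<longrightarrow> m = 0" for s z m
  proof -
    obtain j n where j: "j \<in> I" "z = j \<otimes>\<^bsub>?F\<^esub> gen_F2 s [^]\<^bsub>?F\<^esub> (n::int)" "zero \<longrightarrow> n = 0"
      using iz by (auto simp: P_def)
    then have "z \<otimes>\<^bsub>?F\<^esub> gen_F2 s [^]\<^bsub>?F\<^esub> m = j \<otimes>\<^bsub>?F\<^esub> gen_F2 s [^]\<^bsub>?F\<^esub> (n + m)"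
      using Ic L by (simp add: F.m_assoc F.int_pow_mult)
    moreover have "zero \<longrightarrow> n + m = 0" using j iz(2) by simp
    ultimately show ?thesis using j(1) unfolding P_def by blast
  qed
  have PI: "P s i" if "i \<in> I" for s i
    unfolding P_def using that Ic by (intro bexI[of _ i] exI[of _ 0]) auto
  have PII: "z \<in> I" if "P s z" "gen_F2 s \<in> I \<or> zero" for s z
    using that Ip[of "gen_F2 s"] Im Ic unfolding P_def by auto
  define Q where "Q v \<longleftrightarrow> P (col v) (H v)" for v
  have x0: "zero \<longrightarrow> \<chi> v x = 0" if "v \<in> V" "x \<in> stV v" for v x using that by (auto simp: zero_def)
  have inv_pow: "gen_F2 s [^]\<^bsub>?F\<^esub> (- m) = inv\<^bsub>?F\<^esub> (gen_F2 s [^]\<^bsub>?F\<^esub> m)" for s and m :: int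
    using F.int_pow_neg L by blast
  have gQ: "Q (g \<cdot> v)" if gv: "g \<in> carrier G" "v \<in> V" "Q v" for g v
  proof -
    obtain x where x: "x \<in> stV v" "h g \<otimes>\<^bsub>?F\<^esub> H v = H (g \<cdot> v) \<otimes>\<^bsub>?F\<^esub> gen_F2 (col v) [^]\<^bsub>?F\<^esub> \<chi> v x"
      using H2[OF gv(2,1)] by blast
    then have "H (g \<cdot> v) = h g \<otimes>\<^bsub>?F\<^esub> H v \<otimes>\<^bsub>?F\<^esub> gen_F2 (col v) [^]\<^bsub>?F\<^esub> (- \<chi> v x)"
      unfolding x(2) inv_pow using Hc gv L by (simp add: F.m_assoc)
    then show ?thesis
      using Pp[OF Pm[OF hI[OF gv(1)]], of "col v" "H v" "- \<chi> v x"] x0[OF gv(2) x(1)] gv col by (simp add: Q_def)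
  qed
  have invert: "H (ter f) = H (ini f) \<otimes>\<^bsub>?F\<^esub> gen_F2 (col (ini f)) [^]\<^bsub>?F\<^esub> (- n) \<otimes>\<^bsub>?F\<^esub> inv\<^bsub>?F\<^esub> \<tau> f
      \<otimes>\<^bsub>?F\<^esub> gen_F2 (col (ter f)) [^]\<^bsub>?F\<^esub> (- m)"
    if "f \<in> E" "H (ini f) = H (ter f) \<otimes>\<^bsub>?F\<^esub> gen_F2 (col (ter f)) [^]\<^bsub>?F\<^esub> m \<otimes>\<^bsub>?F\<^esub> \<tau> f
         \<otimes>\<^bsub>?F\<^esub> gen_F2 (col (ini f)) [^]\<^bsub>?F\<^esub> n" for f and m n :: int
    unfolding that(2) inv_pow using Hc L \<tau>c that(1) by (simp add: F.m_assoc)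
  have flatQ: "Q (ini f) \<longleftrightarrow> Q (ter f)" if f: "f \<in> E - R" for f
  proof -
    obtain x y where x: "x \<in> stV (ter f)" "y \<in> stV (ini f)" and
      e: "H (ini f) = H (ter f) \<otimes>\<^bsub>?F\<^esub> gen_F2 (col (ter f)) [^]\<^bsub>?F\<^esub> \<chi> (ter f) x \<otimes>\<^bsub>?F\<^esub> \<tau> f
         \<otimes>\<^bsub>?F\<^esub> gen_F2 (col (ini f)) [^]\<^bsub>?F\<^esub> \<chi> (ini f) y" using H3[of f] f by auto
    have fE: "f \<in> E" using f by simp
    note e' = invert[OF fE e]
    have c: "col (ini f) = col (ter f)" "\<tau> f = \<one>\<^bsub>?F\<^esub>" using flat[OF f] by auto
    have z: "zero \<longrightarrow> \<chi> (ter f) x = 0" "zero \<longrightarrow> \<chi> (ini f) y = 0"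
      "zero \<longrightarrow> - \<chi> (ter f) x = 0" "zero \<longrightarrow> - \<chi> (ini f) y = 0"
      using x0 x fE by auto
    show ?thesis
    proof
      assume "Q (ini f)"
      then show "Q (ter f)" using Pp[OF Pp[OF _ z(4)] z(3), of "col (ter f)" "H (ini f)"] e' c Hc fE L
        by (simp add: Q_def)
    next
      assume "Q (ter f)"
      then show "Q (ini f)" using Pp[OF Pp[OF _ z(1)] z(2), of "col (ter f)" "H (ter f)"] e c Hc fE L
        by (simp add: Q_def)
    qed
  qed
  show ?thesis
  proof (rule that[OF h I_def sI, of Q])
    show "Q v0" using PI[OF I1] H0 by (simp add: Q_def)
    show "Q v \<and> col v = col u" if "conn R V u v" "u \<in> V" "Q u" for u v
      using that(1)
      by (rule conn_propagate[where P = "\<lambda>v. Q v \<and> col v = col u"])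
        (use that gQ col flatQ flat in auto)
    \<comment> \<open>The potential is \<open>i\<close> times a power of the same generator, and the
      wanted power commutes with that power. Hence it is the conjugate of \<open>h x\<close> by
      \<open>i\<close>.\<close>
    show "gen_F2 (col v) [^]\<^bsub>?F\<^esub> \<chi> v x \<in> I" if v: "v \<in> V" "Q v" "x \<in> stV v" for v x
    proof -
      obtain i n where i: "i \<in> I" "H v = i \<otimes>\<^bsub>?F\<^esub> gen_F2 (col v) [^]\<^bsub>?F\<^esub> (n::int)"
        using v by (auto simp: Q_def P_def)
      let ?p = "\<lambda>n::int. gen_F2 (col v) [^]\<^bsub>?F\<^esub> n"
      have x: "h x \<in> I" using hI v by (simp add: stV_iff)
      have "h x \<otimes>\<^bsub>?F\<^esub> i \<otimes>\<^bsub>?F\<^esub> ?p n = i \<otimes>\<^bsub>?F\<^esub> (?p n \<otimes>\<^bsub>?F\<^esub> ?p (\<chi> v x))"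
        using H1[OF v(1,3)] i x Ic L by (simp add: F.m_assoc)
      also have "?p n \<otimes>\<^bsub>?F\<^esub> ?p (\<chi> v x) = ?p (\<chi> v x) \<otimes>\<^bsub>?F\<^esub> ?p n"
        using L by (simp flip: F.int_pow_mult add: add.commute)
      also have "i \<otimes>\<^bsub>?F\<^esub> (?p (\<chi> v x) \<otimes>\<^bsub>?F\<^esub> ?p n) = i \<otimes>\<^bsub>?F\<^esub> ?p (\<chi> v x) \<otimes>\<^bsub>?F\<^esub> ?p n"
        using Ic i L by (simp add: F.m_assoc)
      finally have "h x \<otimes>\<^bsub>?F\<^esub> i = i \<otimes>\<^bsub>?F\<^esub> ?p (\<chi> v x)"
        using Ic i x L by simp
      then have "?p (\<chi> v x) = inv\<^bsub>?F\<^esub> i \<otimes>\<^bsub>?F\<^esub> (h x \<otimes>\<^bsub>?F\<^esub> i)"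
        using Ic i x L by (simp add: F.m_assoc[symmetric])
      then show ?thesis using Im Ii i x by simp
    qed
    \<comment> \<open>Once the generator at \<open>ini f\<close> lies in \<open>I\<close>, so does
      the potential there. Crossing \<open>f\<close> then leaves an element of \<open>I\<close>
      times a power of the generator at \<open>ter f\<close>.\<close>
    show "Q (ter f)" if f: "f \<in> E" "Q (ini f)" "gen_F2 (col (ini f)) \<in> I" "\<tau> f = \<one>\<^bsub>?F\<^esub>" for f
    proof -
      obtain x y where x: "x \<in> stV (ter f)" "y \<in> stV (ini f)" and
        e: "H (ini f) = H (ter f) \<otimes>\<^bsub>?F\<^esub> gen_F2 (col (ter f)) [^]\<^bsub>?F\<^esub> \<chi> (ter f) x \<otimes>\<^bsub>?F\<^esub> \<tau> f
           \<otimes>\<^bsub>?F\<^esub> gen_F2 (col (ini f)) [^]\<^bsub>?F\<^esub> \<chi> (ini f) y" using H3[of f] f by auto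
      have "H (ini f) \<in> I" using PII f by (auto simp: Q_def)
      then have "H (ini f) \<otimes>\<^bsub>?F\<^esub> gen_F2 (col (ini f)) [^]\<^bsub>?F\<^esub> (- \<chi> (ini f) y) \<in> I"
        using Im Ip f by blast
      from Pp[OF PI[OF this], of "- \<chi> (ter f) x" "col (ter f)"]
      show ?thesis using invert[OF f(1) e] f x0[OF _ x(1)] Hc L by (simp add: Q_def)
    qed
    show "\<tau> f \<in> I" if f: "f \<in> E" "Q (ini f)" "Q (ter f)"
      "gen_F2 (col (ini f)) \<in> I \<and> gen_F2 (col (ter f)) \<in> I \<or> (\<forall>v\<in>V. \<forall>x\<in>stV v. \<chi> v x = 0)" for f
    proof -
      obtain x y where x: "x \<in> stV (ter f)" "y \<in> stV (ini f)" and
        e: "H (ini f) = H (ter f) \<otimes>\<^bsub>?F\<^esub> gen_F2 (col (ter f)) [^]\<^bsub>?F\<^esub> \<chi> (ter f) x \<otimes>\<^bsub>?F\<^esub> \<tau> f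
           \<otimes>\<^bsub>?F\<^esub> gen_F2 (col (ini f)) [^]\<^bsub>?F\<^esub> \<chi> (ini f) y" using H3[of f] f by auto
      let ?m = "gen_F2 (col (ter f)) [^]\<^bsub>?F\<^esub> \<chi> (ter f) x"
      let ?n = "gen_F2 (col (ini f)) [^]\<^bsub>?F\<^esub> \<chi> (ini f) y"
      have c: "gen_F2 (col (ini f)) \<in> I \<and> gen_F2 (col (ter f)) \<in> I \<or> zero" using f(4) by (simp add: zero_def)
      have HI: "H (ini f) \<in> I" "H (ter f) \<in> I" using PII f c by (auto simp: Q_def)
      have mn: "?m \<in> I" "?n \<in> I"
        using c Ip x0[OF ter_closed[OF f(1)] x(1)] x0[OF ini_closed[OF f(1)] x(2)] I1 by auto
      have "\<tau> f = inv\<^bsub>?F\<^esub> ?m \<otimes>\<^bsub>?F\<^esub> inv\<^bsub>?F\<^esub> (H (ter f)) \<otimes>\<^bsub>?F\<^esub> H (ini f) \<otimes>\<^bsub>?F\<^esub> inv\<^bsub>?F\<^esub> ?n"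
        unfolding e using Hc f(1) L \<tau>c by (simp add: F.m_assoc) (simp add: F.m_assoc[symmetric])
      then show ?thesis using Im Ii HI mn by simp
    qed
  qed
qed

subsection \<open>Criteria for a map onto the free group\<close>

lemma family_kill_orbit:
  assumes "family \<chi>" "e \<in> E" "\<forall>x\<in>stE e. \<chi> (ini e) x = 0 \<and> \<chi> (ter e) x = 0" "f \<in> orbE e"
  shows "\<forall>x\<in>stE f. \<chi> (ini f) x = 0 \<and> \<chi> (ter f) x = 0"
proof
  fix x assume x: "x \<in> stE f"
  obtain g where g: "g \<in> carrier G" "f = g \<star> e" using assms(4) by (auto simp: orbE_def)
  obtain y where y: "y \<in> stE e" "x = g \<otimes> y \<otimes> inv g" using x stE_act'[OF g(1) assms(2)] g(2) by auto
  have "y \<in> stV (ini e)" "y \<in> stV (ter e)" using y stE_subset[OF assms(2)] by auto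
  then have "\<chi> (g \<cdot> ini e) x = \<chi> (ini e) y" "\<chi> (g \<cdot> ter e) x = \<chi> (ter e) y"
    using assms(1,2) g y unfolding family_def by auto
  then show "\<chi> (ini f) x = 0 \<and> \<chi> (ter f) x = 0" using assms(2,3) g y by simp
qed

lemma family_div:
  assumes \<chi>: "family \<chi>" and d: "\<And>g v. g \<in> carrier G \<Longrightarrow> v \<in> V \<Longrightarrow> d (g \<cdot> v) = (d v :: int)"
    and dvd: "\<And>v x. v \<in> V \<Longrightarrow> x \<in> stV v \<Longrightarrow> d v dvd \<chi> v x"
  shows "family (\<lambda>v x. \<chi> v x div d v)"
  unfolding family_def
proof (intro ballI conjI)
  fix v assume v: "v \<in> V"
  show "zhom (stV v) (\<lambda>x. \<chi> v x div d v)"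
    using \<chi> v dvd unfolding family_def zhom_def by (simp add: div_add)
  fix g x assume "g \<in> carrier G" "x \<in> stV v"
  then show "\<chi> (g \<cdot> v) (g \<otimes> x \<otimes> inv g) div d (g \<cdot> v) = \<chi> v x div d v"
    using \<chi> v d unfolding family_def by simp
qed

lemma maps_onto_F2_I:
  assumes "h \<in> hom G free_group_F2" "I = h ` carrier G" "subgroup I free_group_F2"
    "gen_F2 True \<in> I" "gen_F2 False \<in> I"
  shows maps_onto_F2
proof -
  have "gen_F2 s \<in> I" for s using assms by (cases s) auto
  then have "I = carrier free_group_F2" using subgroup_F2_eq assms(3) by blast
  then show ?thesis using assms unfolding maps_onto_F2_def by blast
qed

lemma orbE_disjoint:
  assumes "e \<in> E" "f \<in> E" "f \<notin> orbE e" "x \<in> orbE e"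
  shows "x \<notin> orbE f"
proof
  assume "x \<in> orbE f"
  then obtain g h where "g \<in> carrier G" "x = g \<star> f" "h \<in> carrier G" "x = h \<star> e"
    using assms by (auto simp: orbE_def)
  then have "f = (inv g \<otimes> h) \<star> e" "inv g \<otimes> h \<in> carrier G" using assms by (auto simp: actE_mult)
  then show False using assms(3) by (auto simp: orbE_def)
qed

lemma orbE_act: "g \<in> carrier G \<Longrightarrow> f \<in> E \<Longrightarrow> e \<in> E \<Longrightarrow> g \<star> f \<in> orbE e \<longleftrightarrow> f \<in> orbE e"
  using ginvD[OF ginv_orbE] by blast

text \<open>With the zero family, the homomorphism kills all vertex stabilizers and sees only the
  quotient graph. The two edge orbits carry the two generators, and the quotient stays connected
  without them, so both labels lie in the image.\<close>

lemma maps_onto_F2_two_cycles: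
  assumes e: "e \<in> E" and f: "f \<in> E" "f \<notin> orbE e"
    and ce: "conn (orbE e) V (ini e) (ter e)" and cf: "conn (orbE e \<union> orbE f) V (ini f) (ter f)"
  shows maps_onto_F2
proof -
  let ?R = "orbE e \<union> orbE f"
  define \<tau> where "\<tau> x = (if x \<in> orbE e then gen_F2 True else if x \<in> orbE f then gen_F2 False
    else \<one>\<^bsub>free_group_F2\<^esub>)" for x
  have all: "conn ?R V (ini e) v" if v: "v \<in> V" for v
  proof (rule conn_propagate[OF conn_all[OF e ce v]])
    show "conn ?R V (ini e) (g \<cdot> w)" if "g \<in> carrier G" "w \<in> V" "conn ?R V (ini e) w" for g w
      using that conn_act[of w V g ?R] conn_trans by (metis actV_closed)
    \<comment> \<open>A translate of \<open>f\<close> is bypassed by the path between the ends of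
      \<open>f\<close> that avoids both orbits.\<close>
    have *: "conn ?R V (ini x) (ter x) \<and> conn ?R V (ter x) (ini x)" if x: "x \<in> E - orbE e" for x
    proof (cases "x \<in> orbE f")
      case True
      then obtain g where g: "g \<in> carrier G" "x = g \<star> f" by (auto simp: orbE_def)
      have "conn ?R V (g \<cdot> ini f) (ini f)" using conn_sym[of V] conn_act[of "ini f" V g ?R] g f by simp
      also note cf
      also have "conn ?R V (ter f) (g \<cdot> ter f)" using conn_act[of "ter f" V g ?R] g f by simp
      finally show ?thesis using g f conn_sym[of V] by auto
    next
      case False
      then show ?thesis using x conn_edge[of x ?R V] by auto
    qed
    show "conn ?R V (ini e) (ter x)" if "x \<in> E - orbE e" "conn ?R V (ini e) (ini x)" for x
      using * that conn_trans by blast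
    show "conn ?R V (ini e) (ini x)" if "x \<in> E - orbE e" "conn ?R V (ini e) (ter x)" for x
      using * that conn_trans by blast
  qed (use e in auto)
  have fam: "family (\<lambda>_ _. 0)" by (simp add: family_def zhom_def)
  obtain h I Q where I: "h \<in> hom G free_group_F2" "I = h ` carrier G" "subgroup I free_group_F2" "Q (ini e)"
    and Q: "\<And>u v. conn ?R V u v \<Longrightarrow> u \<in> V \<Longrightarrow> Q u \<Longrightarrow> Q v \<and> True = True"
    and \<tau>I: "\<And>f. f \<in> E \<Longrightarrow> Q (ini f) \<Longrightarrow> Q (ter f) \<Longrightarrow>
       gen_F2 True \<in> I \<and> gen_F2 True \<in> I \<or> (\<forall>v\<in>V. \<forall>x\<in>stV v. (0::int) = 0) \<Longrightarrow> \<tau> f \<in> I"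
    by (rule F2_hom[where \<chi> = "\<lambda>_ _. 0" and col = "\<lambda>_. True" and \<tau> = \<tau> and R = ?R and ?v0.0 = "ini e"])
      (use fam gen_F2_closed one_F2_closed orbE_act e f in \<open>auto simp: \<tau>_def\<close>)
  have Qv: "Q v" if "v \<in> V" for v using Q[OF all[OF that] _ I(4)] e by auto
  have "\<tau> e \<in> I" "\<tau> f \<in> I" using \<tau>I Qv e f by auto
  then have "gen_F2 True \<in> I" "gen_F2 False \<in> I" using e f by (auto simp: \<tau>_def)
  then show ?thesis using maps_onto_F2_I I by blast
qed

lemma gen_exponents_diff:
  assumes "subgroup I free_group_F2"
    "gen_F2 s [^]\<^bsub>free_group_F2\<^esub> (a::int) \<in> I" "gen_F2 s [^]\<^bsub>free_group_F2\<^esub> (b::int) \<in> I"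
  shows "gen_F2 s [^]\<^bsub>free_group_F2\<^esub> (a - b) \<in> I"
proof -
  interpret F: group free_group_F2 by (rule group_free_group_F2)
  show ?thesis
    using subgroup.m_closed[OF assms(1,2) subgroup.m_inv_closed[OF assms(1,3)]]
    by (simp add: F.int_pow_diff gen_F2_closed)
qed

text \<open>An HNN extension: the stable letter goes to one generator, the base group to powers of the other.\<close>

lemma maps_onto_F2_HNN:
  assumes e: "e \<in> E" and ce: "conn (orbE e) V (ini e) (ter e)" and \<chi>: "family \<chi>"
    and agree: "\<And>f x. f \<in> E - orbE e \<Longrightarrow> x \<in> stE f \<Longrightarrow> \<chi> (ini f) x = \<chi> (ter f) x"
    and kill: "\<forall>x\<in>stE e. \<chi> (ini e) x = 0 \<and> \<chi> (ter e) x = 0"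
    and v: "v \<in> V" "x \<in> stV v" "\<chi> v x \<noteq> 0"
  shows maps_onto_F2
proof -
  \<comment> \<open>The gcd of all values has to be divided out; otherwise only a proper power of
    the first generator might be reached.\<close>
  define S where "S = {\<chi> w y | w y. w \<in> V \<and> y \<in> stV w}"
  obtain d where d: "d \<noteq> 0" "\<And>s. s \<in> S \<Longrightarrow> d dvd s"
    "\<And>J. (\<And>a b. a \<in> J \<Longrightarrow> b \<in> J \<Longrightarrow> a - b \<in> J) \<Longrightarrow> (\<And>s. s \<in> S \<Longrightarrow> s div d \<in> J) \<Longrightarrow> (1::int) \<in> J"
    by (rule normalize_int_set[of "\<chi> v x" S]) (use v in \<open>auto simp: S_def\<close>)
  define \<chi>' where "\<chi>' w y = \<chi> w y div d" for w y
  have fam: "family \<chi>'"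
    unfolding \<chi>'_def by (rule family_div[OF \<chi>]) (use d(2) in \<open>auto simp: S_def\<close>)
  have k: "\<forall>x\<in>stE f. \<chi>' (ini f) x = 0 \<and> \<chi>' (ter f) x = 0" if "f \<in> orbE e" for f
    using family_kill_orbit[OF \<chi> e kill that] by (simp add: \<chi>'_def)
  define \<tau> where "\<tau> x = (if x \<in> orbE e then gen_F2 False else \<one>\<^bsub>free_group_F2\<^esub>)" for x
  obtain h I Q where I: "h \<in> hom G free_group_F2" "I = h ` carrier G" "subgroup I free_group_F2" "Q (ini e)"
    and Q: "\<And>u v. conn (orbE e) V u v \<Longrightarrow> u \<in> V \<Longrightarrow> Q u \<Longrightarrow> Q v \<and> True = True"
    and powI: "\<And>v x. v \<in> V \<Longrightarrow> Q v \<Longrightarrow> x \<in> stV v \<Longrightarrow> gen_F2 True [^]\<^bsub>free_group_F2\<^esub> \<chi>' v x \<in> I"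
    and \<tau>I: "\<And>f. f \<in> E \<Longrightarrow> Q (ini f) \<Longrightarrow> Q (ter f) \<Longrightarrow>
       gen_F2 True \<in> I \<and> gen_F2 True \<in> I \<or> (\<forall>v\<in>V. \<forall>x\<in>stV v. \<chi>' v x = 0) \<Longrightarrow> \<tau> f \<in> I"
  proof (rule F2_hom[where \<chi> = \<chi>' and col = "\<lambda>_. True" and \<tau> = \<tau> and R = "orbE e" and ?v0.0 = "ini e"])
    show "(True = True \<and> \<tau> f = \<one>\<^bsub>free_group_F2\<^esub> \<and> (\<forall>x\<in>stE f. \<chi>' (ini f) x = \<chi>' (ter f) x)) \<or>
      (\<forall>x\<in>stE f. \<chi>' (ini f) x = 0 \<and> \<chi>' (ter f) x = 0)" if "f \<in> E" for f
      using that k agree by (cases "f \<in> orbE e") (auto simp: \<tau>_def \<chi>'_def)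
  qed (use fam gen_F2_closed one_F2_closed orbE_act e in \<open>auto simp: \<tau>_def\<close>)
  have Qv: "Q v" if "v \<in> V" for v using Q[OF conn_all[OF e ce that] _ I(4)] e by auto
  have "1 \<in> {n::int. gen_F2 True [^]\<^bsub>free_group_F2\<^esub> n \<in> I}"
  proof (rule d(3))
    show "s div d \<in> {n::int. gen_F2 True [^]\<^bsub>free_group_F2\<^esub> n \<in> I}" if "s \<in> S" for s
      using that powI Qv by (auto simp: S_def \<chi>'_def)
  qed (use gen_exponents_diff[OF I(3)] in auto)
  then have T: "gen_F2 True \<in> I"
    using group.int_pow_1[OF group_free_group_F2 gen_F2_closed] by simp
  moreover have "\<tau> e \<in> I" using \<tau>I Qv e T by auto
  then have "gen_F2 False \<in> I" using e by (auto simp: \<tau>_def)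
  ultimately show ?thesis using maps_onto_F2_I I by blast
qed

text \<open>The colour of a vertex is the side of \<open>e\<close> on which its image lies. Each
  side goes to powers of its own generator, so the values are normalized by a separate gcd on each
  side. The generator of the side of \<open>ini e\<close> is reached first, and it allows crossing
  \<open>e\<close> to the other side.\<close>

lemma maps_onto_F2_amalgam:
  assumes e: "e \<in> E" and sep: "\<not> conn (orbE e) V (ini e) (ter e)" and \<chi>: "family \<chi>"
    and agree: "\<And>f x. f \<in> E - orbE e \<Longrightarrow> x \<in> stE f \<Longrightarrow> \<chi> (ini f) x = \<chi> (ter f) x"
    and kill: "\<forall>x\<in>stE e. \<chi> (ini e) x = 0 \<and> \<chi> (ter e) x = 0"
    and v: "conn (orbE e) V (ini e) v" "x \<in> stV v" "\<chi> v x \<noteq> 0"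
    and w: "conn (orbE e) V (ter e) w" "y \<in> stV w" "\<chi> w y \<noteq> 0"
  shows maps_onto_F2
proof -
  let ?R = "orbE e"
  define col where "col u \<longleftrightarrow> conn ?R V (ini e) u" for u
  have colg: "col (g \<cdot> u) = col u" if "g \<in> carrier G" "u \<in> V" for g u
    using that conn_act[of u V g ?R] conn_trans conn_sym[of V] unfolding col_def
    by (metis actV_closed subset_refl)
  have cole: "col (ini f) = col (ter f)" if "f \<in> E - ?R" for f
    using that conn_edge[of f ?R V] conn_trans unfolding col_def by (metis DiffD1 ini_closed ter_closed)
  have colT: "col u" if "conn ?R V (ini e) u" for u using that by (simp add: col_def)
  have colF: "\<not> col u" if "conn ?R V (ter e) u" for u
    using that sep conn_sym[of V] conn_trans unfolding col_def by blast
  have vw: "v \<in> V" "w \<in> V" using v w conn_closed e by auto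
  define S where "S s = {\<chi> w y | w y. w \<in> V \<and> y \<in> stV w \<and> col w = s}" for s
  have "\<exists>z\<in>S s. z \<noteq> 0" for s
  proof (cases s)
    case True then show ?thesis using v vw colT unfolding S_def by blast
  next
    case False then show ?thesis using w vw colF unfolding S_def by blast
  qed
  then have "\<exists>d. d \<noteq> 0 \<and> (\<forall>z\<in>S s. d dvd z) \<and>
    (\<forall>J. (\<forall>a b. a \<in> J \<longrightarrow> b \<in> J \<longrightarrow> a - b \<in> J) \<longrightarrow> (\<forall>z\<in>S s. z div d \<in> J) \<longrightarrow> (1::int) \<in> J)" for s
    using normalize_int_set[of _ "S s"] by metis
  then obtain d where d: "\<And>s z. z \<in> S s \<Longrightarrow> d s dvd z"
    "\<And>s J. (\<And>a b. a \<in> J \<Longrightarrow> b \<in> J \<Longrightarrow> a - b \<in> J) \<Longrightarrow> (\<And>z. z \<in> S s \<Longrightarrow> z div d s \<in> J) \<Longrightarrow> (1::int) \<in> J"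
    by metis
  define \<chi>' where "\<chi>' w y = \<chi> w y div d (col w)" for w y
  have fam: "family \<chi>'"
    unfolding \<chi>'_def by (rule family_div[OF \<chi>]) (use d(1) colg in \<open>auto simp: S_def\<close>)
  have k: "\<forall>x\<in>stE f. \<chi>' (ini f) x = 0 \<and> \<chi>' (ter f) x = 0" if "f \<in> ?R" for f
    using family_kill_orbit[OF \<chi> e kill that] by (simp add: \<chi>'_def)
  define \<tau> :: "'e \<Rightarrow> (bool \<times> bool) list" where "\<tau> x = \<one>\<^bsub>free_group_F2\<^esub>" for x
  obtain h I Q where I: "h \<in> hom G free_group_F2" "I = h ` carrier G" "subgroup I free_group_F2" "Q (ini e)"
    and Q: "\<And>u v. conn ?R V u v \<Longrightarrow> u \<in> V \<Longrightarrow> Q u \<Longrightarrow> Q v \<and> col v = col u"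
    and powI: "\<And>v x. v \<in> V \<Longrightarrow> Q v \<Longrightarrow> x \<in> stV v \<Longrightarrow> gen_F2 (col v) [^]\<^bsub>free_group_F2\<^esub> \<chi>' v x \<in> I"
    and cross: "\<And>f. f \<in> E \<Longrightarrow> Q (ini f) \<Longrightarrow> gen_F2 (col (ini f)) \<in> I \<Longrightarrow> \<tau> f = \<one>\<^bsub>free_group_F2\<^esub> \<Longrightarrow> Q (ter f)"
  proof (rule F2_hom[where \<chi> = \<chi>' and col = col and \<tau> = \<tau> and R = ?R and ?v0.0 = "ini e"])
    show "(col (ini f) = col (ter f) \<and> \<tau> f = \<one>\<^bsub>free_group_F2\<^esub> \<and> (\<forall>x\<in>stE f. \<chi>' (ini f) x = \<chi>' (ter f) x)) \<or>
      (\<forall>x\<in>stE f. \<chi>' (ini f) x = 0 \<and> \<chi>' (ter f) x = 0)" if "f \<in> E" for f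
      using that k agree cole by (cases "f \<in> ?R") (auto simp: \<tau>_def \<chi>'_def)
  qed (use fam one_F2_closed colg cole e in \<open>auto simp: \<tau>_def\<close>)
  have gen: "gen_F2 s \<in> I" if "\<And>u. u \<in> V \<Longrightarrow> col u = s \<Longrightarrow> Q u" for s
  proof -
    have "1 \<in> {n::int. gen_F2 s [^]\<^bsub>free_group_F2\<^esub> n \<in> I}"
    proof (rule d(2))
      show "z div d s \<in> {n::int. gen_F2 s [^]\<^bsub>free_group_F2\<^esub> n \<in> I}" if z: "z \<in> S s" for z
      proof -
        obtain w y where "w \<in> V" "y \<in> stV w" "col w = s" "z = \<chi> w y" using z by (auto simp: S_def)
        then show ?thesis using powI[of w y] \<open>\<And>u. u \<in> V \<Longrightarrow> col u = s \<Longrightarrow> Q u\<close> by (simp add: \<chi>'_def)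
      qed
    qed (use gen_exponents_diff[OF I(3)] in auto)
    then show ?thesis using group.int_pow_1[OF group_free_group_F2 gen_F2_closed] by simp
  qed
  have T: "gen_F2 True \<in> I" using Q[OF _ _ I(4)] e by (intro gen) (auto simp: col_def)
  \<comment> \<open>The label of \<open>e\<close> is trivial, so crossing it involves only powers of
    the two generators, and the first one is already in the image.\<close>
  have "Q (ter e)" using cross[OF e I(4)] T colT[of "ini e"] by (simp add: \<tau>_def)
  then have "gen_F2 False \<in> I" using Q[of "ter e"] conn_or[OF e] e by (intro gen) (auto simp: col_def)
  then show ?thesis using maps_onto_F2_I I T by blast
qed

end

subsection \<open>Partial families\<close>

locale abelian_tree_action = tree_action G V E ini ter actV actE
  for G :: "('a, 'b) monoid_scheme" (structure) and V :: "'v set" and E :: "'e set"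
    and ini ter :: "'e \<Rightarrow> 'v"
    and actV :: "'a \<Rightarrow> 'v \<Rightarrow> 'v" (infixr "\<cdot>" 75) and actE :: "'a \<Rightarrow> 'e \<Rightarrow> 'e" (infixr "\<star>" 75) +
  fixes M :: nat
  assumes fab_stV: "v \<in> V \<Longrightarrow> fab M (stV v)"
    and retraction_ini: "e \<in> E \<Longrightarrow> \<exists>\<rho>. retraction (stE e) (stV (ini e)) \<rho>"
    and retraction_ter: "e \<in> E \<Longrightarrow> \<exists>\<rho>. retraction (stE e) (stV (ter e)) \<rho>"
    and commuting_conjugates: "x \<in> carrier G \<Longrightarrow> y \<in> carrier G \<Longrightarrow> z \<in> carrier G \<Longrightarrow>
      x \<otimes> y = y \<otimes> x \<Longrightarrow> z \<otimes> x \<otimes> inv z = y \<Longrightarrow> x = y"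
begin

lemma retraction_dart:
  "fst d \<in> E \<Longrightarrow> \<exists>\<rho>. retraction (stE (fst d)) (stV (src d)) \<rho>"
  "fst d \<in> E \<Longrightarrow> \<exists>\<rho>. retraction (stE (fst d)) (stV (tgt d)) \<rho>"
  using retraction_ini retraction_ter by (auto simp: src_def tgt_def)

lemma stV_comm: "v \<in> V \<Longrightarrow> x \<in> stV v \<Longrightarrow> y \<in> stV v \<Longrightarrow> x \<otimes> y = y \<otimes> x"
  using fab_comm[OF fab_stV] .

text \<open>Transport of a homomorphism by conjugation. The value 0 off the carrier, together with
  the value 0 off the stabilizer in \<open>adm\<close>, makes agreement of homomorphisms an equality
  of functions.\<close>

definition cj :: "'a \<Rightarrow> ('a \<Rightarrow> int) \<Rightarrow> 'a \<Rightarrow> int" where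
  "cj g \<alpha> x = (if x \<in> carrier G then \<alpha> (inv g \<otimes> x \<otimes> g) else 0)"

definition adm :: "'v \<Rightarrow> ('a \<Rightarrow> int) \<Rightarrow> bool" where
  "adm v \<alpha> \<longleftrightarrow> zhom (stV v) \<alpha> \<and> (\<forall>x. x \<notin> stV v \<longrightarrow> \<alpha> x = 0)"

lemma cj_cj: "g \<in> carrier G \<Longrightarrow> h \<in> carrier G \<Longrightarrow> cj g (cj h \<alpha>) = cj (g \<otimes> h) \<alpha>"
  by (rule ext) (simp add: cj_def inv_mult_group m_assoc)

lemma cj_one: "adm v \<alpha> \<Longrightarrow> cj \<one> \<alpha> = \<alpha>"
  by (rule ext) (auto simp: cj_def adm_def stV_iff)

lemma adm_cj:
  assumes "v \<in> V" "adm v \<alpha>" "g \<in> carrier G"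
  shows "adm (g \<cdot> v) (cj g \<alpha>)"
  unfolding adm_def
proof (intro conjI allI impI)
  have c: "x \<in> carrier G" if "x \<in> stV w" for x w using that by (simp add: stV_iff)
  show "zhom (stV (g \<cdot> v)) (cj g \<alpha>)"
    unfolding zhom_def
  proof (intro ballI)
    fix x y assume x: "x \<in> stV (g \<cdot> v)" and y: "y \<in> stV (g \<cdot> v)"
    have "inv g \<otimes> (x \<otimes> y) \<otimes> g = (inv g \<otimes> x \<otimes> g) \<otimes> (inv g \<otimes> y \<otimes> g)"
      using c[OF x] c[OF y] assms(3) by (simp add: m_assoc m_inv_cancel)
    moreover have "inv g \<otimes> x \<otimes> g \<in> stV v" "inv g \<otimes> y \<otimes> g \<in> stV v"
      using x y stV_act[OF assms(3,1)] c by auto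
    ultimately show "cj g \<alpha> (x \<otimes> y) = cj g \<alpha> x + cj g \<alpha> y"
      using assms(2) c[OF x] c[OF y] by (simp add: cj_def adm_def zhom_def)
  qed
  show "cj g \<alpha> x = 0" if "x \<notin> stV (g \<cdot> v)" for x
    using that stV_act[OF assms(3,1)] assms(2) by (auto simp: cj_def adm_def)
qed

text \<open>Vertex stabilizers are abelian, so conjugation inside one of them changes
  nothing.\<close>

lemma cj_stabilizer:
  assumes "v \<in> V" "adm v \<alpha>" "k \<in> stV v"
  shows "cj k \<alpha> = \<alpha>"
proof
  fix x
  have k: "k \<in> carrier G" "k \<cdot> v = v" using assms by (auto simp: stV_iff)
  show "cj k \<alpha> x = \<alpha> x"
  proof (cases "x \<in> stV v")
    case True
    then have x: "x \<in> carrier G" by (simp add: stV_iff)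
    have "inv k \<otimes> x \<otimes> k = inv k \<otimes> (k \<otimes> x)" using stV_comm[OF assms(1) True assms(3)] x k by (simp add: m_assoc)
    also have "\<dots> = x" using x k by (simp flip: m_assoc)
    finally show ?thesis using x by (simp add: cj_def)
  next
    case False
    then have "\<alpha> x = 0" using assms(2) by (simp add: adm_def)
    moreover have "cj k \<alpha> x = 0" using adm_cj[OF assms(1,2) k(1)] k False by (simp add: adm_def)
    ultimately show ?thesis by simp
  qed
qed

text \<open>Consequently a homomorphism at one vertex has a single equivariant continuation to its
  orbit, which makes \<open>orbP\<close> below single-valued.\<close>

lemma cj_well_defined:
  assumes "v \<in> V" "adm v \<alpha>" "g \<in> carrier G" "h \<in> carrier G" "g \<cdot> v = h \<cdot> v"
  shows "cj g \<alpha> = cj h \<alpha>"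
proof -
  have "(inv h \<otimes> g) \<in> stV v" using assms by (simp add: stV_iff actV_mult)
  then have "cj h (cj (inv h \<otimes> g) \<alpha>) = cj h \<alpha>" using cj_stabilizer assms by simp
  then show ?thesis using assms by (simp add: cj_cj m_inv_cancel)
qed

text \<open>A partial family is encoded as a set of pairs \<open>(v, \<alpha>)\<close>. It is defined on an invariant set of
vertices which is convex modulo the edges in \<open>R\<close>, and compatible with the edges outside \<open>R\<close>.\<close>

definition good :: "'e set \<Rightarrow> ('v \<times> ('a \<Rightarrow> int)) set \<Rightarrow> bool" where
  "good R P \<longleftrightarrow>
     (\<forall>v \<alpha>. (v, \<alpha>) \<in> P \<longrightarrow> v \<in> V \<and> adm v \<alpha>) \<and>
     (\<forall>v \<alpha> \<beta>. (v, \<alpha>) \<in> P \<longrightarrow> (v, \<beta>) \<in> P \<longrightarrow> \<alpha> = \<beta>) \<and>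
     (\<forall>v \<alpha> g. (v, \<alpha>) \<in> P \<longrightarrow> g \<in> carrier G \<longrightarrow> (g \<cdot> v, cj g \<alpha>) \<in> P) \<and>
     (\<forall>f \<alpha> \<beta>. f \<in> E - R \<longrightarrow> (ini f, \<alpha>) \<in> P \<longrightarrow> (ter f, \<beta>) \<in> P \<longrightarrow> (\<forall>x\<in>stE f. \<alpha> x = \<beta> x)) \<and>
     (\<forall>u\<in>fst ` P. \<forall>v\<in>fst ` P. conn R V u v \<longrightarrow> conn R (fst ` P) u v)"

lemma goodD:
  assumes "good R P"
  shows "(v, \<alpha>) \<in> P \<Longrightarrow> v \<in> V" "(v, \<alpha>) \<in> P \<Longrightarrow> adm v \<alpha>"
    "(v, \<alpha>) \<in> P \<Longrightarrow> (v, \<beta>) \<in> P \<Longrightarrow> \<alpha> = \<beta>"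
    "(v, \<alpha>) \<in> P \<Longrightarrow> g \<in> carrier G \<Longrightarrow> (g \<cdot> v, cj g \<alpha>) \<in> P"
    "f \<in> E - R \<Longrightarrow> (ini f, \<alpha>) \<in> P \<Longrightarrow> (ter f, \<beta>) \<in> P \<Longrightarrow> x \<in> stE f \<Longrightarrow> \<alpha> x = \<beta> x"
    "u \<in> fst ` P \<Longrightarrow> v \<in> fst ` P \<Longrightarrow> conn R V u v \<Longrightarrow> conn R (fst ` P) u v"
  using assms unfolding good_def by blast+

lemma good_subset: "good R P \<Longrightarrow> fst ` P \<subseteq> V"
  using goodD(1) by fastforce

lemma good_act: "good R P \<Longrightarrow> g \<in> carrier G \<Longrightarrow> v \<in> V \<Longrightarrow> g \<cdot> v \<in> fst ` P \<longleftrightarrow> v \<in> fst ` P"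
proof
  assume a: "good R P" "g \<in> carrier G" "v \<in> V"
  show "g \<cdot> v \<in> fst ` P" if "v \<in> fst ` P" using goodD(4)[OF a(1) _ a(2)] that by force
  assume "g \<cdot> v \<in> fst ` P"
  then have "inv g \<cdot> g \<cdot> v \<in> fst ` P" using goodD(4)[OF a(1), of _ _ "inv g"] a(2) by force
  then show "v \<in> fst ` P" using a by simp
qed

lemma good_empty: "good R {}"
  by (simp add: good_def)

definition orbP :: "'v \<Rightarrow> ('a \<Rightarrow> int) \<Rightarrow> ('v \<times> ('a \<Rightarrow> int)) set" where
  "orbP w \<psi> = (\<lambda>g. (g \<cdot> w, cj g \<psi>)) ` carrier G"

lemma orbP_self: "w \<in> V \<Longrightarrow> adm w \<psi> \<Longrightarrow> (w, \<psi>) \<in> orbP w \<psi>"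
  unfolding orbP_def by (rule image_eqI[of _ _ \<one>]) (auto simp: cj_one)

lemma conn_restrict:
  assumes "conn R U u v" "\<And>f. f \<in> E - R \<Longrightarrow> ini f \<in> U \<Longrightarrow> ter f \<in> U \<Longrightarrow> f \<notin> R'"
  shows "conn (R \<union> R') U u v"
proof -
  have "arcs R U \<subseteq> arcs (R \<union> R') U"
  proof
    fix p assume "p \<in> arcs R U"
    then obtain a b where p: "p = (a, b)" "a \<in> U" "b \<in> U"
      "(\<exists>g\<in>carrier G. b = g \<cdot> a) \<or> (\<exists>f\<in>E - R. {a, b} = {ini f, ter f})" by (auto simp: arcs_def)
    have "f \<in> E - (R \<union> R')" if "f \<in> E - R" "{a, b} = {ini f, ter f}" for f
    proof -
      have "ini f \<in> U" "ter f \<in> U" using that p by (auto simp: doubleton_eq_iff)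
      then show ?thesis using that assms(2) by auto
    qed
    then show "p \<in> arcs (R \<union> R') U" using p unfolding arcs_def by blast
  qed
  then show ?thesis using assms(1) rtrancl_mono unfolding conn_def by blast
qed

lemma conn_dart_sym: "fst d \<in> E - R \<Longrightarrow> src d \<in> U \<Longrightarrow> tgt d \<in> U \<Longrightarrow> conn R U (tgt d) (src d)"
  using conn_dart[of "flip d" R U] by simp

text \<open>A new orbit is attached either along one edge over which the homomorphisms agree, or in
  a component that the domain does not meet. In the first case compatibility has to hold over all
  edges between the domain and the new orbit; these turn out to be translates of the given one,
  because the quotient without \<open>R\<close> is a forest and the domain is convex.\<close>

lemma good_step:
  assumes R: "forest R" and P: "good R P" and w: "w \<in> V" "w \<notin> fst ` P" and \<psi>: "adm w \<psi>"
    and alt: "(\<exists>d \<alpha>. fst d \<in> E - R \<and> (src d, \<alpha>) \<in> P \<and> tgt d = w \<and> (\<forall>x\<in>stE (fst d). \<alpha> x = \<psi> x)) \<or>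
      (\<forall>u\<in>fst ` P. \<not> conn R V u w)"
  shows "good R (P \<union> orbP w \<psi>)"
proof -
  let ?U = "fst ` P"
  let ?W = "(\<lambda>g. g \<cdot> w) ` carrier G"
  have fst': "fst ` (P \<union> orbP w \<psi>) = ?U \<union> ?W" unfolding orbP_def image_Un image_image by simp
  have UV: "?U \<subseteq> V" using good_subset[OF P] .
  have WV: "?W \<subseteq> V" using w by auto
  have UW: "u \<notin> ?W" if "u \<in> ?U" for u using that good_act[OF P _ w(1)] w(2) by blast
  have Wconn: "conn R' U u v" if uv: "u \<in> ?W" "v \<in> ?W" "?W \<subseteq> U" for u v R' U
  proof -
    obtain g h where g: "g \<in> carrier G" "u = g \<cdot> w" "h \<in> carrier G" "v = h \<cdot> w" using uv by auto
    then have "v = (h \<otimes> inv g) \<cdot> u" using w by (simp add: actV_mult)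
    then show ?thesis using conn_act[of u U "h \<otimes> inv g" R'] g uv by auto
  qed
  have wW: "w \<in> ?W" using w by (intro image_eqI[of _ _ \<one>]) auto
  have inW: "\<exists>g\<in>carrier G. v = g \<cdot> w \<and> \<beta> = cj g \<psi>" if "(v, \<beta>) \<in> P \<union> orbP w \<psi>" "v \<in> ?W" for v \<beta>
    using that UW by (force simp: orbP_def)
  have inU: "(v, \<beta>) \<in> P" if "(v, \<beta>) \<in> P \<union> orbP w \<psi>" "v \<in> ?U" for v \<beta>
    using that UW by (auto simp: orbP_def)
  have joined: "\<exists>d0 \<alpha>0. fst d0 \<in> E - R \<and> (src d0, \<alpha>0) \<in> P \<and> tgt d0 = w \<and> (\<forall>x\<in>stE (fst d0). \<alpha>0 x = \<psi> x)"
    if "u \<in> ?U" "v \<in> ?W" "conn R V u v" for u v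
    using alt that Wconn[OF that(2) wW WV, of R] conn_trans by blast
  have cross: "\<alpha> x = \<beta> x"
    if d: "fst d \<in> E - R" "(src d, \<alpha>) \<in> P" "tgt d \<in> ?W" "(tgt d, \<beta>) \<in> P \<union> orbP w \<psi>" "x \<in> stE (fst d)"
    for d \<alpha> \<beta> x
  proof -
    have sU: "src d \<in> ?U" using d(2) by force
    have dE: "fst d \<in> E" "fst d \<notin> R" using d(1) by auto
    obtain d0 \<alpha>0 where d0: "fst d0 \<in> E - R" "(src d0, \<alpha>0) \<in> P" "tgt d0 = w" "\<forall>x\<in>stE (fst d0). \<alpha>0 x = \<psi> x"
      using joined[OF sU d(3) conn_dart[OF d(1)]] dE by auto
    have s0U: "src d0 \<in> ?U" using d0(2) by force
    \<comment> \<open>Otherwise there is a cycle: by convexity \<open>src d\<close> and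
      \<open>src d0\<close> are joined inside the domain, hence off the orbit of
      \<open>fst d\<close>, all of whose edges have an end in the new orbit; returning through
      \<open>d0\<close> bypasses \<open>d\<close>.\<close>
    have "fst d \<in> orbE (fst d0)"
    proof (rule ccontr)
      assume n: "fst d \<notin> orbE (fst d0)"
      let ?Q = "R \<union> orbE (fst d)"
      have n0: "fst d0 \<notin> orbE (fst d)" using orbE_disjoint[of "fst d0" "fst d"] n dE d0 by auto
      have "conn R V (src d) (tgt d)" using conn_dart[OF d(1)] dE by simp
      also have "conn R V (tgt d) w" using Wconn[OF d(3) wW WV] .
      also have "conn R V w (src d0)" using conn_dart_sym[OF d0(1), of V] d0 w by simp
      finally have "conn R ?U (src d) (src d0)" using goodD(6)[OF P sU s0U] by simp
      then have "conn ?Q ?U (src d) (src d0)"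
      proof (rule conn_restrict)
        fix f assume f: "f \<in> E - R" "ini f \<in> ?U" "ter f \<in> ?U"
        show "f \<notin> orbE (fst d)"
        proof
          assume "f \<in> orbE (fst d)"
          then obtain g where g: "g \<in> carrier G" "f = g \<star> fst d" by (auto simp: orbE_def)
          obtain h where h: "h \<in> carrier G" "tgt d = h \<cdot> w" using d(3) by auto
          have "g \<cdot> tgt d = (g \<otimes> h) \<cdot> w" using g h w by (simp add: actV_mult)
          then have "g \<cdot> tgt d \<in> ?W" using g h by auto
          moreover have "g \<cdot> tgt d \<in> ?U" using f g dE by (auto simp: tgt_def split: if_splits)
          ultimately show False using UW by blast
        qed
      qed
      then have "conn ?Q V (src d) (src d0)" using UV conn_mono by blast
      also have "conn ?Q V (src d0) w" using conn_dart[of d0 ?Q V] d0 n0 by auto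
      also have "conn ?Q V w (tgt d)" using Wconn[OF wW d(3) WV] .
      finally show False using forestD[OF R dE] by simp
    qed
    \<comment> \<open>Agreement over \<open>d0\<close> is carried to its translate by equivariance,
      once \<open>k\<close> is known to match the ends of the two darts in the right order.\<close>
    then obtain k where k: "k \<in> carrier G" "fst d = k \<star> fst d0" by (auto simp: orbE_def)
    have d0E: "fst d0 \<in> E" using d0 by auto
    have "{src d, tgt d} = {k \<cdot> src d0, k \<cdot> w}"
      using dart_ends[of d] dart_ends[of "actD k d0"] k d0 by auto
    moreover have "src d \<noteq> k \<cdot> w" using UW[OF sU] k by blast
    ultimately have st: "src d = k \<cdot> src d0" "tgt d = k \<cdot> w" by (auto simp: doubleton_eq_iff)
    have "\<alpha> = cj k \<alpha>0" using goodD(3)[OF P d(2)] goodD(4)[OF P d0(2) k(1)] st by simp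
    moreover obtain g where g: "g \<in> carrier G" "tgt d = g \<cdot> w" "\<beta> = cj g \<psi>" using inW[OF d(4,3)] by auto
    then have "\<beta> = cj k \<psi>" using cj_well_defined[OF w(1) \<psi> g(1) k(1)] st by simp
    moreover have "inv k \<otimes> x \<otimes> k \<in> stE (fst d0)"
      using d(5) k d0E stE_act[OF k(1) d0E, of x] by (auto simp: stE_iff)
    ultimately show ?thesis using d0(4) by (simp add: cj_def)
  qed
  show ?thesis
    unfolding good_def fst'
  proof (intro conjI allI impI ballI)
    fix v \<alpha> assume v: "(v, \<alpha>) \<in> P \<union> orbP w \<psi>"
    then show "v \<in> V" using UV WV by (force simp: orbP_def)
    show "adm v \<alpha>" using v goodD(2)[OF P] adm_cj[OF w(1) \<psi>] by (auto simp: orbP_def)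
    show "(g \<cdot> v, cj g \<alpha>) \<in> P \<union> orbP w \<psi>" if "g \<in> carrier G" for g
      using v
    proof
      assume "(v, \<alpha>) \<in> orbP w \<psi>"
      then obtain h where h: "h \<in> carrier G" "v = h \<cdot> w" "\<alpha> = cj h \<psi>" by (auto simp: orbP_def)
      then have "(g \<cdot> v, cj g \<alpha>) = ((g \<otimes> h) \<cdot> w, cj (g \<otimes> h) \<psi>)" using that w by (simp add: actV_mult cj_cj)
      then show ?thesis using that h by (auto simp: orbP_def)
    qed (use goodD(4)[OF P] that in auto)
    show "\<alpha> = \<beta>" if "(v, \<beta>) \<in> P \<union> orbP w \<psi>" for \<beta>
    proof (cases "v \<in> ?U")
      case True
      then show ?thesis using inU v that goodD(3)[OF P] by blast
    next
      case False
      then have "v \<in> ?W" using v fst' by (metis UnE fst_conv image_eqI)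
      then show ?thesis using inW[OF v] inW[OF that] cj_well_defined[OF w(1) \<psi>] by metis
    qed
  next
    fix f \<alpha> \<beta> x
    assume f: "f \<in> E - R" "(ini f, \<alpha>) \<in> P \<union> orbP w \<psi>" "(ter f, \<beta>) \<in> P \<union> orbP w \<psi>" and x: "x \<in> stE f"
    have i: "ini f \<in> ?U \<union> ?W" "ter f \<in> ?U \<union> ?W" using f(2,3) fst' by (metis fst_conv image_eqI)+
    show "\<alpha> x = \<beta> x"
    proof (cases "ini f \<in> ?U"; cases "ter f \<in> ?U")
      assume "ini f \<in> ?U" "ter f \<in> ?U"
      then show ?thesis using inU f goodD(5)[OF P f(1)] x by blast
    next
      assume a: "ini f \<in> ?U" "ter f \<notin> ?U"
      then have "(ini f, \<alpha>) \<in> P" "ter f \<in> ?W" using inU f(2) i(2) by blast+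
      then show ?thesis using cross[of "(f, True)" \<alpha> \<beta> x] f(1,3) x by (simp add: src_def tgt_def)
    next
      assume "ini f \<notin> ?U" "ter f \<in> ?U"
      then have "(ter f, \<beta>) \<in> P" "ini f \<in> ?W" using inU f(3) i(1) by blast+
      then show ?thesis using cross[of "(f, False)" \<beta> \<alpha> x] f(1,2) x by (simp add: src_def tgt_def)
    next
      \<comment> \<open>An edge with both ends in the new orbit would be a loop of the quotient
        outside \<open>R\<close>.\<close>
      assume "ini f \<notin> ?U" "ter f \<notin> ?U"
      then have "conn (R \<union> orbE f) V (ini f) (ter f)" using Wconn i WV by blast
      then show ?thesis using R f(1) by (auto simp: forest_def)
    qed
  next
    fix u v assume uv: "u \<in> ?U \<union> ?W" "v \<in> ?U \<union> ?W" "conn R V u v"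
    have UWV: "?U \<union> ?W \<subseteq> V" using UV WV by simp
    have UtoW: "conn R (?U \<union> ?W) u v" if uv: "u \<in> ?U" "v \<in> ?W" "conn R V u v" for u v
    proof -
      obtain d0 \<alpha>0 where d0: "fst d0 \<in> E - R" "(src d0, \<alpha>0) \<in> P" "tgt d0 = w"
        using joined[OF uv] by blast
      have s0U: "src d0 \<in> ?U" using d0(2) by force
      have "conn R V v w" using Wconn[OF uv(2) wW WV] .
      also have "conn R V w (src d0)" using conn_dart_sym[OF d0(1), of V] d0 w by simp
      finally have "conn R V u (src d0)" using uv(3) conn_trans by blast
      then have "conn R ?U u (src d0)" using goodD(6)[OF P uv(1) s0U] by simp
      then have "conn R (?U \<union> ?W) u (src d0)" using conn_mono by blast
      also have "conn R (?U \<union> ?W) (src d0) w" using conn_dart[OF d0(1)] s0U wW d0(3) by auto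
      also have "conn R (?U \<union> ?W) w v" using Wconn[OF wW uv(2)] by simp
      finally show ?thesis .
    qed
    show "conn R (?U \<union> ?W) u v"
    proof (cases "u \<in> ?U"; cases "v \<in> ?U")
      assume "u \<in> ?U" "v \<in> ?U"
      then show ?thesis using goodD(6)[OF P _ _ uv(3)] conn_mono by blast
    next
      assume "u \<in> ?U" "v \<notin> ?U"
      then show ?thesis using UtoW uv by blast
    next
      assume "u \<notin> ?U" "v \<in> ?U"
      then have "conn R (?U \<union> ?W) v u" using UtoW[of v u] uv conn_sym[of V] by blast
      then show ?thesis using conn_sym[OF UWV] by blast
    next
      assume "u \<notin> ?U" "v \<notin> ?U"
      then show ?thesis using Wconn[of u v "?U \<union> ?W" R] uv by blast
    qed
  qed
qed

text \<open>A maximal partial family that misses a vertex has a boundary edge outside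
  \<open>R\<close>, and the retraction onto its stabilizer extends the homomorphism unchanged. This
  exactness makes unions of chains possible: rescaling at each step would not survive infinitely
  many steps.\<close>

lemma good_extend:
  assumes R: "forest R" and P: "good R P" and cover: "\<And>v. v \<in> V \<Longrightarrow> \<exists>u\<in>fst ` P. conn R V u v"
  obtains Q where "good R Q" "P \<subseteq> Q" "fst ` Q = V"
proof -
  let ?A = "{Q. good R Q \<and> P \<subseteq> Q}"
  have "\<exists>Q\<in>?A. \<forall>X\<in>?A. Q \<subseteq> X \<longrightarrow> X = Q"
  proof (rule subset_Zorn_nonempty)
    show "?A \<noteq> {}" using P by auto
    fix C assume C: "C \<noteq> {}" "subset.chain ?A C"
    have gC: "good R Q" "P \<subseteq> Q" if "Q \<in> C" for Q using C that by (auto simp: subset.chain_def)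
    have lin: "Q \<subseteq> Q' \<or> Q' \<subseteq> Q" if "Q \<in> C" "Q' \<in> C" for Q Q'
      using C that by (auto simp: subset_chain_def)
    have both: "\<exists>Q\<in>C. p \<in> Q \<and> q \<in> Q" if pq: "p \<in> \<Union>C" "q \<in> \<Union>C" for p q
    proof -
      obtain Q Q' where "Q \<in> C" "p \<in> Q" "Q' \<in> C" "q \<in> Q'" using pq by blast
      then show ?thesis using lin by blast
    qed
    have "good R (\<Union>C)"
      unfolding good_def
    proof (intro conjI allI impI ballI)
      fix v \<alpha> assume "(v, \<alpha>) \<in> \<Union>C"
      then obtain Q where Q: "Q \<in> C" "(v, \<alpha>) \<in> Q" by blast
      note g = goodD[OF gC(1)[OF Q(1)]]
      show "v \<in> V" "adm v \<alpha>" using g(1,2) Q by blast+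
      show "(g \<cdot> v, cj g \<alpha>) \<in> \<Union>C" if "g \<in> carrier G" for g using g(4)[OF Q(2) that] Q by blast
    next
      fix v \<alpha> \<beta> assume "(v, \<alpha>) \<in> \<Union>C" "(v, \<beta>) \<in> \<Union>C"
      then obtain Q where "Q \<in> C" "(v, \<alpha>) \<in> Q" "(v, \<beta>) \<in> Q" using both by blast
      then show "\<alpha> = \<beta>" using goodD(3)[OF gC(1)] by blast
    next
      fix f \<alpha> \<beta> x assume f: "f \<in> E - R" "(ini f, \<alpha>) \<in> \<Union>C" "(ter f, \<beta>) \<in> \<Union>C" "x \<in> stE f"
      then obtain Q where "Q \<in> C" "(ini f, \<alpha>) \<in> Q" "(ter f, \<beta>) \<in> Q" using both by blast
      then show "\<alpha> x = \<beta> x" using goodD(5)[OF gC(1) f(1)] f(4) by blast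
    next
      fix u v assume uv: "u \<in> fst ` \<Union>C" "v \<in> fst ` \<Union>C" "conn R V u v"
      then obtain p q where "p \<in> \<Union>C" "u = fst p" "q \<in> \<Union>C" "v = fst q" by blast
      then obtain Q where "Q \<in> C" "u \<in> fst ` Q" "v \<in> fst ` Q" using both by blast
      then show "conn R (fst ` \<Union>C) u v" using goodD(6)[OF gC(1) _ _ uv(3)] conn_mono by blast
    qed
    then show "\<Union>C \<in> ?A" using C(1) gC(2) by blast
  qed
  then obtain Q where Q0: "Q \<in> ?A" "\<forall>X\<in>?A. Q \<subseteq> X \<longrightarrow> X = Q" by (rule bexE)
  then have Q: "good R Q" "P \<subseteq> Q" by auto
  have max: "X = Q" if "good R X" "Q \<subseteq> X" for X
    using Q0(2) that subset_trans[OF Q(2) that(2)] by simp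
  have "fst ` Q = V"
  proof (rule ccontr)
    assume "fst ` Q \<noteq> V"
    then obtain v where v: "v \<in> V" "v \<notin> fst ` Q" using good_subset[OF Q(1)] by blast
    obtain u where u: "u \<in> fst ` P" "conn R V u v" using cover v by blast
    have uQ: "u \<in> fst ` Q" using u Q(2) by blast
    have "\<exists>d. fst d \<in> E - R \<and> src d \<in> fst ` Q \<and> tgt d \<notin> fst ` Q"
    proof (rule ccontr)
      assume "\<not> ?thesis"
      then have n: "tgt d \<in> fst ` Q" if "fst d \<in> E - R" "src d \<in> fst ` Q" for d using that by blast
      have "v \<in> fst ` Q"
      proof (rule conn_propagate[OF u(2), where P = "\<lambda>v. v \<in> fst ` Q"])
        show "ter f \<in> fst ` Q" if "f \<in> E - R" "ini f \<in> fst ` Q" for f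
          using n[of "(f, True)"] that by (simp add: src_def tgt_def)
        show "ini f \<in> fst ` Q" if "f \<in> E - R" "ter f \<in> fst ` Q" for f
          using n[of "(f, False)"] that by (simp add: src_def tgt_def)
      qed (use uQ good_subset[OF Q(1)] good_act[OF Q(1)] in auto)
      then show False using v by simp
    qed
    then obtain d \<alpha> where d: "fst d \<in> E - R" "(src d, \<alpha>) \<in> Q" "tgt d \<notin> fst ` Q" by force
    have dE: "fst d \<in> E" using d by simp
    have "zhom (stV (src d)) \<alpha>" using goodD(2)[OF Q(1) d(2)] by (simp add: adm_def)
    then have z: "zhom (stE (fst d)) \<alpha>" using zhom_subset stE_subset_dart dE by blast
    obtain \<rho> where \<rho>: "retraction (stE (fst d)) (stV (tgt d)) \<rho>" using retraction_dart(2)[OF dE] by blast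
    obtain \<chi> where \<chi>: "zhom (stV (tgt d)) \<chi>" "\<forall>x\<in>stE (fst d). \<chi> x = \<alpha> x"
      using retraction_zhom_extend[OF \<rho> z] by blast
    define \<psi> where "\<psi> x = (if x \<in> stV (tgt d) then \<chi> x else 0)" for x
    have a: "adm (tgt d) \<psi>"
      using \<chi>(1) subgroup.m_closed[OF subgroup_stV[of "tgt d"]] dE by (simp add: adm_def \<psi>_def zhom_def)
    have "\<forall>x\<in>stE (fst d). \<alpha> x = \<psi> x" using \<chi>(2) stE_subset_dart(2)[OF dE] by (auto simp: \<psi>_def)
    then have "good R (Q \<union> orbP (tgt d) \<psi>)"
      using d dE by (intro good_step[OF R Q(1) _ d(3) a] disjI1 exI[of _ d] exI[of _ \<alpha>]) auto
    then have "Q \<union> orbP (tgt d) \<psi> = Q" using max by blast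
    then have "(tgt d, \<psi>) \<in> Q" using orbP_self[OF _ a] dE by auto
    then show False using d(3) by force
  qed
  then show ?thesis using that Q by blast
qed

lemma family_of_good:
  assumes Q: "good R Q" and V: "fst ` Q = V"
  obtains \<chi> where "family \<chi>" "\<And>v \<alpha>. (v, \<alpha>) \<in> Q \<Longrightarrow> \<chi> v = \<alpha>"
    "\<And>f x. f \<in> E - R \<Longrightarrow> x \<in> stE f \<Longrightarrow> \<chi> (ini f) x = \<chi> (ter f) x"
proof -
  define \<chi> where "\<chi> v = (THE \<alpha>. (v, \<alpha>) \<in> Q)" for v
  have \<chi>: "\<chi> v = \<alpha>" if "(v, \<alpha>) \<in> Q" for v \<alpha>
    unfolding \<chi>_def using that goodD(3)[OF Q] by blast
  have in_Q: "(v, \<chi> v) \<in> Q" if "v \<in> V" for v using that V \<chi> by force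
  have "family \<chi>"
    unfolding family_def
  proof (intro ballI conjI)
    fix v assume v: "v \<in> V"
    show "zhom (stV v) (\<chi> v)" using goodD(2)[OF Q in_Q[OF v]] by (simp add: adm_def)
    fix g x assume g: "g \<in> carrier G" and x: "x \<in> stV v"
    have "x \<in> carrier G" using x by (simp add: stV_iff)
    moreover have "\<chi> (g \<cdot> v) = cj g (\<chi> v)" using \<chi> goodD(4)[OF Q in_Q[OF v] g] by blast
    ultimately show "\<chi> (g \<cdot> v) (g \<otimes> x \<otimes> inv g) = \<chi> v x"
      using conj_cancel(2)[OF g] g by (simp add: cj_def)
  qed
  moreover have "\<chi> (ini f) x = \<chi> (ter f) x" if "f \<in> E - R" "x \<in> stE f" for f x
    using goodD(5)[OF Q that(1) in_Q in_Q that(2)] that by simp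
  ultimately show ?thesis using that \<chi> by blast
qed

lemma good_scale:
  assumes P: "good R P"
  shows "good R ((\<lambda>(v, \<alpha>). (v, \<lambda>x. k * \<alpha> x)) ` P)"
proof -
  let ?P = "(\<lambda>(v, \<alpha>). (v, \<lambda>x. k * \<alpha> x)) ` P"
  have mem: "(v, \<alpha>') \<in> ?P \<longleftrightarrow> (\<exists>\<alpha>. (v, \<alpha>) \<in> P \<and> \<alpha>' = (\<lambda>x. k * \<alpha> x))" for v \<alpha>' by auto
  have f: "fst ` ?P = fst ` P" by force
  show ?thesis
    unfolding good_def f
  proof (intro conjI allI impI ballI)
    fix v \<alpha>' assume "(v, \<alpha>') \<in> ?P"
    then obtain \<alpha> where \<alpha>: "(v, \<alpha>) \<in> P" "\<alpha>' = (\<lambda>x. k * \<alpha> x)" using mem by blast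
    show "v \<in> V" using goodD(1)[OF P \<alpha>(1)] .
    show "adm v \<alpha>'" using goodD(2)[OF P \<alpha>(1)] by (simp add: \<alpha>(2) adm_def zhom_def algebra_simps)
    show "(g \<cdot> v, cj g \<alpha>') \<in> ?P" if "g \<in> carrier G" for g
      unfolding mem using goodD(4)[OF P \<alpha>(1) that]
      by (intro exI[of _ "cj g \<alpha>"]) (auto simp: \<alpha>(2) cj_def fun_eq_iff)
  next
    fix v \<alpha> \<beta> assume "(v, \<alpha>) \<in> ?P" "(v, \<beta>) \<in> ?P"
    then show "\<alpha> = \<beta>" unfolding mem using goodD(3)[OF P] by blast
  next
    fix f \<alpha> \<beta> x assume "f \<in> E - R" "(ini f, \<alpha>) \<in> ?P" "(ter f, \<beta>) \<in> ?P" "x \<in> stE f"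
    then show "\<alpha> x = \<beta> x" unfolding mem using goodD(5)[OF P] by metis
  next
    fix u v assume "u \<in> fst ` P" "v \<in> fst ` P" "conn R V u v"
    then show "conn R (fst ` P) u v" using goodD(6)[OF P] by blast
  qed
qed

section \<open>Surjectivity criteria for partial families\<close>

lemma maps_onto_F2_HNN_good:
  assumes e: "e \<in> E" "conn (orbE e) V (ini e) (ter e)" "forest (orbE e)" and P: "good (orbE e) P"
    and i: "(ini e, \<alpha>) \<in> P" "\<forall>x\<in>stE e. \<alpha> x = 0" and t: "(ter e, \<beta>) \<in> P" "\<forall>x\<in>stE e. \<beta> x = 0"
    and v: "(v, \<gamma>) \<in> P" "\<gamma> y \<noteq> 0"
  shows maps_onto_F2
proof -
  have "ini e \<in> fst ` P" using i by force
  then have cover: "\<exists>u\<in>fst ` P. conn (orbE e) V u v" if "v \<in> V" for v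
    using conn_all[OF e(1,2) that] by blast
  obtain Q where Q: "good (orbE e) Q" "P \<subseteq> Q" "fst ` Q = V"
    by (rule good_extend[OF e(3) P]) (use cover in blast)+
  obtain \<chi> where \<chi>: "family \<chi>" "\<And>v \<alpha>. (v, \<alpha>) \<in> Q \<Longrightarrow> \<chi> v = \<alpha>"
    "\<And>f x. f \<in> E - orbE e \<Longrightarrow> x \<in> stE f \<Longrightarrow> \<chi> (ini f) x = \<chi> (ter f) x"
    by (rule family_of_good[OF Q(1,3)]) blast
  have "\<chi> (ini e) = \<alpha>" "\<chi> (ter e) = \<beta>" "\<chi> v = \<gamma>" using \<chi>(2) i t v Q(2) by blast+
  moreover have "y \<in> stV v" using goodD(2)[OF P v(1)] v(2) by (auto simp: adm_def)
  ultimately show ?thesis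
    using maps_onto_F2_HNN[OF e(1,2) \<chi>(1,3), of v y] i t v goodD(1)[OF P v(1)] by auto
qed

lemma maps_onto_F2_amalgam_good:
  assumes e: "e \<in> E" "\<not> conn (orbE e) V (ini e) (ter e)" "forest (orbE e)" and P: "good (orbE e) P"
    and i: "(ini e, \<alpha>) \<in> P" "\<forall>x\<in>stE e. \<alpha> x = 0" and t: "(ter e, \<beta>) \<in> P" "\<forall>x\<in>stE e. \<beta> x = 0"
    and v: "(v, \<gamma>) \<in> P" "\<gamma> y \<noteq> 0" "conn (orbE e) V (ini e) v"
    and w: "(w, \<delta>) \<in> P" "\<delta> z \<noteq> 0" "conn (orbE e) V (ter e) w"
  shows maps_onto_F2
proof -
  have "ini e \<in> fst ` P" "ter e \<in> fst ` P" using i t by force+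
  then have cover: "\<exists>u\<in>fst ` P. conn (orbE e) V u v" if "v \<in> V" for v
    using conn_or[OF e(1) that] by blast
  obtain Q where Q: "good (orbE e) Q" "P \<subseteq> Q" "fst ` Q = V"
    by (rule good_extend[OF e(3) P]) (use cover in blast)+
  obtain \<chi> where \<chi>: "family \<chi>" "\<And>v \<alpha>. (v, \<alpha>) \<in> Q \<Longrightarrow> \<chi> v = \<alpha>"
    "\<And>f x. f \<in> E - orbE e \<Longrightarrow> x \<in> stE f \<Longrightarrow> \<chi> (ini f) x = \<chi> (ter f) x"
    by (rule family_of_good[OF Q(1,3)]) blast
  have "\<chi> (ini e) = \<alpha>" "\<chi> (ter e) = \<beta>" "\<chi> v = \<gamma>" "\<chi> w = \<delta>" using \<chi>(2) i t v w Q(2) by blast+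
  moreover have "y \<in> stV v" "z \<in> stV w"
    using goodD(2)[OF P v(1)] goodD(2)[OF P w(1)] v(2) w(2) by (auto simp: adm_def)
  ultimately show ?thesis
    using maps_onto_F2_amalgam[OF e(1,2) \<chi>(1,3), of v y w z] i t v w by auto
qed

lemma kill_exists:
  assumes "fst d \<in> E" "stE (fst d) \<noteq> stV (tgt d)"
  obtains \<psi> x where "adm (tgt d) \<psi>" "\<forall>x\<in>stE (fst d). \<psi> x = 0" "\<psi> x \<noteq> 0"
proof -
  obtain \<rho> where \<rho>: "retraction (stE (fst d)) (stV (tgt d)) \<rho>" using retraction_dart(2)[OF assms(1)] by blast
  obtain \<chi> x where \<chi>: "zhom (stV (tgt d)) \<chi>" "\<forall>x\<in>stE (fst d). \<chi> x = 0" "x \<in> stV (tgt d)" "\<chi> x \<noteq> 0"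
    using retraction_kill[OF fab_stV subgroup_stE \<rho> assms(2)] assms(1) by auto
  define \<psi> where "\<psi> x = (if x \<in> stV (tgt d) then \<chi> x else 0)" for x
  have "adm (tgt d) \<psi>"
    using \<chi>(1) subgroup.m_closed[OF subgroup_stV[of "tgt d"]] assms(1) by (simp add: adm_def \<psi>_def zhom_def)
  moreover have "\<forall>x\<in>stE (fst d). \<psi> x = 0" using \<chi>(2) by (simp add: \<psi>_def)
  moreover have "\<psi> x \<noteq> 0" using \<chi> by (simp add: \<psi>_def)
  ultimately show ?thesis using that by blast
qed

subsection \<open>Descending walks\<close>

text \<open>Vertex stabilizers decrease along such a walk, and compatibility over its edges makes
  the homomorphism at the end the restriction of the one at the start. So \<open>desc R u\<close>
  consists of vertices where a zero homomorphism at \<open>u\<close> forces zero.\<close>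

definition desc_walk :: "'e set \<Rightarrow> 'v \<Rightarrow> ('e \<times> bool) list \<Rightarrow> 'v \<Rightarrow> bool" where
  "desc_walk R u ds v \<longleftrightarrow> walk u ds v \<and> avoids ds R \<and> (\<forall>d\<in>set ds. stE (fst d) = stV (tgt d))"

definition desc :: "'e set \<Rightarrow> 'v \<Rightarrow> 'v set" where
  "desc R u = {v. \<exists>g\<in>carrier G. \<exists>ds. desc_walk R (g \<cdot> u) ds v}"

lemma stab_eq_act:
  assumes "g \<in> carrier G" "fst d \<in> E" "stE (fst d) = stV (tgt d)"
  shows "stE (fst (actD g d)) = stV (tgt (actD g d))"
  using assms stE_act' stV_act' by simp

lemma desc_act:
  assumes R: "ginv R" and u: "u \<in> V" and g: "g \<in> carrier G" and v: "v \<in> desc R u"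
  shows "g \<cdot> v \<in> desc R u"
proof -
  obtain h ds where h: "h \<in> carrier G" "desc_walk R (h \<cdot> u) ds v" using v by (auto simp: desc_def)
  have w: "walk (h \<cdot> u) ds v" using h by (simp add: desc_walk_def)
  have "walk (g \<cdot> h \<cdot> u) (map (actD g) ds) (g \<cdot> v)" using walk_act[OF g w] .
  moreover have "avoids (map (actD g) ds) R" using avoids_act[OF R g w] h by (simp add: desc_walk_def)
  moreover have "\<forall>d\<in>set (map (actD g) ds). stE (fst d) = stV (tgt d)"
    using stab_eq_act[OF g walk_edges[OF w]] h(2) unfolding desc_walk_def by auto
  ultimately have "desc_walk R ((g \<otimes> h) \<cdot> u) (map (actD g) ds) (g \<cdot> v)"
    using g h(1) u by (simp add: desc_walk_def actV_mult)
  then show ?thesis using g h(1) unfolding desc_def by blast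
qed

lemma desc_self: "u \<in> V \<Longrightarrow> u \<in> desc R u"
  unfolding desc_def desc_walk_def by (auto intro!: bexI[of _ \<one>] exI[of _ "[]"])

lemma desc_subset: "desc R u \<subseteq> V"
  by (auto simp: desc_def desc_walk_def dest: walk_closed)

lemma desc_step:
  assumes "fst d \<in> E - R" "src d \<in> desc R u" "stE (fst d) = stV (tgt d)"
  shows "tgt d \<in> desc R u"
proof -
  obtain h ds where h: "h \<in> carrier G" "desc_walk R (h \<cdot> u) ds (src d)" using assms by (auto simp: desc_def)
  then have "desc_walk R (h \<cdot> u) (ds @ [d]) (tgt d)" using assms by (auto simp: desc_walk_def walk_append)
  then show ?thesis using h unfolding desc_def by blast
qed

lemma desc_conn:
  assumes R: "ginv R" and u: "u \<in> V" and v: "v \<in> desc R u"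
  shows "conn R (desc R u) u v"
proof -
  obtain h ds where h: "h \<in> carrier G" "desc_walk R (h \<cdot> u) ds v" using v by (auto simp: desc_def)
  have "v \<in> desc R u \<and> conn R (desc R u) u v" if "desc_walk R (h \<cdot> u) ds v" for v
    using that
  proof (induction ds arbitrary: v rule: rev_induct)
    case Nil
    then have v: "v = h \<cdot> u" by (simp add: desc_walk_def)
    have "h \<cdot> u \<in> desc R u" using desc_act[OF R u h(1) desc_self[OF u]] .
    then show ?case using v conn_act[OF desc_self[OF u] _ h(1)] by blast
  next
    case (snoc d ds)
    then have d: "desc_walk R (h \<cdot> u) ds (src d)" "fst d \<in> E - R" "tgt d = v" "stE (fst d) = stV (tgt d)"
      by (auto simp: desc_walk_def walk_append)
    have IH: "src d \<in> desc R u" "conn R (desc R u) u (src d)" using snoc.IH[OF d(1)] by auto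
    have "tgt d \<in> desc R u" using desc_step[OF d(2) IH(1) d(4)] .
    then show ?case using IH conn_dart[OF d(2) IH(1)] d(3) conn_trans by blast
  qed
  then show ?thesis using h(2) by blast
qed

lemma conn_boundary:
  assumes "conn R V u v" "u \<in> S" "v \<notin> S" "u \<in> V" "\<And>g v. g \<in> carrier G \<Longrightarrow> v \<in> S \<Longrightarrow> g \<cdot> v \<in> S"
  obtains d where "fst d \<in> E - R" "src d \<in> S" "tgt d \<notin> S" "conn R V u (src d)"
proof (rule ccontr)
  assume nt: "\<not> thesis"
  note thesisI = that
  have n: "tgt d \<in> S" if "fst d \<in> E - R" "src d \<in> S" "conn R V u (src d)" for d
    using nt thesisI that by blast
  have "v \<in> S \<and> conn R V u v"
  proof (rule conn_propagate[OF assms(1), where P = "\<lambda>v. v \<in> S \<and> conn R V u v"])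
    show "g \<cdot> w \<in> S \<and> conn R V u (g \<cdot> w)" if "g \<in> carrier G" "w \<in> V" "w \<in> S \<and> conn R V u w" for g w
      using that assms(5) conn_act[of w V g R] conn_trans actV_closed by blast
    show "ter f \<in> S \<and> conn R V u (ter f)" if "f \<in> E - R" "ini f \<in> S \<and> conn R V u (ini f)" for f
    proof -
      have "conn R V (ini f) (ter f)" using conn_edge(1)[OF that(1), of V] that(1) by simp
      then show ?thesis using n[of "(f, True)"] that conn_trans unfolding src_def tgt_def by auto
    qed
    show "ini f \<in> S \<and> conn R V u (ini f)" if "f \<in> E - R" "ter f \<in> S \<and> conn R V u (ter f)" for f
    proof -
      have "conn R V (ter f) (ini f)" using conn_edge(2)[OF that(1), of V] that(1) by simp
      then show ?thesis using n[of "(f, False)"] that conn_trans unfolding src_def tgt_def by auto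
    qed
  qed (use assms in auto)
  then show False using assms by simp
qed

text \<open>An edge leaving \<open>desc R u\<close> has a stabilizer smaller than that of its far
  end, since otherwise the descent would continue. So the zero family on \<open>desc R u\<close> can
  be joined to a nonzero homomorphism at the far end which kills that edge.\<close>

lemma nonzero_family_off_desc:
  assumes R: "forest R" and u: "u \<in> V" and w: "conn R V u w" "w \<notin> desc R u"
  obtains P v \<alpha> x where "good R P" "\<And>a. a \<in> desc R u \<Longrightarrow> (a, \<lambda>_. 0) \<in> P" "(v, \<alpha>) \<in> P" "\<alpha> x \<noteq> 0"
    "\<And>a. a \<in> fst ` P \<Longrightarrow> conn R V u a"
proof -
  have g: "ginv R" using R by (simp add: forest_def)
  define P0 where "P0 = (\<lambda>v. (v, (\<lambda>_::'a. 0::int))) ` desc R u"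
  have f: "fst ` P0 = desc R u" by (simp add: P0_def image_image)
  have mem: "(v, \<alpha>) \<in> P0 \<longleftrightarrow> v \<in> desc R u \<and> \<alpha> = (\<lambda>_. 0)" for v \<alpha> by (auto simp: P0_def)
  have P0: "good R P0"
    unfolding good_def f mem
  proof (intro conjI allI impI ballI)
    fix v \<alpha> h assume "v \<in> desc R u \<and> \<alpha> = (\<lambda>_::'a. 0::int)" "h \<in> carrier G"
    then show "h \<cdot> v \<in> desc R u" "cj h \<alpha> = (\<lambda>_. 0)" using desc_act[OF g u] by (auto simp: cj_def)
  next
    fix a b assume "a \<in> desc R u" "b \<in> desc R u"
    then have "conn R (desc R u) u a" "conn R (desc R u) u b" using desc_conn[OF g u] by auto
    then show "conn R (desc R u) a b" using conn_sym[OF desc_subset] conn_trans by blast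
  qed (use desc_subset in \<open>auto simp: adm_def zhom_def\<close>)
  have uc: "conn R V u a" if "a \<in> desc R u" for a
    using desc_conn[OF g u that] conn_mono[OF _ subset_refl desc_subset] by blast
  obtain d where d: "fst d \<in> E - R" "src d \<in> desc R u" "tgt d \<notin> desc R u" "conn R V u (src d)"
    by (rule conn_boundary[OF w(1) desc_self[OF u] w(2) u]) (use desc_act[OF g u] in auto)
  have dE: "fst d \<in> E" using d by simp
  have ne: "stE (fst d) \<noteq> stV (tgt d)" using desc_step[OF d(1,2)] d(3) by blast
  obtain \<psi> x where \<psi>: "adm (tgt d) \<psi>" "\<forall>x\<in>stE (fst d). \<psi> x = 0" "\<psi> x \<noteq> 0"
    by (rule kill_exists[OF dE ne])
  let ?P = "P0 \<union> orbP (tgt d) \<psi>"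
  show ?thesis
  proof (rule that[of ?P "tgt d" \<psi> x])
    show "good R ?P"
    proof (rule good_step[OF R P0 _ _ \<psi>(1)])
      show "(\<exists>d' \<alpha>. fst d' \<in> E - R \<and> (src d', \<alpha>) \<in> P0 \<and> tgt d' = tgt d \<and> (\<forall>x\<in>stE (fst d'). \<alpha> x = \<psi> x)) \<or>
        (\<forall>a\<in>fst ` P0. \<not> conn R V a (tgt d))"
        using d \<psi>(2) mem by (intro disjI1 exI[of _ d] exI[of _ "\<lambda>_. 0"]) auto
    qed (use d dE f in auto)
    show "(tgt d, \<psi>) \<in> ?P" using orbP_self[OF _ \<psi>(1)] dE by simp
    show "conn R V u a" if a: "a \<in> fst ` ?P" for a
    proof (cases "a \<in> desc R u")
      case False
      then obtain h where h: "h \<in> carrier G" "a = h \<cdot> tgt d" using a f by (auto simp: orbP_def)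
      have "conn R V u (tgt d)" using d(4) conn_dart[OF d(1), of V] dE conn_trans by auto
      then show ?thesis using conn_act[of "tgt d" V h R] h dE conn_trans by auto
    qed (use uc in blast)
  qed (use mem \<psi> in auto)
qed

subsection \<open>Nonseparating edges smaller than a vertex stabilizer\<close>

text \<open>The homomorphism at each vertex is chosen to vanish on the part of \<open>D\<close> which fixes the rest of
the walk; this makes the conditions on the next homomorphism consistent over the rationals, and the
factor \<open>k\<close> clears denominators.\<close>

lemma extend_along_walk:
  assumes R: "forest R" and D: "subgroup D G" "D \<subseteq> stV z"
    and ds: "walk y ds z" "avoids ds R" and P: "good R P" "(y, \<alpha>) \<in> P"
    and kill: "\<And>x. x \<in> D \<Longrightarrow> (\<And>d. d \<in> set ds \<Longrightarrow> x \<in> stE (fst d)) \<Longrightarrow> \<alpha> x = 0"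
    and short: "\<And>u s ds'. u \<in> fst ` P \<Longrightarrow> s \<in> carrier G \<Longrightarrow> walk u ds' (s \<cdot> z) \<Longrightarrow> avoids ds' R \<Longrightarrow>
      length ds \<le> length ds'"
  shows "\<exists>k>0. \<exists>Q \<gamma>. good R Q \<and> (\<forall>v \<beta>. (v, \<beta>) \<in> P \<longrightarrow> (v, \<lambda>x. k * \<beta> x) \<in> Q) \<and>
    (z, \<gamma>) \<in> Q \<and> (\<forall>x\<in>D. \<gamma> x = 0)"
  using ds P kill short
proof (induction ds arbitrary: y P \<alpha>)
  case Nil
  then have "y = z" by simp
  then show ?case using Nil by (intro exI[of _ 1] conjI exI[of _ P] exI[of _ \<alpha>]) auto
next
  case (Cons d ds)
  let ?w = "tgt d"
  have d: "fst d \<in> E" "fst d \<notin> R" "src d = y" "walk ?w ds z" "avoids ds R" using Cons.prems(1,2) by auto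
  have wV: "?w \<in> V" and zV: "z \<in> V" using d walk_closed by auto
  note P = Cons.prems(3,4)
  \<comment> \<open>The elements of \<open>D\<close> that fix every remaining edge of the walk. They
    are exactly those on which no later choice could correct a nonzero value.\<close>
  define K where "K = {x\<in>D. \<forall>d\<in>set ds. x \<in> stE (fst d)}"
  have dsE: "fst d' \<in> E" if "d' \<in> set ds" for d' using walk_edges[OF d(4) that] .
  have "subgroup K G"
  proof (rule subgroupI)
    show "K \<subseteq> carrier G" using subgroup.subset[OF D(1)] by (auto simp: K_def)
    show "K \<noteq> {}" using subgroup.one_closed[OF D(1)] subgroup.one_closed[OF subgroup_stE[OF dsE]]
      by (auto simp: K_def)
    show "inv a \<in> K" if "a \<in> K" for a
      using that subgroup.m_inv_closed[OF D(1)] subgroup.m_inv_closed[OF subgroup_stE[OF dsE]]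
      by (auto simp: K_def)
    show "a \<otimes> b \<in> K" if "a \<in> K" "b \<in> K" for a b
      using that subgroup.m_closed[OF D(1)] subgroup.m_closed[OF subgroup_stE[OF dsE]]
      by (auto simp: K_def)
  qed
  moreover have "K \<subseteq> stV ?w"
  proof (cases ds)
    case Nil
    then show ?thesis using d(4) D(2) by (auto simp: K_def)
  next
    case (Cons d' ds')
    then have "src d' = ?w" "fst d' \<in> E" using d(4) by auto
    then show ?thesis using stE_subset_dart(1)[of d'] Cons by (auto simp: K_def)
  qed
  moreover have "zhom (stE (fst d)) \<alpha>"
    using goodD(2)[OF P] zhom_subset stE_subset_dart(1)[OF d(1)] d(3) by (auto simp: adm_def)
  moreover have "\<alpha> x = 0" if "x \<in> stE (fst d)" "x \<in> K" for x
    using Cons.prems(5)[of x] that by (auto simp: K_def)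
  ultimately obtain k \<chi> where k: "k > (0::int)" "zhom (stV ?w) \<chi>" "\<And>p. p \<in> stE (fst d) \<Longrightarrow> \<chi> p = k * \<alpha> p"
    "\<And>x. x \<in> K \<Longrightarrow> \<chi> x = 0"
    using fab_extend[OF fab_stV[OF wV] subgroup_stE[OF d(1)] stE_subset_dart(2)[OF d(1)], of K \<alpha>] by blast
  define \<psi> where "\<psi> x = (if x \<in> stV ?w then \<chi> x else 0)" for x
  have \<psi>: "adm ?w \<psi>"
    using k(2) subgroup.m_closed[OF subgroup_stV[OF wV]] by (simp add: adm_def \<psi>_def zhom_def)
  define P1 where "P1 = (\<lambda>(v, \<alpha>). (v, \<lambda>x. k * \<alpha> x)) ` P"
  have P1: "good R P1" unfolding P1_def by (rule good_scale[OF P(1)])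
  have f1: "fst ` P1 = fst ` P" unfolding P1_def by force
  have m1: "(v, \<lambda>x. k * \<beta> x) \<in> P1" if "(v, \<beta>) \<in> P" for v \<beta> unfolding P1_def using that by force
  have yP: "y \<in> fst ` P" using P(2) by force
  \<comment> \<open>Were \<open>tgt d\<close> already in the domain, the walk \<open>ds\<close>
    would be shorter than minimality allows.\<close>
  have w: "?w \<notin> fst ` P1"
    using Cons.prems(6)[of ?w \<one> ds] d zV f1 by auto
  let ?P2 = "P1 \<union> orbP ?w \<psi>"
  have P2: "good R ?P2"
  proof (rule good_step[OF R P1 wV w \<psi>])
    have "\<forall>x\<in>stE (fst d). k * \<alpha> x = \<psi> x"
      using k(3) stE_subset_dart(2)[OF d(1)] by (auto simp: \<psi>_def)
    then show "(\<exists>d' \<alpha>. fst d' \<in> E - R \<and> (src d', \<alpha>) \<in> P1 \<and> tgt d' = ?w \<and> (\<forall>x\<in>stE (fst d'). \<alpha> x = \<psi> x)) \<or>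
        (\<forall>a\<in>fst ` P1. \<not> conn R V a ?w)"
      using d m1[OF P(2)] by (intro disjI1 exI[of _ d] exI[of _ "\<lambda>x. k * \<alpha> x"]) auto
  qed
  have "\<exists>k'>0. \<exists>Q \<gamma>. good R Q \<and> (\<forall>v \<beta>. (v, \<beta>) \<in> ?P2 \<longrightarrow> (v, \<lambda>x. k' * \<beta> x) \<in> Q) \<and>
    (z, \<gamma>) \<in> Q \<and> (\<forall>x\<in>D. \<gamma> x = 0)"
  proof (rule Cons.IH[OF d(4,5) P2, of \<psi>])
    show "(?w, \<psi>) \<in> ?P2" using orbP_self[OF wV \<psi>] by simp
    show "\<psi> x = 0" if "x \<in> D" "\<And>d. d \<in> set ds \<Longrightarrow> x \<in> stE (fst d)" for x
      using k(4)[of x] that by (auto simp: \<psi>_def K_def)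
    show "length ds \<le> length ds'"
      if u: "u \<in> fst ` ?P2" "s \<in> carrier G" "walk u ds' (s \<cdot> z)" "avoids ds' R" for u s ds'
    proof (cases "u \<in> fst ` P")
      case True
      then show ?thesis using Cons.prems(6)[of u s ds'] u by simp
    next
      case False
      then obtain g where g: "g \<in> carrier G" "u = g \<cdot> ?w" using u(1) f1 by (auto simp: orbP_def)
      have "walk (inv g \<cdot> u) (map (actD (inv g)) ds') (inv g \<cdot> s \<cdot> z)" using walk_act[OF _ u(3)] g by simp
      then have "walk ?w (map (actD (inv g)) ds') ((inv g \<otimes> s) \<cdot> z)" using g wV zV u(2) by (simp add: actV_mult)
      moreover have "avoids (map (actD (inv g)) ds') R"
        using avoids_act[of R "inv g", OF _ _ u(3)] R g u(4) by (simp add: forest_def)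
      ultimately show ?thesis
        using Cons.prems(6)[OF yP, of "inv g \<otimes> s" "d # map (actD (inv g)) ds'"] g u(2) d by simp
    qed
  qed
  then obtain k' Q \<gamma> where Q: "k' > 0" "good R Q" "\<And>v \<beta>. (v, \<beta>) \<in> ?P2 \<Longrightarrow> (v, \<lambda>x. k' * \<beta> x) \<in> Q"
    "(z, \<gamma>) \<in> Q" "\<forall>x\<in>D. \<gamma> x = 0" by blast
  have "(v, \<lambda>x. k' * k * \<beta> x) \<in> Q" if "(v, \<beta>) \<in> P" for v \<beta>
    using Q(3)[of v "\<lambda>x. k * \<beta> x"] m1[OF that] by (simp add: mult.assoc)
  then show ?case using Q k(1) by (intro exI[of _ "k' * k"]) auto
qed

lemma shortest_walk:
  assumes "conn R V u w" "u \<in> V" "ginv R"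
  obtains s ds where "s \<in> carrier G" "walk u ds (s \<cdot> w)" "avoids ds R"
    "\<And>s' ds'. s' \<in> carrier G \<Longrightarrow> walk u ds' (s' \<cdot> w) \<Longrightarrow> avoids ds' R \<Longrightarrow> length ds \<le> length ds'"
proof -
  let ?P = "\<lambda>(s, ds). s \<in> carrier G \<and> walk u ds (s \<cdot> w) \<and> avoids ds R"
  obtain s0 ds0 where "s0 \<in> carrier G" "walk u ds0 (s0 \<cdot> w)" "avoids ds0 R" using walk_of_conn[OF assms] .
  then have "?P (s0, ds0)" by simp
  from ex_has_least_nat[of ?P, OF this, of "\<lambda>(s, ds). length ds"]
  obtain p where "?P p" "\<forall>q. ?P q \<longrightarrow> (\<lambda>(s, ds). length ds) p \<le> (\<lambda>(s, ds). length ds) q" by blast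
  then show ?thesis using that[of "fst p" "snd p"] by (cases p) auto
qed

text \<open>A nonzero homomorphism at \<open>src d\<close> that kills \<open>fst d\<close> is
  carried along a shortest lift of the way round the cycle to \<open>s \<cdot> tgt d\<close>, where
  it is made to vanish on the translated edge. Translating back gives the vanishing at both ends
  that the HNN criterion requires.\<close>

lemma maps_onto_F2_if_small_nonseparating:
  assumes e: "fst d \<in> E" "conn (orbE (fst d)) V (src d) (tgt d)" "forest (orbE (fst d))"
    and ne: "stE (fst d) \<noteq> stV (src d)"
  shows maps_onto_F2
proof -
  let ?R = "orbE (fst d)"
  have gR: "ginv ?R" using e(3) by (simp add: forest_def)
  have V: "src d \<in> V" "tgt d \<in> V" using e by auto
  obtain \<psi> y where \<psi>: "adm (src d) \<psi>" "\<forall>x\<in>stE (fst d). \<psi> x = 0" "\<psi> y \<noteq> 0"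
    using kill_exists[of "flip d"] e ne by (metis dart_simps(1,3))
  obtain s ds where ds: "s \<in> carrier G" "walk (src d) ds (s \<cdot> tgt d)" "avoids ds ?R"
    and short: "\<And>s' ds'. s' \<in> carrier G \<Longrightarrow> walk (src d) ds' (s' \<cdot> tgt d) \<Longrightarrow> avoids ds' ?R \<Longrightarrow> length ds \<le> length ds'"
    by (rule shortest_walk[OF e(2) V(1) gR]) (rule that; assumption)
  let ?z = "s \<cdot> tgt d"
  let ?D = "stE (s \<star> fst d)"
  let ?P = "{} \<union> orbP (src d) \<psi>"
  have P: "good ?R ?P" by (rule good_step[OF e(3) good_empty V(1) _ \<psi>(1)]) auto
  have "\<exists>k>0. \<exists>Q \<gamma>. good ?R Q \<and> (\<forall>v \<beta>. (v, \<beta>) \<in> ?P \<longrightarrow> (v, \<lambda>x. k * \<beta> x) \<in> Q) \<and>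
    (?z, \<gamma>) \<in> Q \<and> (\<forall>x\<in>?D. \<gamma> x = 0)"
  proof (rule extend_along_walk[OF e(3) _ _ ds(2,3) P])
    show "subgroup ?D G" using subgroup_stE ds(1) e(1) by simp
    show D: "?D \<subseteq> stV ?z" using stE_subset_dart(2)[of "actD s d"] ds(1) e(1) by simp
    show "(src d, \<psi>) \<in> ?P" using orbP_self[OF V(1) \<psi>(1)] by simp
    \<comment> \<open>Both \<open>x\<close> and its conjugate by \<open>inv s\<close> lie in the
      abelian group \<open>stV (src d)\<close>, so they commute and hence coincide. Therefore
      \<open>x\<close> fixes \<open>fst d\<close>, where \<psi> vanishes.\<close>
    show "\<psi> x = 0" if x: "x \<in> ?D" "\<And>d. d \<in> set ds \<Longrightarrow> x \<in> stE (fst d)" for x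
    proof -
      have xc: "x \<in> carrier G" using x(1) by (simp add: stE_iff)
      have xv: "x \<in> stV (src d)"
      proof (cases ds)
        case Nil
        then show ?thesis using ds(2) D x(1) by auto
      next
        case (Cons d' ds')
        then show ?thesis using ds(2) x(2)[of d'] stE_subset_dart(1)[of d'] by auto
      qed
      have c: "inv s \<otimes> x \<otimes> s \<in> stE (fst d)" using stE_act[OF ds(1) e(1) xc] x(1) by simp
      then have "inv s \<otimes> x \<otimes> s \<in> stV (src d)" using stE_subset_dart(1)[OF e(1)] by blast
      then have "x \<otimes> (inv s \<otimes> x \<otimes> s) = (inv s \<otimes> x \<otimes> s) \<otimes> x" using stV_comm[OF V(1) xv] by blast
      then have "x = inv s \<otimes> x \<otimes> s"
        using commuting_conjugates[of x "inv s \<otimes> x \<otimes> s" "inv s"] xc ds(1) by simp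
      then show ?thesis using \<psi>(2) c by metis
    qed
    show "length ds \<le> length ds'"
      if u: "u \<in> fst ` ?P" "s' \<in> carrier G" "walk u ds' (s' \<cdot> ?z)" "avoids ds' ?R" for u s' ds'
    proof -
      obtain g where g: "g \<in> carrier G" "u = g \<cdot> src d" using u(1) by (auto simp: orbP_def)
      have "walk (inv g \<cdot> u) (map (actD (inv g)) ds') (inv g \<cdot> s' \<cdot> ?z)" using walk_act[OF _ u(3)] g by simp
      then have "walk (src d) (map (actD (inv g)) ds') ((inv g \<otimes> s' \<otimes> s) \<cdot> tgt d)"
        using g V u(2) ds(1) by (simp add: actV_mult)
      moreover have "avoids (map (actD (inv g)) ds') ?R" using avoids_act[OF gR _ u(3), of "inv g"] g u(4) by simp
      ultimately show ?thesis using short[of "inv g \<otimes> s' \<otimes> s" "map (actD (inv g)) ds'"] g u(2) ds(1) by simp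
    qed
  qed
  then obtain k Q \<gamma> where Q: "k > 0" "good ?R Q" "\<And>v \<beta>. (v, \<beta>) \<in> ?P \<Longrightarrow> (v, \<lambda>x. k * \<beta> x) \<in> Q"
    "(?z, \<gamma>) \<in> Q" "\<forall>x\<in>?D. \<gamma> x = 0" by blast
  have a: "(src d, \<lambda>x. k * \<psi> x) \<in> Q" using Q(3) orbP_self[OF V(1) \<psi>(1)] by simp
  have b: "(tgt d, cj (inv s) \<gamma>) \<in> Q" using goodD(4)[OF Q(2,4), of "inv s"] ds(1) V by simp
  have b0: "cj (inv s) \<gamma> x = 0" if x: "x \<in> stE (fst d)" for x
  proof -
    have "x \<in> carrier G" using x by (simp add: stE_iff)
    moreover have "s \<otimes> x \<otimes> inv s \<in> ?D" using stE_act'[OF ds(1) e(1)] x by auto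
    ultimately show ?thesis using Q(5) ds(1) by (simp add: cj_def)
  qed
  have a0: "\<forall>x\<in>stE (fst d). k * \<psi> x = 0" using \<psi>(2) by simp
  have y: "k * \<psi> y \<noteq> 0" using \<psi>(3) Q(1) by simp
  show ?thesis
  proof (cases "snd d")
    case True
    then have st: "src d = ini (fst d)" "tgt d = ter (fst d)" by (auto simp: src_def tgt_def)
    show ?thesis
      using maps_onto_F2_HNN_good[OF e(1) _ e(3) Q(2), of "\<lambda>x. k * \<psi> x" "cj (inv s) \<gamma>" "src d" "\<lambda>x. k * \<psi> x" y]
        e(2) a b a0 b0 y st by auto
  next
    case False
    then have st: "tgt d = ini (fst d)" "src d = ter (fst d)" by (auto simp: src_def tgt_def)
    show ?thesis
      using maps_onto_F2_HNN_good[OF e(1) _ e(3) Q(2), of "cj (inv s) \<gamma>" "\<lambda>x. k * \<psi> x" "src d" "\<lambda>x. k * \<psi> x" y]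
        conn_sym[OF subset_refl e(2)] a b a0 b0 y st by auto
  qed
qed

subsection \<open>A largest vertex stabilizer\<close>

text \<open>Conjugates of \<open>x\<close> stay in the largest stabilizer, which is abelian; so
  \<open>x\<close> commutes with each of its conjugates and equals them all.\<close>

lemma largest_stabilizer_central:
  assumes u: "u \<in> V" and max: "\<And>w. w \<in> V \<Longrightarrow> stV w \<subseteq> stV u"
    and x: "x \<in> stV u" and g: "g \<in> carrier G"
  shows "g \<otimes> x = x \<otimes> g"
proof -
  have xc: "x \<in> carrier G" using x by (simp add: stV_iff)
  have "g \<otimes> x \<otimes> inv g \<in> stV (g \<cdot> u)" using stV_act'[OF g u] x by auto
  then have "g \<otimes> x \<otimes> inv g \<in> stV u" using max[of "g \<cdot> u"] u g by auto
  then have "x = g \<otimes> x \<otimes> inv g"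
    using commuting_conjugates[of x "g \<otimes> x \<otimes> inv g" g] stV_comm[OF u x] xc g by simp
  then have "x \<otimes> g = g \<otimes> x \<otimes> inv g \<otimes> g" by simp
  then show ?thesis using xc g by (simp add: m_assoc)
qed

text \<open>Folding shortens the walk at the price of changing \<open>g\<close> by an element of a vertex stabilizer.\<close>

lemma closed_walk_in_largest_stabilizer:
  assumes R: "forest R" and u: "u \<in> V" and max: "\<And>w. w \<in> V \<Longrightarrow> stV w \<subseteq> stV u"
    and "walk v ds (g \<cdot> v)" "avoids ds R" "g \<in> carrier G"
  shows "g \<in> stV u"
  using assms(4-6)
proof (induction "length ds" arbitrary: ds g rule: less_induct)
  case less
  have v: "v \<in> V" using walk_closed less.prems by blast
  have gR: "ginv R" using R by (simp add: forest_def)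
  show ?case
  proof (cases "ds = []")
    case True
    then have "g \<in> stV v" using less.prems by (simp add: stV_iff)
    then show ?thesis using max[OF v] by blast
  next
    case False
    obtain xs a b ys k where k: "ds = xs @ a # b # ys" "k \<in> carrier G" "k \<cdot> tgt a = tgt a" "k \<star> fst a = fst b"
      using fold_exists[OF R less.prems(1,2) False less.prems(3)] by blast
    have w: "walk v xs (src a)" "fst a \<in> E" "fst b \<in> E" "src b = tgt a" "walk (tgt b) ys (g \<cdot> v)"
      using less.prems(1) k(1) by (auto simp: walk_append)
    \<comment> \<open>Since \<open>b\<close> is the reversed translate of \<open>a\<close>, both are
      cut out and \<open>ys\<close> is moved by \<open>inv k\<close> to continue from
      \<open>src a\<close>. This replaces \<open>g\<close> by \<open>inv k \<otimes> g\<close>, and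
      \<open>k\<close>, which fixes \<open>tgt a\<close>, lies in \<open>stV u\<close>.\<close>
    have "b = flip (actD k a)" using dart_eq_flip[of "actD k a" b] k w by simp
    then have "tgt b = k \<cdot> src a" using k w by simp
    then have "walk (inv k \<cdot> k \<cdot> src a) (map (actD (inv k)) ys) (inv k \<cdot> g \<cdot> v)"
      using walk_act[of "inv k", OF _ w(5)] k by simp
    then have "walk (src a) (map (actD (inv k)) ys) ((inv k \<otimes> g) \<cdot> v)"
      using k w v less.prems(3) by (simp add: actV_mult)
    then have "walk v (xs @ map (actD (inv k)) ys) ((inv k \<otimes> g) \<cdot> v)" using w(1) by (auto simp: walk_append)
    moreover have "avoids (xs @ map (actD (inv k)) ys) R"
      using less.prems(2) k(1,2) avoids_act[OF gR _ w(5), of "inv k"] by simp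
    ultimately have "inv k \<otimes> g \<in> stV u"
      using less.hyps[of "xs @ map (actD (inv k)) ys" "inv k \<otimes> g"] k less.prems(3) by simp
    moreover have "k \<in> stV u" using max[of "tgt a"] k w by (auto simp: stV_iff)
    ultimately have "k \<otimes> (inv k \<otimes> g) \<in> stV u" using subgroup.m_closed[OF subgroup_stV[OF u]] by blast
    then show ?thesis using k less.prems(3) by (simp add: m_inv_cancel)
  qed
qed

text \<open>A walk from \<open>u\<close> to \<open>g \<cdot> u\<close> is closed in the quotient,
  which is a forest; so every \<open>g\<close> lies in \<open>stV u\<close> and the group is
  abelian.\<close>

lemma solvable_tree_quotient:
  assumes "forest {}" and u: "u \<in> V" and max: "\<And>w. w \<in> V \<Longrightarrow> stV w \<subseteq> stV u"
  shows "solvable G"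
proof (rule solvable_if_commutative)
  have "g \<in> stV u" if g: "g \<in> carrier G" for g
  proof -
    obtain ds where "walk u ds (g \<cdot> u)" using walk_exists[of u "g \<cdot> u"] u g by auto
    then show ?thesis using closed_walk_in_largest_stabilizer[OF assms(1) u max] g by simp
  qed
  then show "x \<otimes> y = y \<otimes> x" if "x \<in> carrier G" "y \<in> carrier G" for x y using stV_comm[OF u] that by blast
qed

text \<open>Here the group is generated by the central subgroup \<open>stV u\<close> and one more element \<open>s\<close>.\<close>

lemma solvable_unicyclic_quotient:
  assumes e: "e \<in> E" "conn (orbE e) V (ini e) (ter e)" and R: "forest (orbE e)"
    and u: "u \<in> V" and max: "\<And>w. w \<in> V \<Longrightarrow> stV w \<subseteq> stV u"
  shows "solvable G"
proof (rule solvable_if_commutative)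
  let ?R = "orbE e"
  have gR: "ginv ?R" using R by (simp add: forest_def)
  \<comment> \<open>The cycle through \<open>e\<close>, cut open at \<open>e\<close>, lifts to a
    walk from \<open>ini e\<close> to \<open>s' \<cdot> ter e\<close>. The inverse of
    \<open>s'\<close> takes the place of the stable letter.\<close>
  obtain s' ds0 where s': "s' \<in> carrier G" "walk (ini e) ds0 (s' \<cdot> ter e)" "avoids ds0 ?R"
    using walk_of_conn[OF e(2) ini_closed[OF e(1)] gR] .
  define s where "s = inv s'"
  have s: "s \<in> carrier G" using s' by (simp add: s_def)
  define v1 where "v1 = s' \<cdot> ter e"
  have v1: "v1 \<in> V" "s \<cdot> v1 = ter e" using s' e by (auto simp: s_def v1_def)
  \<comment> \<open>The component of \<open>ini e\<close> in the tree without the translates of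
    \<open>e\<close>. A group element taking one of its vertices to another closes up a walk in a
    forest, so it lies in \<open>stV u\<close>.\<close>
  define X where "X = {x. \<exists>ds. walk (ini e) ds x \<and> avoids ds ?R}"
  have XV: "x \<in> V" if "x \<in> X" for x using that walk_closed by (auto simp: X_def)
  have v1X: "v1 \<in> X" using s' by (auto simp: X_def v1_def)
  have v0X: "ini e \<in> X" using e by (auto simp: X_def intro!: exI[of _ "[]"])
  have XX: "h \<in> stV u" if h: "h \<in> carrier G" "x \<in> X" "h \<cdot> x \<in> X" for h x
  proof -
    obtain ds ds' where d: "walk (ini e) ds x" "avoids ds ?R" "walk (ini e) ds' (h \<cdot> x)" "avoids ds' ?R"
      using h by (auto simp: X_def)
    have "walk x (rev (map flip ds) @ ds') (h \<cdot> x)" using walk_rev[OF d(1)] d(3) by (auto simp: walk_append)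
    then show ?thesis using closed_walk_in_largest_stabilizer[OF R u max] d h(1) by auto
  qed
  \<comment> \<open>The \<Gamma>-translates of \<open>X\<close> cover the tree: leaving one of them
    through \<open>g \<star> e\<close> puts \<open>g\<close> into \<Gamma>, with \<open>s\<close>
    accounting for the direction of the crossing. Then \<open>g \<cdot> ini e\<close> lies in some
    translate by \<open>\<gamma>\<close>, and \<open>inv \<gamma> \<otimes> g\<close> in
    \<open>stV u\<close>.\<close>
  have all: "\<Gamma> = carrier G" if \<Gamma>: "subgroup \<Gamma> G" "stV u \<subseteq> \<Gamma>" "s \<in> \<Gamma>" for \<Gamma>
  proof -
    have \<Gamma>c: "h \<in> carrier G" if "h \<in> \<Gamma>" for h using subgroup.mem_carrier[OF \<Gamma>(1) that] .
    have \<Gamma>m: "g \<otimes> h \<in> \<Gamma>" if "g \<in> \<Gamma>" "h \<in> \<Gamma>" for g h using subgroup.m_closed[OF \<Gamma>(1) that] .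
    have \<Gamma>i: "inv g \<in> \<Gamma>" if "g \<in> \<Gamma>" for g using subgroup.m_inv_closed[OF \<Gamma>(1) that] .
    define T where "T = {\<gamma> \<cdot> x | \<gamma> x. \<gamma> \<in> \<Gamma> \<and> x \<in> X}"
    have step: "tgt d \<in> T" if d: "fst d \<in> E" "src d \<in> T" for d
    proof -
      obtain \<gamma> x where \<gamma>: "\<gamma> \<in> \<Gamma>" "x \<in> X" "src d = \<gamma> \<cdot> x" using d by (auto simp: T_def)
      have xV: "x \<in> V" using XV \<gamma> by blast
      show ?thesis
      proof (cases "fst d \<in> ?R")
        case False
        let ?d = "actD (inv \<gamma>) d"
        have sd: "src ?d = x" using \<gamma> d \<Gamma>c xV by simp
        have "fst ?d \<notin> ?R" using False ginvD[OF gR] \<Gamma>c \<gamma> d by simp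
        moreover obtain ds where "walk (ini e) ds x" "avoids ds ?R" using \<gamma> by (auto simp: X_def)
        ultimately have "walk (ini e) (ds @ [?d]) (tgt ?d)" "avoids (ds @ [?d]) ?R"
          using sd d \<Gamma>c \<gamma>(1) by (auto simp: walk_append)
        then have "tgt ?d \<in> X" by (auto simp: X_def)
        moreover have "tgt d = \<gamma> \<cdot> tgt ?d" using d \<Gamma>c \<gamma>(1) by simp
        ultimately show ?thesis using \<gamma>(1) by (auto simp: T_def)
      next
        case True
        then obtain g where g: "g \<in> carrier G" "fst d = g \<star> e" by (auto simp: orbE_def)
        have ends: "{src d, tgt d} = {g \<cdot> ini e, (g \<otimes> s) \<cdot> v1}"
          using dart_ends[of d] g e s v1 by (simp add: actV_mult)
        then consider "src d = g \<cdot> ini e" "tgt d = (g \<otimes> s) \<cdot> v1" | "src d = (g \<otimes> s) \<cdot> v1" "tgt d = g \<cdot> ini e"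
          by (auto simp: doubleton_eq_iff)
        then show ?thesis
        proof cases
          case 1
          have "(inv \<gamma> \<otimes> g) \<cdot> ini e = x"
            using 1 \<gamma> g \<Gamma>c xV e by (metis actV_inv(1) actV_mult ini_closed inv_closed)
          then have "inv \<gamma> \<otimes> g \<in> stV u" using XX[of "inv \<gamma> \<otimes> g" "ini e"] v0X \<gamma> g \<Gamma>c by simp
          then have "\<gamma> \<otimes> (inv \<gamma> \<otimes> g) \<in> \<Gamma>" using \<Gamma>m \<gamma>(1) \<Gamma>(2) by blast
          then have "g \<in> \<Gamma>" using m_inv_cancel \<Gamma>c \<gamma>(1) g by simp
          then show ?thesis using 1(2) \<Gamma>m \<Gamma>(3) v1X by (auto simp: T_def)
        next
          case 2
          have "(inv \<gamma> \<otimes> (g \<otimes> s)) \<cdot> v1 = x"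
            using 2 \<gamma> g s \<Gamma>c xV v1 by (metis actV_inv(1) actV_mult m_closed inv_closed)
          then have "inv \<gamma> \<otimes> (g \<otimes> s) \<in> stV u" using XX[of "inv \<gamma> \<otimes> (g \<otimes> s)" v1] v1X \<gamma> g s \<Gamma>c by simp
          then have "\<gamma> \<otimes> (inv \<gamma> \<otimes> (g \<otimes> s)) \<in> \<Gamma>" using \<Gamma>m \<gamma>(1) \<Gamma>(2) by blast
          then have "g \<otimes> s \<in> \<Gamma>" using m_inv_cancel \<Gamma>c \<gamma>(1) g s by simp
          then have "g \<otimes> s \<otimes> inv s \<in> \<Gamma>" using \<Gamma>m \<Gamma>i \<Gamma>(3) by blast
          then have "g \<in> \<Gamma>" using g s by (simp add: m_assoc)
          then show ?thesis using 2(2) v0X by (auto simp: T_def)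
        qed
      qed
    qed
    have walkT: "w \<in> T" if "walk v ds w" "v \<in> T" for v w ds
      using that by (induction ds arbitrary: v) (auto intro: step)
    have v0T: "ini e \<in> T" using v0X subgroup.one_closed[OF \<Gamma>(1)] e unfolding T_def
      by (auto intro!: exI[of _ \<one>] exI[of _ "ini e"])
    have "g \<in> \<Gamma>" if g: "g \<in> carrier G" for g
    proof -
      obtain ds where "walk (ini e) ds (g \<cdot> ini e)" using walk_exists[of "ini e" "g \<cdot> ini e"] e g by auto
      then have "g \<cdot> ini e \<in> T" using walkT v0T by blast
      then obtain \<gamma> x where \<gamma>: "\<gamma> \<in> \<Gamma>" "x \<in> X" "g \<cdot> ini e = \<gamma> \<cdot> x" by (auto simp: T_def)
      then have "(inv \<gamma> \<otimes> g) \<cdot> ini e = x"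
        using g \<Gamma>c XV e by (metis actV_inv(1) actV_mult ini_closed inv_closed)
      then have "inv \<gamma> \<otimes> g \<in> stV u" using XX[of "inv \<gamma> \<otimes> g" "ini e"] v0X \<gamma> g \<Gamma>c by simp
      then have "\<gamma> \<otimes> (inv \<gamma> \<otimes> g) \<in> \<Gamma>" using \<Gamma>m \<gamma>(1) \<Gamma>(2) by blast
      then show ?thesis using m_inv_cancel \<Gamma>c \<gamma>(1) g by simp
    qed
    then show ?thesis using \<Gamma>c by blast
  qed
  have centralizer: "subgroup {g \<in> carrier G. g \<otimes> y = y \<otimes> g} G" if y: "y \<in> carrier G" for y
  proof (rule subgroupI)
    fix a assume a: "a \<in> {g \<in> carrier G. g \<otimes> y = y \<otimes> g}"
    then have "inv a \<otimes> y = y \<otimes> inv a" using inv_mult_eq[of y a a y] y by simp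
    then show "inv a \<in> {g \<in> carrier G. g \<otimes> y = y \<otimes> g}" using a by simp
    fix b assume b: "b \<in> {g \<in> carrier G. g \<otimes> y = y \<otimes> g}"
    have ab: "a \<in> carrier G" "a \<otimes> y = y \<otimes> a" "b \<in> carrier G" "b \<otimes> y = y \<otimes> b" using a b by auto
    have "a \<otimes> b \<otimes> y = a \<otimes> (y \<otimes> b)" using ab y by (simp add: m_assoc)
    also have "\<dots> = (a \<otimes> y) \<otimes> b" using ab(1,3) y by (simp add: m_assoc)
    also have "\<dots> = y \<otimes> (a \<otimes> b)" unfolding ab(2) using ab(1,3) y by (simp add: m_assoc)
    finally show "a \<otimes> b \<in> {g \<in> carrier G. g \<otimes> y = y \<otimes> g}" using a b by simp
  qed (use y in auto)
  have stu: "x \<in> carrier G" if "x \<in> stV u" for x using that by (simp add: stV_iff)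
  \<comment> \<open>A centralizer containing \<open>stV u\<close> and \<open>s\<close> is the whole
    group. This is applied to the centralizer of \<open>s\<close>, so that \<open>s\<close> is
    central, and afterwards to that of an arbitrary \<open>y\<close>.\<close>
  have "{g \<in> carrier G. g \<otimes> s = s \<otimes> g} = carrier G"
    by (rule all[OF centralizer[OF s]]) (use s stu largest_stabilizer_central[OF u max _ s] in auto)
  then have s_central: "g \<otimes> s = s \<otimes> g" if "g \<in> carrier G" for g using that by blast
  fix x y assume x: "x \<in> carrier G" and y: "y \<in> carrier G"
  have "{g \<in> carrier G. g \<otimes> y = y \<otimes> g} = carrier G"
    by (rule all[OF centralizer[OF y]])
      (use s s_central[OF y] stu largest_stabilizer_central[OF u max _ y] in auto)
  then show "x \<otimes> y = y \<otimes> x" using x by blast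
qed

subsection \<open>Pairs of incomparable stabilizers\<close>

text \<open>Only conditions at the two ends are imposed, so that cutting at an interior vertex whose
  stabilizer exceeds that of an adjacent edge of the walk again yields a pair.\<close>

definition pair :: "'v \<Rightarrow> ('e \<times> bool) list \<Rightarrow> 'v \<Rightarrow> bool" where
  "pair u ds w \<longleftrightarrow> walk u ds w \<and> reduced ds \<and> ds \<noteq> [] \<and>
     stE (fst (hd ds)) \<noteq> stV u \<and> stE (fst (last ds)) \<noteq> stV w"

lemma walk_hd: "walk u ds w \<Longrightarrow> ds \<noteq> [] \<Longrightarrow> src (hd ds) = u"
  by (cases ds) auto

lemma walk_last: "walk u ds w \<Longrightarrow> ds \<noteq> [] \<Longrightarrow> tgt (last ds) = w"
  by (cases ds rule: rev_cases) (auto simp: walk_append)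

text \<open>The vertex \<open>u\<close> maximizes the number of homomorphisms to the group of order
  two, which is bounded by \<open>2 ^ M\<close>. On a reduced walk to a vertex whose stabilizer is
  not contained in \<open>stV u\<close>, the first dart leading out of the vertices with stabilizer
  inside \<open>stV u\<close> gives one end of the pair; maximality of \<open>u\<close> gives the
  other.\<close>

lemma pair_exists:
  assumes "\<not> (\<exists>u\<in>V. \<forall>w\<in>V. stV w \<subseteq> stV u)"
  shows "\<exists>u ds w. pair u ds w"
proof -
  let ?N = "\<lambda>v. card (mod2 (stV v))"
  obtain v0 where "v0 \<in> V" using V_nonempty by blast
  moreover have "\<forall>y. y \<in> V \<longrightarrow> ?N y < Suc (2 ^ M)"
    using mod2_bound(2)[OF fab_stV] by (auto simp: le_imp_less_Suc)
  ultimately obtain u where u: "u \<in> V" and umax: "\<And>v. v \<in> V \<Longrightarrow> ?N v \<le> ?N u"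
    using ex_has_greatest_nat[of "\<lambda>v. v \<in> V" v0 ?N] by blast
  obtain w where w: "w \<in> V" "\<not> stV w \<subseteq> stV u" using assms u by blast
  obtain ds where ds: "walk u ds w" "reduced ds" using reduced_walk_exists[OF u w(1)] .
  have "ds \<noteq> []" using ds(1) w(2) by auto
  then have "\<exists>d\<in>set ds. \<not> stV (tgt d) \<subseteq> stV u" using walk_last[OF ds(1)] w(2) last_in_set by metis
  from split_list_first_prop[OF this]
  obtain xs d ys where d: "ds = xs @ d # ys" "\<not> stV (tgt d) \<subseteq> stV u"
    "\<forall>c\<in>set xs. stV (tgt c) \<subseteq> stV u" by blast
  have w': "walk u xs (src d)" "fst d \<in> E" using ds(1) d(1) by (auto simp: walk_append)
  have "stV (src d) \<subseteq> stV u"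
  proof (cases "xs = []")
    case False
    then show ?thesis using walk_last[OF w'(1)] d(3) last_in_set by metis
  qed (use w' in auto)
  then have dne: "stE (fst d) \<noteq> stV (tgt d)" using stE_subset_dart(1)[OF w'(2)] d(2) by blast
  \<comment> \<open>Otherwise the count could not decrease on the way to \<open>src d\<close> and
    would strictly increase at \<open>d\<close>, against the choice of \<open>u\<close>.\<close>
  have "\<exists>c\<in>set (xs @ [d]). stE (fst c) \<noteq> stV (src c)"
  proof (rule ccontr)
    assume "\<not> ?thesis"
    then have n: "stE (fst c) = stV (src c)" if "c \<in> set (xs @ [d])" for c using that by blast
    have mono: "?N v \<le> ?N v'" if "walk v zs v'" "\<And>c. c \<in> set zs \<Longrightarrow> stE (fst c) = stV (src c)" for v zs v'
      using that
    proof (induction zs arbitrary: v)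
      case (Cons c zs)
      then have c: "fst c \<in> E" "src c = v" "walk (tgt c) zs v'" "stE (fst c) = stV (src c)" by auto
      obtain \<rho> where "retraction (stE (fst c)) (stV (tgt c)) \<rho>" using retraction_dart(2)[OF c(1)] by blast
      then have "?N (src c) \<le> ?N (tgt c)"
        using mod2_retraction(1)[OF fab_stV subgroup_stE] c by (metis dart_closed(2))
      also have "\<dots> \<le> ?N v'" using Cons.IH[OF c(3)] Cons.prems(2) by simp
      finally show ?case using c(2) by simp
    qed simp
    have "?N u \<le> ?N (src d)" using mono[OF w'(1)] n by simp
    also obtain \<rho> where \<rho>: "retraction (stE (fst d)) (stV (tgt d)) \<rho>" using retraction_dart(2)[OF w'(2)] by blast
    have "?N (src d) < ?N (tgt d)"
      using mod2_retraction(2)[OF fab_stV subgroup_stE \<rho> dne] w'(2) n[of d] by simp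
    also have "\<dots> \<le> ?N u" using umax w'(2) by simp
    finally show False by simp
  qed
  then obtain c as bs where c: "xs @ [d] = as @ c # bs" "stE (fst c) \<noteq> stV (src c)"
    by (metis split_list)
  have "walk u (as @ c # bs) (tgt d)" using w' c(1) by (metis walk_append walk.simps dart_closed(2))
  then have "walk (src c) (c # bs) (tgt d)" by (auto simp: walk_append)
  moreover have "reduced (c # bs)"
  proof -
    have "reduced (xs @ [d])" using ds(2) d(1) reduced_append(1)[of "xs @ [d]" ys] by simp
    then show ?thesis using c(1) reduced_append(2)[of as "c # bs"] by metis
  qed
  moreover have "last (c # bs) = d" using c(1) by (metis last_appendR last_snoc list.discI)
  ultimately have "pair (src c) (c # bs) (tgt d)" using c(2) dne by (simp add: pair_def)
  then show ?thesis by blast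
qed

text \<open>In a shortest pair, an edge stabilizer smaller than that of an adjacent interior vertex
  would allow splitting off a shorter pair, either the initial or the final segment at that
  vertex.\<close>

lemma minimal_pair:
  assumes "pair u0 ds0 w0"
  obtains u ds w where "pair u ds w"
    "successively (\<lambda>a b. fst a \<noteq> fst b \<and> stE (fst a) = stV (tgt a) \<and> stE (fst b) = stV (tgt a)) ds"
proof -
  let ?P = "\<lambda>(u, ds, w). pair u ds w"
  have "?P (u0, ds0, w0)" using assms by simp
  from ex_has_least_nat[of ?P, OF this, of "\<lambda>(u, ds, w). length ds"]
  obtain p where p: "?P p" "\<forall>q. ?P q \<longrightarrow> (\<lambda>(u, ds, w). length ds) p \<le> (\<lambda>(u, ds, w). length ds) q" by blast
  obtain u ds w where "p = (u, ds, w)" by (cases p)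
  then have pair: "pair u ds w" and min: "\<And>u' ds' w'. pair u' ds' w' \<Longrightarrow> length ds \<le> length ds'"
    using p by auto
  have "fst a \<noteq> fst b \<and> stE (fst a) = stV (tgt a) \<and> stE (fst b) = stV (tgt a)" if s: "ds = xs @ a # b # ys" for xs a b ys
  proof -
    have w1: "walk u (xs @ [a]) (tgt a)" "walk (src b) (b # ys) w" "src b = tgt a"
      using pair s by (auto simp: pair_def walk_append)
    have red: "reduced (xs @ [a])" "reduced (b # ys)" "fst a \<noteq> fst b"
      using pair s by (auto simp: pair_def reduced_def successively_append_iff)
    have h: "hd (xs @ [a]) = hd ds" "last (b # ys) = last ds" using s by (auto simp: hd_append)
    have "stE (fst a) = stV (tgt a)"
    proof (rule ccontr)
      assume "stE (fst a) \<noteq> stV (tgt a)"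
      then have "pair u (xs @ [a]) (tgt a)" using w1 red h pair by (simp add: pair_def)
      then show False using min s by fastforce
    qed
    moreover have "stE (fst b) = stV (tgt a)"
    proof (rule ccontr)
      assume "stE (fst b) \<noteq> stV (tgt a)"
      then have "pair (src b) (b # ys) w" using w1 red h pair by (simp add: pair_def)
      then show False using min s by fastforce
    qed
    ultimately show ?thesis using red(3) by simp
  qed
  then have "successively (\<lambda>a b. fst a \<noteq> fst b \<and> stE (fst a) = stV (tgt a) \<and> stE (fst b) = stV (tgt a)) ds"
    unfolding successively_conv_nth by (metis Cons_nth_drop_Suc Suc_lessD append_take_drop_id)
  then show ?thesis using that pair by blast
qed

section \<open>Reversal and prolongation of tight walks\<close>

lemma tight_rev: "walk u ds w \<Longrightarrow> tight ds \<Longrightarrow> tight (rev (map flip ds))"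
proof (induction ds arbitrary: u)
  case (Cons d ds)
  show ?case
  proof (cases ds)
    case Nil
    then show ?thesis by (simp add: tight_def)
  next
    case (Cons b bs)
    then show ?thesis using Cons.IH[of "tgt d"] Cons.prems
      by (auto simp: tight_def successively_append_iff)
  qed
qed (simp add: tight_def)

lemma desc_walk_tight: "desc_walk R u ds w \<Longrightarrow> reduced ds \<Longrightarrow> tight ds"
proof (induction ds arbitrary: u)
  case (Cons d ds)
  then have "tight ds" by (auto simp: desc_walk_def reduced_def successively_Cons)
  then show ?case using Cons.prems by (cases ds) (auto simp: tight_def desc_walk_def reduced_def)
qed (simp add: tight_def)

lemma tight_append:
  assumes "tight xs" "tight ys"
    "xs \<noteq> [] \<Longrightarrow> ys \<noteq> [] \<Longrightarrow> fst (last xs) \<noteq> fst (hd ys) \<and>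
      (stE (fst (last xs)) = stV (tgt (last xs)) \<or> stE (fst (hd ys)) = stV (tgt (last xs)))"
  shows "tight (xs @ ys)"
  using assms by (auto simp: tight_def successively_append_iff)

lemma desc_reduced_walk:
  assumes "v \<in> desc R u"
  obtains g ds where "g \<in> carrier G" "desc_walk R (g \<cdot> u) ds v" "reduced ds"
proof -
  obtain g ds0 where g: "g \<in> carrier G" "desc_walk R (g \<cdot> u) ds0 v" using assms by (auto simp: desc_def)
  obtain ds where ds: "desc_walk R (g \<cdot> u) ds v"
    and min: "\<And>ds'. desc_walk R (g \<cdot> u) ds' v \<Longrightarrow> length ds \<le> length ds'"
    using ex_has_least_nat[of "\<lambda>ds. desc_walk R (g \<cdot> u) ds v", OF g(2), of length] by blast
  have "reduced ds"
  proof (rule ccontr)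
    assume "\<not> reduced ds"
    then obtain xs a b ys where x: "ds = xs @ a # b # ys" "fst a = fst b" using not_reduced by blast
    then have "desc_walk R (g \<cdot> u) (xs @ ys) v"
      using ds walk_cancel(2)[of "g \<cdot> u" xs a b ys v] by (auto simp: desc_walk_def)
    then show False using min x(1) by fastforce
  qed
  then show ?thesis using that g ds by blast
qed

text \<open>At \<open>w\<close> the first walk arrives through an edge with smaller stabilizer, the
  descending one through an edge with stabilizer \<open>stV w\<close>. So these edges differ, and
  the second one provides tightness at \<open>w\<close>.\<close>

lemma tight_append_desc:
  assumes ds: "walk u ds w" "tight ds" "ds \<noteq> []" "stE (fst (last ds)) \<noteq> stV w"
    and ds2: "desc_walk R v ds2 w" "reduced ds2"
  shows "tight (ds @ rev (map flip ds2))"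
proof (rule tight_append[OF ds(2)])
  have w2: "walk v ds2 w" using ds2(1) by (simp add: desc_walk_def)
  show "tight (rev (map flip ds2))" using tight_rev[OF w2] desc_walk_tight[OF ds2] by blast
  assume "rev (map flip ds2) \<noteq> []"
  then have ne: "ds2 \<noteq> []" by simp
  have h: "hd (rev (map flip ds2)) = flip (last ds2)" using ne by (simp add: hd_rev last_map)
  have e: "stE (fst (last ds2)) = stV w" using ds2(1) walk_last[OF w2 ne] ne by (simp add: desc_walk_def)
  have f: "fst (hd (rev (map flip ds2))) = fst (last ds2)" using h by simp
  show "fst (last ds) \<noteq> fst (hd (rev (map flip ds2))) \<and>
      (stE (fst (last ds)) = stV (tgt (last ds)) \<or> stE (fst (hd (rev (map flip ds2)))) = stV (tgt (last ds)))"
    unfolding f walk_last[OF ds(1,3)] using e ds(4) by metis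
qed

subsection \<open>The main theorem\<close>

lemma forest_single:
  assumes "e \<in> E" "\<And>f. f \<in> E \<Longrightarrow> f \<notin> orbE e \<Longrightarrow> \<not> conn (orbE e \<union> orbE f) V (ini f) (ter f)"
  shows "forest (orbE e)"
  using assms ginv_orbE by (auto simp: forest_def)

lemma conn_edge_ends:
  assumes "conn R V (tgt d) (src d)"
  shows "conn R V (ini (fst d)) (ter (fst d))"
  using assms conn_sym[OF subset_refl assms] by (cases "snd d") (simp_all add: src_def tgt_def)

text \<open>An element of the larger group is the conjugate of some \<open>c\<close> in the smaller
  one. Both lie in the larger group, which is abelian, so they commute and coincide.\<close>

lemma stV_conj_subset:
  assumes v: "v \<in> V" and g: "g \<in> carrier G" and sub: "stV v \<subseteq> stV (g \<cdot> v)"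
  shows "stV (g \<cdot> v) = stV v"
proof
  show "stV (g \<cdot> v) \<subseteq> stV v"
  proof
    fix y assume y: "y \<in> stV (g \<cdot> v)"
    then obtain c where c: "c \<in> stV v" "y = g \<otimes> c \<otimes> inv g" using stV_act'[OF g v] by auto
    have cc: "c \<in> carrier G" "y \<in> carrier G" using c y by (auto simp: stV_iff)
    have "c \<otimes> y = y \<otimes> c" using stV_comm[OF actV_closed[OF g v] _ y] sub c(1) by blast
    then have "c = y" by (rule commuting_conjugates[OF cc g _ c(2)[symmetric]])
    then show "y \<in> stV v" using c by simp
  qed
qed (rule sub)

lemma desc_stV_subset:
  assumes "v \<in> desc R u"
  obtains g where "g \<in> carrier G" "stV v \<subseteq> stV (g \<cdot> u)"
proof -
  obtain g ds where g: "g \<in> carrier G" "desc_walk R (g \<cdot> u) ds v" using assms by (auto simp: desc_def)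
  have "stV v \<subseteq> stV u'" if "desc_walk R u' ds v" for u'
    using that
  proof (induction ds arbitrary: u')
    case (Cons d ds)
    then have d: "fst d \<in> E" "src d = u'" "stE (fst d) = stV (tgt d)" "desc_walk R (tgt d) ds v"
      by (auto simp: desc_walk_def)
    then show ?case using Cons.IH[OF d(4)] stE_subset_dart(1)[OF d(1)] by simp
  qed (simp add: desc_walk_def)
  then show ?thesis using that g by blast
qed

text \<open>If \<open>fst a\<close> were the \<open>k\<close>-translate of \<open>fst b\<close>, the
  part between them could be skipped by continuing with the \<open>k\<close>-translate of the rest,
  starting before or after \<open>b\<close> according to the direction of traversal.\<close>

lemma shortest_walk_distinct:
  assumes R: "ginv R" and w: "w \<in> V"
    and ds: "walk u (xs @ a # ys @ b # zs) (s \<cdot> w)" "avoids (xs @ a # ys @ b # zs) R" "s \<in> carrier G"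
    and short: "\<And>s' ds'. s' \<in> carrier G \<Longrightarrow> walk u ds' (s' \<cdot> w) \<Longrightarrow> avoids ds' R \<Longrightarrow>
      length (xs @ a # ys @ b # zs) \<le> length ds'"
  shows "fst a \<notin> orbE (fst b)"
proof
  assume "fst a \<in> orbE (fst b)"
  then obtain k where k: "k \<in> carrier G" "fst a = k \<star> fst b" by (auto simp: orbE_def)
  have w1: "walk u xs (src a)" "walk (src b) (b # zs) (s \<cdot> w)" "walk (tgt b) zs (s \<cdot> w)" "fst b \<in> E"
    using ds(1) by (auto simp: walk_append)
  have av: "avoids xs R" "avoids (b # zs) R" "avoids zs R" using ds(2) by auto
  have shorten: False if "walk v cs (s \<cdot> w)" "avoids cs R" "src a = k \<cdot> v" "length cs \<le> Suc (length zs)" for v cs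
  proof -
    have "walk (k \<cdot> v) (map (actD k) cs) ((k \<otimes> s) \<cdot> w)" using walk_act[OF k(1) that(1)] k ds(3) w by (simp add: actV_mult)
    then have "walk u (xs @ map (actD k) cs) ((k \<otimes> s) \<cdot> w)" using w1(1) that(3) by (auto simp: walk_append)
    moreover have "avoids (xs @ map (actD k) cs) R" using av(1) avoids_act[OF R k(1) that(1)] that(2) by simp
    ultimately show False using short[of "k \<otimes> s"] k ds(3) that(4) by fastforce
  qed
  have "src a \<in> {k \<cdot> src b, k \<cdot> tgt b}"
    using dart_ends[of a] dart_ends[of "actD k b"] k w1(4) by auto
  then show False using shorten[OF w1(2) av(2)] shorten[OF w1(3) av(3)] by auto
qed

text \<open>The amalgam is taken over the first edge of a minimal pair. Beside \<open>u\<close> its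
  stabilizer is proper, so a nonzero homomorphism kills it. If it is proper at \<open>tgt d\<close>
  too, the same works there; otherwise zero is put on the vertices descending from
  \<open>tgt d\<close>, which do not include \<open>w\<close>, and a nonzero homomorphism beyond
  them.\<close>

lemma maps_onto_F2_tree_quotient:
  assumes sep: "\<And>e. e \<in> E \<Longrightarrow> \<not> conn (orbE e) V (ini e) (ter e)"
    and big: "\<not> (\<exists>u\<in>V. \<forall>w\<in>V. stV w \<subseteq> stV u)"
  shows maps_onto_F2
proof -
  obtain u0 ds0 w0 where p0: "pair u0 ds0 w0" using pair_exists[OF big] by blast
  obtain u ds w where p: "pair u ds w"
    and t: "successively (\<lambda>a b. fst a \<noteq> fst b \<and> stE (fst a) = stV (tgt a) \<and> stE (fst b) = stV (tgt a)) ds"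
    by (rule minimal_pair[OF p0]) (rule that; assumption)
  have td: "tight ds" unfolding tight_def by (rule successively_mono[OF t]) auto
  obtain d rest where ds: "ds = d # rest" using p by (cases ds) (auto simp: pair_def)
  have d: "fst d \<in> E" "src d = u" "walk (tgt d) rest w" "stE (fst d) \<noteq> stV u"
    using p ds by (auto simp: pair_def)
  have V: "u \<in> V" "tgt d \<in> V" "w \<in> V" using d walk_closed by auto
  let ?z = "tgt d"
  let ?R = "orbE (fst d)"
  have gR: "ginv ?R" using ginv_orbE d(1) by blast
  have R: "forest ?R"
  proof (rule forest_single[OF d(1)])
    show "\<not> conn (?R \<union> orbE f) V (ini f) (ter f)" if "f \<in> E" for f
      using sep[OF that] conn_mono[of "?R \<union> orbE f" V "ini f" "ter f" "orbE f" V] by auto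
  qed
  have nc: "\<not> conn ?R V ?z u"
    using sep[OF d(1)] d(2) conn_edge_ends[of ?R d] by blast
  have trest: "tight rest" using td ds by (auto simp: tight_def successively_Cons)
  have zst: "stE (fst d) = stV ?z" "fst d \<noteq> fst (hd rest)" if "rest \<noteq> []"
    using t ds that by (auto simp: successively_Cons)
  \<comment> \<open>As \<open>d\<close> is a bridge, the first return to its orbit starts from a
    translate of \<open>tgt d\<close>, so the part before it is tight and closed modulo the action,
    hence empty. Then \<open>g\<close> fixes \<open>tgt d\<close> and therefore
    \<open>fst d\<close>, against reducedness.\<close>
  have av: "avoids rest ?R"
  proof (rule ccontr)
    assume "\<not> avoids rest ?R"
    then have "\<exists>b\<in>set rest. fst b \<in> ?R" by (auto simp: avoids_def)
    from split_list_first_prop[OF this] obtain xs b ys where b: "rest = xs @ b # ys" "fst b \<in> ?R"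
      "\<forall>x\<in>set xs. fst x \<notin> ?R" by blast
    obtain g where g: "g \<in> carrier G" "fst b = g \<star> fst d" using b(2) by (auto simp: orbE_def)
    have xs: "walk ?z xs (src b)" "avoids xs ?R" using d(3) b by (auto simp: walk_append avoids_def)
    have "src b \<in> {g \<cdot> src d, g \<cdot> ?z}"
      using dart_ends[of b] dart_ends[of "actD g d"] g d(1) by auto
    moreover have "src b \<noteq> g \<cdot> src d"
    proof
      assume "src b = g \<cdot> src d"
      then have "conn ?R V ?z (g \<cdot> u)" using conn_walk[OF xs] d(2) by simp
      also have "conn ?R V (g \<cdot> u) u" using conn_sym[of V] conn_act[of u V g ?R] g V by simp
      finally show False using nc by blast
    qed
    ultimately have sb: "src b = g \<cdot> ?z" by simp
    have r: "rest \<noteq> []" using b by simp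
    show False
    proof (cases "xs = []")
      case True
      then have "g \<cdot> ?z = ?z" using xs sb by simp
      then have "g \<in> stE (fst d)" using g zst(1)[OF r] by (simp add: stV_iff)
      then have "fst b = fst d" using g by (simp add: stE_iff)
      then show False using zst(2)[OF r] b True by simp
    next
      case False
      have "tight xs" using trest b by (auto simp: tight_def successively_append_iff)
      then show False using tight_not_closed[OF R _ xs(2) False g(1)] xs(1) sb by simp
    qed
  qed
  obtain \<psi> x where \<psi>: "adm u \<psi>" "\<forall>y\<in>stE (fst d). \<psi> y = 0" "\<psi> x \<noteq> 0"
    using kill_exists[of "flip d"] d by (metis dart_simps(1,3))
  have "\<exists>P \<beta> v \<alpha> y. good ?R P \<and> (?z, \<beta>) \<in> P \<and> (\<forall>y\<in>stE (fst d). \<beta> y = 0) \<and> (v, \<alpha>) \<in> P \<and> \<alpha> y \<noteq> 0 \<and>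
    (\<forall>a\<in>fst ` P. conn ?R V ?z a)"
  proof (cases "stE (fst d) = stV ?z")
    case False
    obtain \<beta> y where \<beta>: "adm ?z \<beta>" "\<forall>y\<in>stE (fst d). \<beta> y = 0" "\<beta> y \<noteq> 0" by (rule kill_exists[OF d(1) False])
    let ?P = "{} \<union> orbP ?z \<beta>"
    have "good ?R ?P" by (rule good_step[OF R good_empty V(2) _ \<beta>(1)]) auto
    moreover have "(?z, \<beta>) \<in> ?P" using orbP_self[OF V(2) \<beta>(1)] by simp
    moreover have "\<forall>a\<in>fst ` ?P. conn ?R V ?z a" using conn_act[OF V(2)] V by (auto simp: orbP_def)
    ultimately show ?thesis using \<beta> by blast
  next
    case True
    have rne: "rest \<noteq> []"
    proof
      assume "rest = []"
      then have "stE (fst d) \<noteq> stV w" "?z = w" using p ds d(3) by (auto simp: pair_def)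
      then show False using True by simp
    qed
    \<comment> \<open>A descending walk from a translate of \<open>tgt d\<close> to
      \<open>w\<close>, reversed and put after \<open>rest\<close>, would be tight and closed modulo
      the action.\<close>
    have "w \<notin> desc ?R ?z"
    proof
      assume "w \<in> desc ?R ?z"
      then obtain g ds2 where g: "g \<in> carrier G" "desc_walk ?R (g \<cdot> ?z) ds2 w" "reduced ds2"
        by (rule desc_reduced_walk)
      have "stE (fst (last rest)) \<noteq> stV w" using p ds rne by (simp add: pair_def)
      then have "tight (rest @ rev (map flip ds2))" using tight_append_desc[OF d(3) trest rne _ g(2,3)] by blast
      moreover have "walk ?z (rest @ rev (map flip ds2)) (g \<cdot> ?z)"
        using d(3) walk_rev g(2) by (auto simp: walk_append desc_walk_def)
      moreover have "avoids (rest @ rev (map flip ds2)) ?R" using av g(2) by (simp add: desc_walk_def)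
      ultimately show False using tight_not_closed[OF R _ _ _ g(1)] rne by blast
    qed
    with nonzero_family_off_desc[OF R V(2) conn_walk[OF d(3) av]]
    obtain P v \<alpha> y where P: "good ?R P" "\<And>a. a \<in> desc ?R ?z \<Longrightarrow> (a, \<lambda>_. 0) \<in> P" "(v, \<alpha>) \<in> P" "\<alpha> y \<noteq> 0"
      "\<And>a. a \<in> fst ` P \<Longrightarrow> conn ?R V ?z a" by blast
    then show ?thesis using desc_self[OF V(2), of ?R]
      by (intro exI[of _ P] exI[of _ "\<lambda>_. 0"] exI[of _ v] exI[of _ \<alpha>] exI[of _ y]) auto
  qed
  then obtain P \<beta> v \<alpha> y where P: "good ?R P" "(?z, \<beta>) \<in> P" "\<forall>y\<in>stE (fst d). \<beta> y = 0" "(v, \<alpha>) \<in> P" "\<alpha> y \<noteq> 0"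
    "\<And>a. a \<in> fst ` P \<Longrightarrow> conn ?R V ?z a" by blast
  let ?Q = "P \<union> orbP u \<psi>"
  \<comment> \<open>The domain of \<open>P\<close> lies on the far side of the bridge, so the orbit
    of \<open>u\<close> can be added with any homomorphism.\<close>
  have nP: "\<not> conn ?R V a u" if "a \<in> fst ` P" for a
    using P(6)[OF that] nc conn_trans by blast
  have "u \<notin> fst ` P" using nP[of u] by auto
  then have Q: "good ?R ?Q" using nP by (intro good_step[OF R P(1) V(1) _ \<psi>(1)] disjI2 ballI) blast+
  have uQ: "(u, \<psi>) \<in> ?Q" using orbP_self[OF V(1) \<psi>(1)] by simp
  have vz: "conn ?R V ?z v" using P(4,6) by force
  show ?thesis
  proof (cases "snd d")
    case True
    then have "u = ini (fst d)" "?z = ter (fst d)" using d(2) by (auto simp: src_def tgt_def)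
    then show ?thesis
      using maps_onto_F2_amalgam_good[OF d(1) sep[OF d(1)] R Q, of \<psi> \<beta> u \<psi> x v \<alpha> y] uQ P vz \<psi> by auto
  next
    case False
    then have "?z = ini (fst d)" "u = ter (fst d)" using d(2) by (auto simp: src_def tgt_def)
    then show ?thesis
      using maps_onto_F2_amalgam_good[OF d(1) sep[OF d(1)] R Q, of \<beta> \<psi> v \<alpha> y u \<psi> x] uQ P vz \<psi> by auto
  qed
qed

text \<open>By \<open>full\<close>, edges on the cycle have the same stabilizer as their ends, so
  \<open>ter e\<close> descends from \<open>ini e\<close> and a family that is zero on the
  descending set kills \<open>e\<close>. The HNN criterion applies if something lies outside that
  set; if nothing does, the existence of a pair is contradicted.\<close>

lemma maps_onto_F2_unicyclic_quotient:
  assumes e: "e \<in> E" "conn (orbE e) V (ini e) (ter e)" and R: "forest (orbE e)"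
    and full: "\<And>d. fst d \<in> E \<Longrightarrow> conn (orbE (fst d)) V (src d) (tgt d) \<Longrightarrow> stE (fst d) = stV (tgt d)"
    and big: "\<not> (\<exists>u\<in>V. \<forall>w\<in>V. stV w \<subseteq> stV u)"
  shows maps_onto_F2
proof -
  let ?R = "orbE e"
  let ?x = "ini e"
  have gR: "ginv ?R" using R by (simp add: forest_def)
  have xV: "?x \<in> V" using e by simp
  have ter_desc: "ter e \<in> desc ?R ?x"
  proof -
    obtain s ds where ds: "s \<in> carrier G" "walk ?x ds (s \<cdot> ter e)" "avoids ds ?R"
      and short: "\<And>s' ds'. s' \<in> carrier G \<Longrightarrow> walk ?x ds' (s' \<cdot> ter e) \<Longrightarrow> avoids ds' ?R \<Longrightarrow> length ds \<le> length ds'"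
      by (rule shortest_walk[OF e(2) xV gR]) (rule that; assumption)
    \<comment> \<open>A shortest walk meets the orbit of each of its edges once, so the rest of the
      walk together with \<open>e\<close> bypasses \<open>d\<close>. Thus \<open>d\<close> is
      nonseparating and \<open>full\<close> applies to it.\<close>
    have "stE (fst d) = stV (tgt d)" if d: "d \<in> set ds" for d
    proof -
      obtain xs ys where xy: "ds = xs @ d # ys" using split_list[OF d] by blast
      have dE: "fst d \<in> E" "fst d \<notin> ?R" using walk_edges[OF ds(2) d] ds(3) d by (auto simp: avoids_def)
      let ?S = "orbE (fst d)"
      have "fst a \<notin> ?S" if a: "a \<in> set xs" for a
      proof -
        obtain as bs where ab: "xs = as @ a # bs" using split_list[OF a] by blast
        show ?thesis
          using shortest_walk_distinct[OF gR ter_closed[OF e(1)], of ?x as a bs d ys s] ds short xy ab by simp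
      qed
      then have avx: "avoids xs ?S" by (auto simp: avoids_def)
      have "fst a \<notin> ?S" if a: "a \<in> set ys" for a
      proof
        assume "fst a \<in> ?S"
        obtain as bs where ab: "ys = as @ a # bs" using split_list[OF a] by blast
        have aE: "fst a \<in> E" using walk_edges[OF ds(2)] a xy by simp
        have "fst d \<notin> orbE (fst a)"
          using shortest_walk_distinct[OF gR ter_closed[OF e(1)], of ?x xs d as a bs s] ds short xy ab by simp
        then show False using orbE_disjoint[OF aE dE(1)] \<open>fst a \<in> ?S\<close> orbE_self[OF aE] by blast
      qed
      then have avy: "avoids ys ?S" by (auto simp: avoids_def)
      have w: "walk ?x xs (src d)" "walk (tgt d) ys (s \<cdot> ter e)" using ds(2) xy by (auto simp: walk_append)
      have "e \<notin> ?S" using orbE_disjoint[OF e(1) dE] e(1) by simp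
      then have "conn ?S V (ini e) (ter e)" using e(1) by (intro conn_edge) auto
      moreover have "conn ?S V (ter e) (s \<cdot> ter e)" using conn_act[of "ter e" V s ?S] e ds(1) by simp
      moreover have "conn ?S V (s \<cdot> ter e) (tgt d)" using conn_sym[OF subset_refl conn_walk[OF w(2) avy]] .
      moreover have "conn ?S V (src d) ?x" using conn_sym[OF subset_refl conn_walk[OF w(1) avx]] .
      ultimately have "conn ?S V (src d) (tgt d)" using conn_trans by metis
      then show ?thesis using full dE by blast
    qed
    then have "desc_walk ?R (\<one> \<cdot> ?x) ds (s \<cdot> ter e)" using ds xV by (simp add: desc_walk_def)
    then have "s \<cdot> ter e \<in> desc ?R ?x" unfolding desc_def by blast
    then have "inv s \<cdot> s \<cdot> ter e \<in> desc ?R ?x" using desc_act[OF gR xV, of "inv s"] ds(1) by simp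
    then show ?thesis using ds(1) e by simp
  qed
  show ?thesis
  proof (cases "V \<subseteq> desc ?R ?x")
    case False
    then obtain w where w: "w \<in> V" "w \<notin> desc ?R ?x" by blast
    obtain P v \<alpha> y where P: "good ?R P" "\<And>a. a \<in> desc ?R ?x \<Longrightarrow> (a, \<lambda>_. 0) \<in> P" "(v, \<alpha>) \<in> P" "\<alpha> y \<noteq> 0"
      by (rule nonzero_family_off_desc[OF R xV conn_all[OF e w(1)] w(2)]) (rule that; assumption)
    have "(ini e, \<lambda>_. 0) \<in> P" "(ter e, \<lambda>_. 0) \<in> P" using P(2) ter_desc desc_self[OF xV] by auto
    then show ?thesis using maps_onto_F2_HNN_good[OF e R P(1) _ _ _ _ P(3,4)] by simp
  next
    case True
    obtain u0 ds0 w0 where p0: "pair u0 ds0 w0" using pair_exists[OF big] by blast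
    obtain u ds w where p: "pair u ds w"
      and t: "successively (\<lambda>a b. fst a \<noteq> fst b \<and> stE (fst a) = stV (tgt a) \<and> stE (fst b) = stV (tgt a)) ds"
      by (rule minimal_pair[OF p0]) (rule that; assumption)
    have td: "tight ds" unfolding tight_def by (rule successively_mono[OF t]) auto
    have ds: "walk u ds w" "ds \<noteq> []" "stE (fst (hd ds)) \<noteq> stV u" "stE (fst (last ds)) \<noteq> stV w"
      using p by (auto simp: pair_def)
    have V: "u \<in> V" "w \<in> V" using walk_closed ds by auto
    have const: "stE (fst c) = stE (fst (hd cs))"
      if "successively (\<lambda>a b. fst a \<noteq> fst b \<and> stE (fst a) = stV (tgt a) \<and> stE (fst b) = stV (tgt a)) cs"
        "c \<in> set cs" for c cs
      using that by (induction cs) (auto simp: successively_Cons)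
    \<comment> \<open>All edges of \<open>ds\<close> have one common stabilizer. A translate of
      \<open>e\<close> among them would make it the stabilizer of a translate of
      \<open>ini e\<close>, properly contained in \<open>stV u\<close>; but \<open>stV u\<close>
      lies in a conjugate of that group, and nested conjugates coincide.\<close>
    have av: "avoids ds ?R"
    proof (rule ccontr)
      assume "\<not> avoids ds ?R"
      then obtain c where c: "c \<in> set ds" "fst c \<in> ?R" by (auto simp: avoids_def)
      obtain g where g: "g \<in> carrier G" "fst c = g \<star> e" using c(2) by (auto simp: orbE_def)
      have "stE e = stV ?x"
        using full[of "(e, False)"] e conn_sym[OF subset_refl e(2)] by (simp add: src_def tgt_def)
      then have "stE (fst c) = stV (g \<cdot> ?x)" using g stE_act' stV_act' e by simp
      then have C: "stE (fst (hd ds)) = stV (g \<cdot> ?x)" using const[OF t c(1)] by simp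
      have hE: "fst (hd ds) \<in> E" "src (hd ds) = u" using walk_edges[OF ds(1)] walk_hd[OF ds(1,2)] ds(2) by auto
      have sub: "stV (g \<cdot> ?x) \<subset> stV u" using stE_subset_dart(1)[OF hE(1)] hE(2) C ds(3) by auto
      obtain h where h: "h \<in> carrier G" "stV u \<subseteq> stV (h \<cdot> ?x)" using desc_stV_subset True V(1) by blast
      have hx: "h \<cdot> ?x = (h \<otimes> inv g) \<cdot> g \<cdot> ?x" using h g xV by (simp add: actV_mult)
      have "stV ((h \<otimes> inv g) \<cdot> g \<cdot> ?x) = stV (g \<cdot> ?x)"
        using stV_conj_subset[of "g \<cdot> ?x" "h \<otimes> inv g"] sub h g xV hx by simp
      then show False using sub h(2) hx by auto
    qed
    obtain g1 ds1 where g1: "g1 \<in> carrier G" "desc_walk ?R (g1 \<cdot> ?x) ds1 u" "reduced ds1"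
      using desc_reduced_walk True V(1) by blast
    obtain g2 ds2 where g2: "g2 \<in> carrier G" "desc_walk ?R (g2 \<cdot> ?x) ds2 w" "reduced ds2"
      using desc_reduced_walk True V(2) by blast
    \<comment> \<open>Descending walks from translates of \<open>ini e\<close> prolong the pair at
      both ends, which closes it up in the quotient while keeping it tight.\<close>
    let ?ds = "ds1 @ (ds @ rev (map flip ds2))"
    have w1: "walk (g1 \<cdot> ?x) ds1 u" using g1 by (simp add: desc_walk_def)
    have "tight ?ds"
    proof (rule tight_append[OF desc_walk_tight[OF g1(2,3)] tight_append_desc[OF ds(1) td ds(2,4) g2(2,3)]])
      assume "ds1 \<noteq> []"
      then have "stE (fst (last ds1)) = stV u" "tgt (last ds1) = u"
        using g1(2) walk_last[OF w1] by (auto simp: desc_walk_def)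
      moreover have "hd (ds @ rev (map flip ds2)) = hd ds" using ds(2) by simp
      ultimately show "fst (last ds1) \<noteq> fst (hd (ds @ rev (map flip ds2))) \<and>
        (stE (fst (last ds1)) = stV (tgt (last ds1)) \<or>
         stE (fst (hd (ds @ rev (map flip ds2)))) = stV (tgt (last ds1)))"
        using ds(3) by metis
    qed
    moreover have "walk (g1 \<cdot> ?x) ?ds (g2 \<cdot> ?x)"
      using w1 ds(1) walk_rev g2(2) unfolding walk_append desc_walk_def by blast
    then have "walk (g1 \<cdot> ?x) ?ds ((g2 \<otimes> inv g1) \<cdot> g1 \<cdot> ?x)" using g1 g2 xV by (simp add: actV_mult)
    moreover have "avoids ?ds ?R" using av g1(2) g2(2) by (simp add: desc_walk_def)
    ultimately show ?thesis
      using tight_not_closed[OF R, of "g1 \<cdot> ?x" ?ds "g2 \<otimes> inv g1"] ds(2) g1(1) g2(1) by simp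
  qed
qed

text \<open>Assuming that there is no such map supplies the standing facts of the cyclic case:
  removing a nonseparating edge leaves a forest, and its stabilizer equals those of both
  ends.\<close>

lemma maps_onto_F2_if_not_solvable:
  assumes ns: "\<not> solvable G"
  shows maps_onto_F2
proof (rule ccontr)
  assume no: "\<not> maps_onto_F2"
  have forest: "forest (orbE e)" if e: "e \<in> E" "conn (orbE e) V (ini e) (ter e)" for e
  proof (rule forest_single[OF e(1)])
    show "\<not> conn (orbE e \<union> orbE f) V (ini f) (ter f)" if "f \<in> E" "f \<notin> orbE e" for f
      using maps_onto_F2_two_cycles[OF e(1) that e(2)] no by blast
  qed
  have full: "stE (fst d) = stV (tgt d)"
    if d: "fst d \<in> E" "conn (orbE (fst d)) V (src d) (tgt d)" for d
  proof (rule ccontr)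
    assume n: "stE (fst d) \<noteq> stV (tgt d)"
    have c: "conn (orbE (fst d)) V (tgt d) (src d)" using conn_sym[OF subset_refl d(2)] .
    have "conn (orbE (fst d)) V (ini (fst d)) (ter (fst d))"
      using d(2) c by (cases "snd d") (auto simp: src_def tgt_def)
    from maps_onto_F2_if_small_nonseparating[of "flip d"] forest[OF d(1) this] d c n no
    show False by simp
  qed
  show False
  proof (cases "\<exists>e\<in>E. conn (orbE e) V (ini e) (ter e)")
    case True
    then obtain e where e: "e \<in> E" "conn (orbE e) V (ini e) (ter e)" by blast
    have "\<not> (\<exists>u\<in>V. \<forall>w\<in>V. stV w \<subseteq> stV u)"
      using solvable_unicyclic_quotient[OF e forest[OF e]] ns by blast
    then show False using maps_onto_F2_unicyclic_quotient[OF e forest[OF e] full] no by blast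
  next
    case False
    then have sep: "\<not> conn (orbE e) V (ini e) (ter e)" if "e \<in> E" for e using that by blast
    then have "forest {}" by (auto simp: forest_def ginv_empty)
    then have "\<not> (\<exists>u\<in>V. \<forall>w\<in>V. stV w \<subseteq> stV u)" using solvable_tree_quotient ns by blast
    then show False using maps_onto_F2_tree_quotient[OF sep] no by blast
  qed
qed

end

theorem theorem5p1:
  fixes G :: "('g, 'b) monoid_scheme"
    and V :: "'v set" and E :: "'e set"
    and ini ter :: "'e \<Rightarrow> 'v"
    and \<phi>V :: "'g \<Rightarrow> 'v \<Rightarrow> 'v" and \<phi>E :: "'g \<Rightarrow> 'e \<Rightarrow> 'e"
    and M :: nat
  assumes "group G"
    and "is_tree V E ini ter"
    and "graph_action G V E ini ter \<phi>V \<phi>E"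
    and "\<forall>v\<in>V. free_abelian_rank_le (G\<lparr>carrier := stabilizer G \<phi>V v\<rparr>) M"
    and "\<forall>e\<in>E. direct_factor G (stabilizer G \<phi>E e) (stabilizer G \<phi>V (ini e)) \<and>
                direct_factor G (stabilizer G \<phi>E e) (stabilizer G \<phi>V (ter e))"
    and "\<forall>x\<in>carrier G. \<forall>y\<in>carrier G. \<forall>z\<in>carrier G.
           x \<otimes>\<^bsub>G\<^esub> y = y \<otimes>\<^bsub>G\<^esub> x \<and> z \<otimes>\<^bsub>G\<^esub> x \<otimes>\<^bsub>G\<^esub> inv\<^bsub>G\<^esub> z = y \<longrightarrow> x = y"
    and "\<not> solvable G"
  shows "\<exists>h. h \<in> hom G free_group_F2 \<and> h ` carrier G = carrier free_group_F2"
proof -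
  interpret tree_action G V E ini ter \<phi>V \<phi>E
    using assms(1-3) by (simp add: tree_action_def tree_action_axioms_def)
  have fab: "fab M (stabilizer G \<phi>V v)" if "v \<in> V" for v
    using fab_if_free_abelian subgroup_stV assms(4) that by blast
  have retr: "\<exists>\<rho>. retraction (stabilizer G \<phi>E e) (stabilizer G \<phi>V v) \<rho>"
    if "e \<in> E" "v = ini e \<or> v = ter e" for e v
  proof -
    have v: "v \<in> V" using that by auto
    have "direct_factor G (stabilizer G \<phi>E e) (stabilizer G \<phi>V v)" using assms(5) that by auto
    then show ?thesis
      using retraction_if_direct_factor(2)[OF subgroup_stV[OF v]] fab_comm[OF fab[OF v]] by blast
  qed
  interpret abelian_tree_action G V E ini ter \<phi>V \<phi>E M
  proof
    show "\<And>v. v \<in> V \<Longrightarrow> fab M (stabilizer G \<phi>V v)" by (rule fab)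
    show "\<And>e. e \<in> E \<Longrightarrow> \<exists>\<rho>. retraction (stabilizer G \<phi>E e) (stabilizer G \<phi>V (ini e)) \<rho>"
      by (simp add: retr)
    show "\<And>e. e \<in> E \<Longrightarrow> \<exists>\<rho>. retraction (stabilizer G \<phi>E e) (stabilizer G \<phi>V (ter e)) \<rho>"
      by (simp add: retr)
    show "x = y" if "x \<in> carrier G" "y \<in> carrier G" "z \<in> carrier G"
      "x \<otimes>\<^bsub>G\<^esub> y = y \<otimes>\<^bsub>G\<^esub> x" "z \<otimes>\<^bsub>G\<^esub> x \<otimes>\<^bsub>G\<^esub> inv\<^bsub>G\<^esub> z = y" for x y z
      using assms(6) that by blast
  qed
  show ?thesis using maps_onto_F2_if_not_solvable[OF assms(7)] by (simp add: maps_onto_F2_def)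
qed

end
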